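(* Suppose that the roof function $f:\mathcal{X}\to\mathbb{R}$ is Lipschitz with $f(x)>1$ for all $x\in\mathcal{X}$, and let $\{\mathcal{I}_n\}_{n\in\mathbb{N}}$, $\mathcal{I}_n\subset\mathcal{X}$, be a sequence of open sets satisfying the nested condition with $\bigcap_{n\in\mathbb{N}}\mathcal{I}_n=\{z\}$, $z\in\mathcal{X}$. Then $$\lim_{n\to\infty}\frac{R(\mathcal{I}_n\times\{0\})}{\nu(\mathcal{I}_n\times[0,1])}\ \ge\ \begin{cases}\dfrac{1}{W} & \text{if } z \text{ is not periodic},\\[2mm] \dfrac{1-\exp\left(\sum_{k=0}^{p-1}\varphi(\sigma^k z)-p\,P(\varphi)\right)}{W} & \text{if } z \text{ has prime period } p,\end{cases}$$ where $W=W(f)=1+\dfrac{\|f\|}{\int f\,d\mu}\in[2,\infty)$ and $\|f\|=\sup_{x\in\mathcal{X}}|f(x)|$.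
   Context: Subshift. Let $A$ be an $a\times a$ matrix of zeros and ones ($a\ge 2$) such that $A^d>0$ entrywise for some $d\in\mathbb{N}$. Let $\mathcal{X}=\{(x_n)_{n\ge 0}\in\{1,\dots,a\}^{\mathbb{Z}^{\ge 0}}: A(x_n,x_{n+1})=1\ \forall n\ge 0\}$ with shift $\sigma(x)_n=x_{n+1}$. Fix $\theta\in(0,1)$; the metric on $\mathcal{X}$ is $d_\theta(x,y)=\theta^m$ with $m=\inf\{n\ge 0:x_n\ne y_n\}$ for $x\neq y$, and $d_\theta(x,x)=0$. Functions on $\mathcal{X}$ are called Lipschitz or H\"older with respect to $d_\theta$. For $x\in\mathcal{X}$, $n\in\mathbb{N}$, the cylinder of length $n$ is $[x]_n=\{y\in\mathcal{X}:y_i=x_i,\ 0\le i\le n-1\}$. Measure on $\mathcal{X}$. Let $\varphi:\mathcal{X}\to\mathbb{R}$ be H\"older and let $\mu$ be its (unique) equilibrium state, i.e. the $\sigma$-invariant Borel probability measure attaining the supremum of $h_m(\mathcal{X})+\int\varphi\,dm$ over all $\sigma$-invariant Borel probability measures $m$, where $h_m(\mathcal{X})$ is the measure-theoretic entropy of $\sigma$ with respect to $m$. Put $P(\varphi)=h_\mu(\mathcal{X})+\int\varphi\,d\mu$. Special semi-flow. Let $\Lambda=\{(x,t):x\in\mathcal{X},\ 0\le t<f(x)\}$ and define the semi-flow $(\Phi^t)_{t\ge 0}$ on $\Lambda$ by $$\Phi^t(x,s)=\Big(\sigma^m x,\ s+t-\sum_{k=0}^{m-1}f(\sigma^k x)\Big)\quad\text{for}\quad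 \sum_{k=0}^{m-1}f(\sigma^kx)\le s+t<\sum_{k=0}^{m}f(\sigma^kx),\ m\in\mathbb{Z}^{\ge 0}.$$ The $\Phi^t$-invariant ergodic probability measure on $\Lambda$ is $\nu=\frac{\mu\times \mathrm{Leb}}{\int f\,d\mu}$ (restricted to $\Lambda$), where $\mathrm{Leb}$ is Lebesgue measure. Escape rate. For $\mathcal{U}\subset\Lambda$, $$R(\mathcal{U})=-\limsup_{t\to+\infty}\frac1t\log\nu\Big\{(x,l)\in\Lambda:\ \bigcup_{0<s<t}\{\Phi^s(x,l)\}\cap\mathcal{U}=\emptyset\Big\}.$$ Nested condition. A family of open sets $\{\mathcal{I}_n\}$, $\mathcal{I}_n\subset\mathcal{X}$, satisfies the nested condition if: (1) each $\mathcal{I}_n$ is a finite union of cylinders, each of length $n$; (2) $\mathcal{I}_{n+1}\subset\mathcal{I}_n$ for all $n\in\mathbb{N}$ and $\bigcap_{n}\mathcal{I}_n=\{z\}$ for some $z\in\mathcal{X}$; (3) there are constants $c>0$ and $0<\rho<1$ with $\mu(\mathcal{I}_n)\le c\rho^n$ for all $n\in\mathbb{N}$; (4) there are a sequence $\{l_n\}\subset\mathbb{N}$ and a constant $\kappa>0$ with $\kappa<l_n/n\le 1$ and $\mathcal{I}_n\subset[z]_{l_n}$ for all $n\in\mathbb{N}$; (5) if $\sigma^p(z)=z$ has prime period $p$, then $\sigma^{-p}(\mathcal{I}_n)\cap[z]_p\subset\mathcal{I}_n$ for all large enough $n$. *)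

theory Defs
  imports "HOL-Probability.Probability"
begin

text \<open>The alphabet is a finite type \<open>'s\<close>, so that a transition matrix is a square matrix indexed
  by \<open>'s\<close> and a point of the subshift is a function \<open>nat \<Rightarrow> 's\<close>.\<close>

definition aperiodic_01_matrix :: "nat ^ 's ^ 's \<Rightarrow> bool" where
  "aperiodic_01_matrix A \<longleftrightarrow>
     (\<forall>i j. A $ i $ j \<in> {0, 1}) \<and>
     (\<exists>d\<ge>1. \<forall>i j. (((**) A ^^ d) (mat 1)) $ i $ j > 0)"

definition subshift :: "nat ^ 's ^ 's \<Rightarrow> (nat \<Rightarrow> 's) set" where
  "subshift A = {x. \<forall>n. A $ x n $ x (Suc n) = 1}"

definition shift_map :: "(nat \<Rightarrow> 's) \<Rightarrow> nat \<Rightarrow> 's" where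
  "shift_map x = (\<lambda>n. x (Suc n))"

definition d_theta :: "real \<Rightarrow> (nat \<Rightarrow> 's) \<Rightarrow> (nat \<Rightarrow> 's) \<Rightarrow> real" where
  "d_theta \<theta> x y = (if x = y then 0 else \<theta> ^ (LEAST n. x n \<noteq> y n))"

definition subshift_metric :: "real \<Rightarrow> nat ^ 's ^ 's \<Rightarrow> (nat \<Rightarrow> 's) metric" where
  "subshift_metric \<theta> A = metric (subshift A, d_theta \<theta>)"

lemma Metric_space_d_theta:
  assumes "0 < \<theta>" "\<theta> < 1"
  shows "Metric_space M (d_theta \<theta>)"
proof
  fix x y z :: "nat \<Rightarrow> 's"
  show "0 \<le> d_theta \<theta> x y"
    using assms by (simp add: d_theta_def)
  show "d_theta \<theta> x y = d_theta \<theta> y x"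
    by (simp add: d_theta_def eq_commute)
  show "d_theta \<theta> x y = 0 \<longleftrightarrow> x = y"
    using assms by (simp add: d_theta_def)
  show "d_theta \<theta> x z \<le> d_theta \<theta> x y + d_theta \<theta> y z"
  proof (cases "x = y \<or> y = z \<or> x = z")
    case True
    then show ?thesis using assms by (auto simp: d_theta_def)
  next
    case False
    define k where "k = (LEAST n. x n \<noteq> z n)"
    have "\<exists>n. x n \<noteq> z n" using False by (meson ext)
    then have k: "x k \<noteq> z k" unfolding k_def by (rule LeastI_ex)
    then have "x k \<noteq> y k \<or> y k \<noteq> z k" by metis
    then have "(LEAST n. x n \<noteq> y n) \<le> k \<or> (LEAST n. y n \<noteq> z n) \<le> k"
      by (metis (mono_tags, lifting) Least_le)
    then have "\<theta> ^ k \<le> \<theta> ^ (LEAST n. x n \<noteq> y n) \<or> \<theta> ^ k \<le> \<theta> ^ (LEAST n. y n \<noteq> z n)"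
      using assms by (meson less_imp_le power_decreasing)
    moreover have "0 \<le> \<theta> ^ (LEAST n. x n \<noteq> y n)" "0 \<le> \<theta> ^ (LEAST n. y n \<noteq> z n)"
      using assms by simp_all
    ultimately have "\<theta> ^ k \<le> \<theta> ^ (LEAST n. x n \<noteq> y n) + \<theta> ^ (LEAST n. y n \<noteq> z n)"
      by linarith
    then show ?thesis
      using False by (simp only: d_theta_def k_def de_Morgan_disj if_False)
  qed
qed

lemma
  assumes "0 < \<theta>" "\<theta> < 1"
  shows mspace_subshift_metric: "mspace (subshift_metric \<theta> A) = subshift A"
    and mdist_subshift_metric: "mdist (subshift_metric \<theta> A) = d_theta \<theta>"
  unfolding subshift_metric_def
  by (rule Metric_space.mspace_metric[OF Metric_space_d_theta[OF assms]])
    (rule Metric_space.mdist_metric[OF Metric_space_d_theta[OF assms]])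

definition Hoelder_on :: "'a metric \<Rightarrow> ('a \<Rightarrow> real) \<Rightarrow> bool" where
  "Hoelder_on m g \<longleftrightarrow>
     (\<exists>\<alpha> C. 0 < \<alpha> \<and> \<alpha> \<le> 1 \<and>
        (\<forall>x\<in>mspace m. \<forall>y\<in>mspace m. \<bar>g x - g y\<bar> \<le> C * mdist m x y powr \<alpha>))"

definition borel_subshift :: "real \<Rightarrow> nat ^ 's ^ 's \<Rightarrow> (nat \<Rightarrow> 's) measure" where
  "borel_subshift \<theta> A =
     sigma (subshift A) {U. openin (mtopology_of (subshift_metric \<theta> A)) U}"

definition cylinder :: "nat ^ 's ^ 's \<Rightarrow> (nat \<Rightarrow> 's) \<Rightarrow> nat \<Rightarrow> (nat \<Rightarrow> 's) set" where
  "cylinder A x n = {y \<in> subshift A. \<forall>i<n. y i = x i}"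

definition prime_period :: "(nat \<Rightarrow> 's) \<Rightarrow> nat \<Rightarrow> bool" where
  "prime_period z p \<longleftrightarrow>
     0 < p \<and> (shift_map ^^ p) z = z \<and> (\<forall>q. 0 < q \<and> q < p \<longrightarrow> (shift_map ^^ q) z \<noteq> z)"

definition birkhoff_sum :: "((nat \<Rightarrow> 's) \<Rightarrow> real) \<Rightarrow> nat \<Rightarrow> (nat \<Rightarrow> 's) \<Rightarrow> real" where
  "birkhoff_sum g m x = (\<Sum>k<m. g ((shift_map ^^ k) x))"

text \<open>Kolmogorov--Sinai entropy. A finite measurable partition is represented by a simple function
  \<open>\<xi>\<close> (its atoms are the level sets), and the join of the first \<open>n\<close> preimages of the partition by the
  itinerary \<open>x \<mapsto> [\<xi> x, \<xi> (T x), \<dots>, \<xi> (T\<^sup>n\<^sup>-\<^sup>1 x)]\<close>; Shannon entropies are taken in nats.\<close>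

definition itinerary :: "('a \<Rightarrow> 'a) \<Rightarrow> ('a \<Rightarrow> nat) \<Rightarrow> nat \<Rightarrow> 'a \<Rightarrow> nat list" where
  "itinerary T \<xi> n x = map (\<lambda>i. \<xi> ((T ^^ i) x)) [0..<n]"

definition partition_entropy :: "'a measure \<Rightarrow> ('a \<Rightarrow> 'b) \<Rightarrow> real" where
  "partition_entropy m X = prob_space.entropy m (exp 1) (count_space (X ` space m)) X"

definition ks_entropy :: "'a measure \<Rightarrow> ('a \<Rightarrow> 'a) \<Rightarrow> ereal" where
  "ks_entropy m T =
     (SUP \<xi>\<in>{\<xi> :: 'a \<Rightarrow> nat. simple_function m \<xi>}.
        lim (\<lambda>n. ereal (partition_entropy m (itinerary T \<xi> n) / real n)))"

definition invariant_prob :: "real \<Rightarrow> nat ^ 's ^ 's \<Rightarrow> (nat \<Rightarrow> 's) measure \<Rightarrow> bool" where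
  "invariant_prob \<theta> A m \<longleftrightarrow>
     sets m = sets (borel_subshift \<theta> A) \<and> prob_space m \<and>
     (\<forall>B\<in>sets m. emeasure m (shift_map -` B \<inter> space m) = emeasure m B)"

definition free_energy :: "((nat \<Rightarrow> 's) \<Rightarrow> real) \<Rightarrow> (nat \<Rightarrow> 's) measure \<Rightarrow> ereal" where
  "free_energy \<phi> m = ks_entropy m shift_map + ereal (\<integral>x. \<phi> x \<partial>m)"

definition equilibrium_state ::
  "real \<Rightarrow> nat ^ 's ^ 's \<Rightarrow> ((nat \<Rightarrow> 's) \<Rightarrow> real) \<Rightarrow> (nat \<Rightarrow> 's) measure \<Rightarrow> bool" where
  "equilibrium_state \<theta> A \<phi> \<mu> \<longleftrightarrow>
     invariant_prob \<theta> A \<mu> \<and> (\<forall>m. invariant_prob \<theta> A m \<longrightarrow> free_energy \<phi> m \<le> free_energy \<phi> \<mu>)"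

text \<open>The free energy is finite, because the entropy of a subshift is at most \<open>ln CARD('s)\<close>;
  hence no information is lost by \<open>real_of_ereal\<close> when \<open>\<mu>\<close> is an equilibrium state of \<open>\<phi>\<close>.\<close>

definition pressure :: "((nat \<Rightarrow> 's) \<Rightarrow> real) \<Rightarrow> (nat \<Rightarrow> 's) measure \<Rightarrow> real" where
  "pressure \<phi> \<mu> = real_of_ereal (free_energy \<phi> \<mu>)"

definition susp_space ::
  "nat ^ 's ^ 's \<Rightarrow> ((nat \<Rightarrow> 's) \<Rightarrow> real) \<Rightarrow> ((nat \<Rightarrow> 's) \<times> real) set" where
  "susp_space A f = {(x, t). x \<in> subshift A \<and> 0 \<le> t \<and> t < f x}"

definition special_flow ::
  "((nat \<Rightarrow> 's) \<Rightarrow> real) \<Rightarrow> real \<Rightarrow> (nat \<Rightarrow> 's) \<times> real \<Rightarrow> (nat \<Rightarrow> 's) \<times> real" where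
  "special_flow f t = (\<lambda>(x, s).
     let m = (THE m. birkhoff_sum f m x \<le> s + t \<and> s + t < birkhoff_sum f (Suc m) x)
     in ((shift_map ^^ m) x, s + t - birkhoff_sum f m x))"

definition susp_measure ::
  "nat ^ 's ^ 's \<Rightarrow> ((nat \<Rightarrow> 's) \<Rightarrow> real) \<Rightarrow> (nat \<Rightarrow> 's) measure \<Rightarrow> ((nat \<Rightarrow> 's) \<times> real) measure"
  where
  "susp_measure A f \<mu> =
     scale_measure (ennreal (1 / (\<integral>x. f x \<partial>\<mu>)))
       (restrict_space (\<mu> \<Otimes>\<^sub>M lborel) (susp_space A f))"

definition survivor_set ::
  "nat ^ 's ^ 's \<Rightarrow> ((nat \<Rightarrow> 's) \<Rightarrow> real) \<Rightarrow> ((nat \<Rightarrow> 's) \<times> real) set \<Rightarrow> real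
     \<Rightarrow> ((nat \<Rightarrow> 's) \<times> real) set" where
  "survivor_set A f U t =
     {q \<in> susp_space A f. (\<Union>s\<in>{0<..<t}. {special_flow f s q}) \<inter> U = {}}"

text \<open>Logarithm with \<open>log 0 = -\<infinity>\<close>, whereas \<open>ln 0 = 0\<close> on the reals.\<close>

definition ext_ln :: "real \<Rightarrow> ereal" where
  "ext_ln r = (if r = 0 then -\<infinity> else ereal (ln r))"

definition escape_rate ::
  "nat ^ 's ^ 's \<Rightarrow> ((nat \<Rightarrow> 's) \<Rightarrow> real) \<Rightarrow> (nat \<Rightarrow> 's) measure \<Rightarrow> ((nat \<Rightarrow> 's) \<times> real) set \<Rightarrow> ereal"
  where
  "escape_rate A f \<mu> U =
     - Limsup at_top
         (\<lambda>t::real. ereal (1 / t) * ext_ln (measure (susp_measure A f \<mu>) (survivor_set A f U t)))"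

text \<open>The sets are indexed by the positive integers; \<open>I 0\<close> is irrelevant.\<close>

definition nested_condition ::
  "real \<Rightarrow> nat ^ 's ^ 's \<Rightarrow> (nat \<Rightarrow> 's) measure \<Rightarrow> (nat \<Rightarrow> (nat \<Rightarrow> 's) set) \<Rightarrow> (nat \<Rightarrow> 's) \<Rightarrow> bool"
  where
  "nested_condition \<theta> A \<mu> I z \<longleftrightarrow>
     (\<forall>n\<ge>1. openin (mtopology_of (subshift_metric \<theta> A)) (I n)) \<and>
     (\<forall>n\<ge>1. \<exists>F. finite F \<and> F \<subseteq> subshift A \<and> I n = (\<Union>x\<in>F. cylinder A x n)) \<and>
     (\<forall>n\<ge>1. I (Suc n) \<subseteq> I n) \<and> z \<in> subshift A \<and> (\<Inter>n\<in>{1..}. I n) = {z} \<and>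
     (\<exists>c \<rho>. 0 < c \<and> 0 < \<rho> \<and> \<rho> < 1 \<and> (\<forall>n\<ge>1. measure \<mu> (I n) \<le> c * \<rho> ^ n)) \<and>
     (\<exists>(l :: nat \<Rightarrow> nat) \<kappa>. 0 < \<kappa> \<and>
        (\<forall>n\<ge>1. l n \<ge> 1 \<and> \<kappa> < real (l n) / real n \<and> real (l n) / real n \<le> 1 \<and>
                I n \<subseteq> cylinder A z (l n))) \<and>
     (\<forall>p. prime_period z p \<longrightarrow>
        (\<forall>\<^sub>F n in sequentially. (shift_map ^^ p) -` I n \<inter> cylinder A z p \<subseteq> I n))"

definition W_const ::
  "nat ^ 's ^ 's \<Rightarrow> ((nat \<Rightarrow> 's) \<Rightarrow> real) \<Rightarrow> (nat \<Rightarrow> 's) measure \<Rightarrow> real" where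
  "W_const A f \<mu> = 1 + (SUP x\<in>subshift A. \<bar>f x\<bar>) / (\<integral>x. f x \<partial>\<mu>)"

end

theory Submission
  imports Defs
begin

text \<open>
  The quotient in the theorem converges to the local escape rate \<open>d\<close> of the shift itself: \<open>d = 1\<close> if
  \<open>z\<close> is not periodic, and \<open>d = 1 - exp (S\<^sub>p \<phi> z - p P)\<close> if \<open>z\<close> has prime period \<open>p\<close>.  As \<open>0 \<le> d\<close> and
  \<open>W \<ge> 2\<close>, this limit is at least \<open>d / W\<close>.

  The equilibrium state is first identified with a Gibbs measure (\<open>equilibrium_gibbs\<close>).  The transfer
  operator with weight \<open>exp \<phi>\<close> has a positive eigenfunction \<open>h\<close> with eigenvalue \<open>lam\<close>, and the weight
  \<open>G = exp \<phi> h / (lam h \<circ> \<sigma>)\<close> defines an operator that fixes the constants.  Its iterates contract a cone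
  of log-Hoelder functions and converge to a constant, and the limits on indicator functions of clopen
  sets form a shift-invariant measure \<open>m\<close>, which is \<open>\<psi>\<close>-mixing and has Jacobian \<open>1 / G\<close>.  The free
  energy of \<open>m\<close> is \<open>ln lam\<close>.  An invariant measure of at least this free energy has bounded
  relative entropy with respect to \<open>m\<close> on all words, while large deviation events of \<open>m\<close> have
  exponentially small mass; hence such a measure sees the same frequencies as \<open>m\<close> and equals \<open>m\<close>
  (\<open>gibbs_unique\<close>).  Thus \<open>\<mu> = m\<close> and \<open>P = ln lam\<close>.

  For the shift with hole \<open>U = I n\<close>, time is cut into blocks of length \<open>n\<^sup>2\<close>, long compared with the
  gap \<open>n + g\<close> over which mixing acts, but short compared with \<open>1 / \<mu> U\<close>.  Mixing makes the blocks almost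
  independent, so the survival probability decays like \<open>(1 - p)\<^sup>k\<close>, where \<open>p\<close> is the probability of a hit
  within one block.  A hit is counted once, at the last visit of its cluster, so \<open>p\<close> is close to
  \<open>n\<^sup>2 d \<mu> U\<close>, where \<open>d\<close> is the limiting probability that a point of \<open>U\<close> does not return to \<open>U\<close>
  within a bounded time.  Returns at later times are negligible, because \<open>I n \<subseteq> I j\<close> and \<open>\<mu> (I j)\<close> decays
  exponentially in \<open>j\<close>.  Only multiples of the period of \<open>z\<close> are possible as bounded return times, and the
  Jacobian of \<open>\<mu>\<close> at \<open>z\<close> gives \<open>d\<close> (\<open>fresh_limit_periodic\<close>, \<open>base_escape\<close>).

  An orbit of the flow crosses the base about \<open>t / \<integral>f d\<mu>\<close> times up to time \<open>t\<close>.  Deviations from this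
  number have probability exponentially small in \<open>t\<close> at a rate independent of \<open>n\<close>, while the escape rate
  of the shift tends to \<open>0\<close>; so the escape rate of the flow is asymptotically that of the shift divided by
  \<open>\<integral>f d\<mu>\<close> (\<open>flow_local_escape\<close>).  The measure of \<open>I n \<times> {0..1}\<close> contains the same factor, which cancels.
\<close>

section \<open>Clopen sets of the subshift\<close>

lemma shift_map_funpow: "(shift_map ^^ k) x = (\<lambda>n. x (n + k))"
  by (induction k arbitrary: x) (simp_all add: shift_map_def funpow_swap1)

lemma shift_map_funpow_apply: "(shift_map ^^ k) x n = x (n + k)"
  by (simp add: shift_map_funpow)

lemma shift_map_apply: "shift_map x n = x (Suc n)"
  by (simp add: shift_map_def)

lemma shift_map_funpow_subshift [simp, intro]:
  "x \<in> subshift A \<Longrightarrow> (shift_map ^^ k) x \<in> subshift A"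
  by (simp add: subshift_def shift_map_funpow_apply)

lemma shift_map_subshift [simp, intro]: "x \<in> subshift A \<Longrightarrow> shift_map x \<in> subshift A"
  by (simp add: subshift_def shift_map_apply)

definition agree :: "nat \<Rightarrow> (nat \<Rightarrow> 's) \<Rightarrow> (nat \<Rightarrow> 's) \<Rightarrow> bool" where
  "agree n x y \<longleftrightarrow> (\<forall>i<n. x i = y i)"

lemma agree_refl [simp]: "agree n x x" and agree_0 [simp]: "agree 0 x y"
  by (simp_all add: agree_def)

lemma agree_sym: "agree n x y \<Longrightarrow> agree n y x"
  by (simp add: agree_def)

lemma agree_commute: "agree n x y \<longleftrightarrow> agree n y x"
  by (auto simp: agree_def)

lemma agree_trans: "agree n x y \<Longrightarrow> agree n y z \<Longrightarrow> agree n x z"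
  by (simp add: agree_def)

lemma agree_mono: "agree n x y \<Longrightarrow> m \<le> n \<Longrightarrow> agree m x y"
  by (simp add: agree_def)

lemma agree_shift: "agree (m + n) x y \<Longrightarrow> agree n ((shift_map ^^ m) x) ((shift_map ^^ m) y)"
  by (simp add: agree_def shift_map_funpow_apply)

lemma agree_Suc: "agree (Suc n) x y \<longleftrightarrow> agree n x y \<and> x n = y n"
  by (auto simp: agree_def less_Suc_eq)

lemma mem_cylinder: "y \<in> cylinder A x n \<longleftrightarrow> y \<in> subshift A \<and> agree n y x"
  by (simp add: cylinder_def agree_def)

definition word :: "nat \<Rightarrow> (nat \<Rightarrow> 's) \<Rightarrow> 's list" where
  "word n x = map x [0..<n]"

lemma word_eq_iff: "word n x = word n y \<longleftrightarrow> agree n x y"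
  by (auto simp: word_def list_eq_iff_nth_eq agree_def)

lemma finite_words: "finite (word n ` (X :: (nat \<Rightarrow> 's::finite) set))"
proof (rule finite_subset)
  show "word n ` X \<subseteq> {xs. set xs \<subseteq> UNIV \<and> length xs = n}" by (auto simp: word_def)
qed (rule finite_lists_length_eq, simp)

definition determined :: "nat ^ 's ^ 's \<Rightarrow> nat \<Rightarrow> (nat \<Rightarrow> 's) set \<Rightarrow> bool" where
  "determined A n U \<longleftrightarrow> U \<subseteq> subshift A \<and> (\<forall>x\<in>U. \<forall>y\<in>subshift A. agree n x y \<longrightarrow> y \<in> U)"

definition depends_on :: "nat ^ 's ^ 's \<Rightarrow> nat \<Rightarrow> ((nat \<Rightarrow> 's) \<Rightarrow> 'b) \<Rightarrow> bool" where
  "depends_on A n \<psi> \<longleftrightarrow> (\<forall>x\<in>subshift A. \<forall>y\<in>subshift A. agree n x y \<longrightarrow> \<psi> x = \<psi> y)"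

definition preim :: "nat ^ 's ^ 's \<Rightarrow> nat \<Rightarrow> (nat \<Rightarrow> 's) set \<Rightarrow> (nat \<Rightarrow> 's) set" where
  "preim A n V = {x \<in> subshift A. (shift_map ^^ n) x \<in> V}"

definition clopens :: "nat ^ 's ^ 's \<Rightarrow> (nat \<Rightarrow> 's) set set" where
  "clopens A = {U. \<exists>n. determined A n U}"

lemma determined_mono: "determined A n U \<Longrightarrow> n \<le> m \<Longrightarrow> determined A m U"
  unfolding determined_def by (meson agree_mono)

lemma determined_subset: "determined A n U \<Longrightarrow> U \<subseteq> subshift A"
  by (simp add: determined_def)

lemma determined_empty [simp]: "determined A n {}"
  and determined_space [simp]: "determined A n (subshift A)"
  by (simp_all add: determined_def)

lemma determined_Int: "determined A n U \<Longrightarrow> determined A n V \<Longrightarrow> determined A n (U \<inter> V)"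
  and determined_Un: "determined A n U \<Longrightarrow> determined A n V \<Longrightarrow> determined A n (U \<union> V)"
  unfolding determined_def by blast+

lemma determined_Diff: "determined A n U \<Longrightarrow> determined A n V \<Longrightarrow> determined A n (U - V)"
proof -
  assume UV: "determined A n U" "determined A n V"
  have "y \<notin> V" if "x \<in> U - V" "y \<in> subshift A" "agree n x y" for x y
  proof
    assume "y \<in> V"
    moreover have "x \<in> subshift A" "agree n y x" using that UV by (auto simp: determined_def agree_commute)
    ultimately have "x \<in> V" using UV(2) unfolding determined_def by blast
    then show False using that by simp
  qed
  then show ?thesis using UV unfolding determined_def by blast
qed

lemma determined_UN:
  "(\<And>i. i \<in> J \<Longrightarrow> determined A n (U i)) \<Longrightarrow> determined A n (\<Union>i\<in>J. U i)"
  unfolding determined_def by blast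

lemma determined_preim: "determined A k V \<Longrightarrow> determined A (n + k) (preim A n V)"
  unfolding determined_def preim_def
proof (safe)
  fix x y
  assume *: "\<forall>x\<in>V. \<forall>y\<in>subshift A. agree k x y \<longrightarrow> y \<in> V" "y \<in> subshift A"
    "agree (n+k) x y" "(shift_map ^^ n) x \<in> V"
  then have "agree k ((shift_map ^^ n) x) ((shift_map ^^ n) y)" by (simp add: agree_shift)
  then show "(shift_map ^^ n) y \<in> V" using * by blast
qed

lemma preim_preim: "preim A n (preim A m V) = preim A (n + m) V"
  by (auto simp: preim_def funpow_add add.commute[of n m])

lemma preim_0: "V \<subseteq> subshift A \<Longrightarrow> preim A 0 V = V"
  by (auto simp: preim_def)

lemma preim_Diff: "preim A n (U - V) = preim A n U - preim A n V"
  and preim_Int: "preim A n (U \<inter> V) = preim A n U \<inter> preim A n V"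
  and preim_space: "preim A n (subshift A) = subshift A"
  by (auto simp: preim_def)

lemma determined_cylinder: "determined A n (cylinder A x n)"
  by (auto simp: determined_def mem_cylinder) (metis agree_sym agree_trans)

lemma mem_cylinder_self: "x \<in> subshift A \<Longrightarrow> x \<in> cylinder A x n"
  by (simp add: mem_cylinder)

lemma depends_on_mono: "depends_on A n \<psi> \<Longrightarrow> n \<le> m \<Longrightarrow> depends_on A m \<psi>"
  unfolding depends_on_def by (meson agree_mono)

lemma depends_on_vimage:
  "depends_on A n \<psi> \<Longrightarrow> determined A n {x \<in> subshift A. \<psi> x \<in> B}"
  unfolding depends_on_def determined_def
proof (intro conjI ballI impI)
  fix x y
  assume *: "\<forall>x\<in>subshift A. \<forall>y\<in>subshift A. agree n x y \<longrightarrow> \<psi> x = \<psi> y"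
    "x \<in> {x \<in> subshift A. \<psi> x \<in> B}" "y \<in> subshift A" "agree n x y"
  then have "\<psi> x = \<psi> y" by blast
  with *(2,3) show "y \<in> {x \<in> subshift A. \<psi> x \<in> B}" by simp
qed blast

lemma depends_on_indicator:
  "determined A n U \<Longrightarrow> depends_on A n (indicator U :: _ \<Rightarrow> real)"
  unfolding depends_on_def
proof (intro ballI impI)
  fix x y assume *: "determined A n U" "x \<in> subshift A" "y \<in> subshift A" "agree n x y"
  then have "agree n y x" by (blast intro: agree_sym)
  with * have "x \<in> U \<longleftrightarrow> y \<in> U" unfolding determined_def by blast
  then show "indicator U x = (indicator U y :: real)" by (simp add: indicator_def)
qed

lemma depends_on_shift:
  assumes "depends_on A n \<psi>" shows "depends_on A (m + n) (\<lambda>x. \<psi> ((shift_map ^^ m) x))"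
  unfolding depends_on_def
proof (intro ballI impI)
  fix x y assume "x \<in> subshift A" "y \<in> subshift A" "agree (m + n) x y"
  then show "\<psi> ((shift_map ^^ m) x) = \<psi> ((shift_map ^^ m) y)"
    using assms[unfolded depends_on_def, rule_format, of "(shift_map ^^ m) x" "(shift_map ^^ m) y"]
    by (simp add: agree_shift)
qed

lemma depends_on_word: "depends_on A n (word n)"
  by (simp add: depends_on_def word_eq_iff)

lemma depends_on_factor:
  assumes "depends_on A n \<psi>"
  obtains F where "\<And>x. x \<in> subshift A \<Longrightarrow> \<psi> x = F (word n x)"
proof
  fix x assume x: "x \<in> subshift A"
  define y where "y = (SOME y. y \<in> subshift A \<and> word n y = word n x)"
  have y: "y \<in> subshift A \<and> word n y = word n x"
    unfolding y_def by (rule someI[of _ x]) (simp add: x)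
  then have "agree n x y" by (metis word_eq_iff)
  then have "\<psi> x = \<psi> y" using assms x y unfolding depends_on_def by blast
  then show "\<psi> x = (\<lambda>w. \<psi> (SOME y. y \<in> subshift A \<and> word n y = w)) (word n x)"
    by (simp add: y_def)
qed

lemma depends_on_finite_range:
  fixes A :: "nat ^ 's::finite ^ 's"
  assumes "depends_on A n \<psi>" shows "finite (\<psi> ` subshift A)"
proof -
  obtain F where "\<And>x. x \<in> subshift A \<Longrightarrow> \<psi> x = F (word n x)"
    using depends_on_factor[OF assms] by metis
  then have "\<psi> ` subshift A = F ` word n ` subshift A" by force
  then show ?thesis using finite_words by (metis finite_imageI)
qed

lemma clopensI: "determined A n U \<Longrightarrow> U \<in> clopens A"
  by (auto simp: clopens_def)

lemma algebra_clopens: "algebra (subshift A) (clopens A)"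
  unfolding algebra_iff_Int
proof (intro conjI ballI)
  show "clopens A \<subseteq> Pow (subshift A)" by (auto simp: clopens_def determined_def)
  show "{} \<in> clopens A" by (auto simp: clopens_def)
  fix a assume "a \<in> clopens A"
  then obtain n where a: "determined A n a" by (auto simp: clopens_def)
  show "subshift A - a \<in> clopens A"
    by (rule clopensI, rule determined_Diff[OF determined_space a])
  fix b assume "b \<in> clopens A"
  then obtain m where b: "determined A m b" by (auto simp: clopens_def)
  have "determined A (max n m) (a \<inter> b)"
    by (rule determined_Int[OF determined_mono[OF a] determined_mono[OF b]]) auto
  then show "a \<inter> b \<in> clopens A" by (rule clopensI)
qed

lemma d_theta_less:
  assumes "0 < \<theta>" "\<theta> < 1" "d_theta \<theta> x y < \<theta> ^ n" shows "agree (Suc n) x y"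
proof (cases "x = y")
  case False
  then have "\<theta> ^ (LEAST n. x n \<noteq> y n) < \<theta> ^ n" using assms by (simp add: d_theta_def)
  then have "n < (LEAST n. x n \<noteq> y n)"
    using assms power_decreasing[of "LEAST n. x n \<noteq> y n" n \<theta>] by linarith
  then have "i < (LEAST n. x n \<noteq> y n)" if "i < Suc n" for i using that by simp
  then show ?thesis unfolding agree_def using not_less_Least[of _ "\<lambda>n. x n \<noteq> y n"] by blast
qed simp

lemma d_theta_le:
  assumes "0 < \<theta>" "\<theta> < 1" "agree n x y" shows "d_theta \<theta> x y \<le> \<theta> ^ n"
proof (cases "x = y")
  case False
  then have "\<exists>n. x n \<noteq> y n" by auto
  then have "x (LEAST n. x n \<noteq> y n) \<noteq> y (LEAST n. x n \<noteq> y n)" by (rule LeastI_ex)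
  then have "n \<le> (LEAST n. x n \<noteq> y n)" using assms(3) unfolding agree_def by (meson linorder_not_le)
  then show ?thesis using False assms by (simp add: d_theta_def power_decreasing)
qed (use assms in \<open>simp add: d_theta_def\<close>)

lemma openin_subshift_iff:
  assumes "0 < \<theta>" "\<theta> < 1"
  shows "openin (mtopology_of (subshift_metric \<theta> A)) U \<longleftrightarrow>
    U \<subseteq> subshift A \<and> (\<forall>x\<in>U. \<exists>n. cylinder A x n \<subseteq> U)"
proof -
  interpret M: Metric_space "subshift A" "d_theta \<theta>"
    by (rule Metric_space_d_theta[OF assms])
  have *: "(\<exists>r>0. M.mball x r \<subseteq> U) \<longleftrightarrow> (\<exists>n. cylinder A x n \<subseteq> U)"
    if x: "x \<in> subshift A" for x
  proof
    assume "\<exists>r>0. M.mball x r \<subseteq> U"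
    then obtain r where r: "r > 0" "M.mball x r \<subseteq> U" by blast
    then obtain n where "\<theta> ^ n < r" using assms real_arch_pow_inv by blast
    then have "cylinder A x n \<subseteq> M.mball x r"
      using d_theta_le[OF assms] x by (force simp: mem_cylinder agree_commute)
    then show "\<exists>n. cylinder A x n \<subseteq> U" using r by blast
  next
    assume "\<exists>n. cylinder A x n \<subseteq> U"
    then obtain n where n: "cylinder A x n \<subseteq> U" by blast
    have "M.mball x (\<theta> ^ n) \<subseteq> cylinder A x n"
      using d_theta_less[OF assms, of x _ n] by (auto simp: mem_cylinder agree_Suc agree_commute)
    then show "\<exists>r>0. M.mball x r \<subseteq> U" using n assms by (metis order.trans zero_less_power)
  qed
  show ?thesis
    unfolding mtopology_of_def mspace_subshift_metric[OF assms] mdist_subshift_metric[OF assms]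
      M.openin_mtopology using * by blast
qed

lemma sets_borel_subshift:
  assumes "0 < \<theta>" "\<theta> < 1"
  shows "sets (borel_subshift \<theta> A) = sigma_sets (subshift A) (clopens A)"
proof -
  have "{U. openin (mtopology_of (subshift_metric \<theta> A)) U} \<subseteq> Pow (subshift A)"
    by (auto simp: openin_subshift_iff[OF assms])
  then have *: "sets (borel_subshift \<theta> A) =
      sigma_sets (subshift A) {U. openin (mtopology_of (subshift_metric \<theta> A)) U}"
    unfolding borel_subshift_def by (rule sets_measure_of)
  have "U \<in> sigma_sets (subshift A) (clopens A)"
    if "openin (mtopology_of (subshift_metric \<theta> A)) U" for U
  proof -
    define V where "V n = {x \<in> subshift A. cylinder A x n \<subseteq> U}" for n
    have U: "U \<subseteq> subshift A" "\<And>x. x \<in> U \<Longrightarrow> \<exists>n. cylinder A x n \<subseteq> U"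
      using that unfolding openin_subshift_iff[OF assms] by blast+
    have "U = (\<Union>n. V n)"
    proof
      show "U \<subseteq> (\<Union>n. V n)" using U by (force simp: V_def)
      show "(\<Union>n. V n) \<subseteq> U" using mem_cylinder_self by (force simp: V_def)
    qed
    moreover have "determined A n (V n)" for n
    proof -
      have "cylinder A x n = cylinder A y n" if "agree n x y" for x y
        using agree_trans[OF _ that] agree_trans[OF _ agree_sym[OF that]]
        by (auto simp: mem_cylinder)
      then show ?thesis unfolding determined_def V_def by blast
    qed
    then have "V n \<in> sigma_sets (subshift A) (clopens A)" for n
      using clopensI by blast
    ultimately show ?thesis using sigma_sets.Union[of V] by simp
  qed
  moreover have "openin (mtopology_of (subshift_metric \<theta> A)) U" if "U \<in> clopens A" for U
  proof -
    from that obtain n where "determined A n U" by (auto simp: clopens_def)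
    then have "U \<subseteq> subshift A" "cylinder A x n \<subseteq> U" if "x \<in> U" for x
      using that unfolding determined_def by (auto simp: mem_cylinder agree_commute)
    then show ?thesis unfolding openin_subshift_iff[OF assms]
      using \<open>determined A n U\<close> determined_subset by blast
  qed
  ultimately show ?thesis unfolding *
    by (intro sigma_sets_eqI) (auto)
qed

text \<open>Koenig's lemma: a finite word that is a prefix of points in every \<open>W i\<close> extends by
  one letter to such a word, since there are finitely many letters and the sets decrease.\<close>

lemma clopens_compact:
  fixes A :: "nat ^ 's::finite ^ 's"
  assumes cl: "\<And>i. W i \<in> clopens A" and dec: "decseq W" and ne: "\<And>i. W i \<noteq> {}"
  shows "(\<Inter>i::nat. W i) \<noteq> {}"
proof -
  define good where "good n x \<longleftrightarrow> (\<forall>i. \<exists>y\<in>W i. agree n x y)" for n x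
  have step: "\<exists>y. good (Suc n) y \<and> agree n x y" if "good n x" for n x
  proof (rule ccontr)
    assume *: "\<not> ?thesis"
    have "\<exists>i. \<forall>y\<in>W i. \<not> agree (Suc n) (x(n := s)) y" for s
    proof (rule ccontr)
      assume "\<nexists>i. \<forall>y\<in>W i. \<not> agree (Suc n) (x(n := s)) y"
      then have "good (Suc n) (x(n := s))" unfolding good_def by blast
      moreover have "agree n x (x(n := s))" by (simp add: agree_def)
      ultimately show False using * by blast
    qed
    then have "\<forall>s. \<exists>i. \<forall>y\<in>W i. \<not> agree (Suc n) (x(n := s)) y" by blast
    from choice[OF this] obtain f
      where f: "\<And>s y. y \<in> W (f s) \<Longrightarrow> \<not> agree (Suc n) (x(n := s)) y" by blast
    define m where "m = Max (range f)"
    have "W m \<subseteq> W (f s)" for s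
      using dec unfolding decseq_def m_def by simp
    moreover obtain y where "y \<in> W m" "agree n x y" using \<open>good n x\<close> unfolding good_def by blast
    ultimately have "\<not> agree (Suc n) (x(n := y n)) y" using f by blast
    then show False using \<open>agree n x y\<close> unfolding agree_def by (metis fun_upd_apply less_antisym)
  qed
  have "\<exists>f. \<forall>n. good n (f n) \<and> agree n (f n) (f (Suc n))"
  proof (rule dependent_nat_choice)
    show "\<exists>x. good 0 x" using ne by (simp add: good_def ex_in_conv)
    show "\<exists>y. good (Suc n) y \<and> agree n x y" if "good n x" for n x using step[OF that] .
  qed
  then obtain f where f: "\<And>n. good n (f n)" "\<And>n. agree n (f n) (f (Suc n))" by blast
  define x where "x = (\<lambda>n. f (Suc n) n)"
  have fx: "f (n + k) i = f n i" if "i < n" for n k i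
  proof (induction k)
    case (Suc k)
    have "f (n + k) i = f (Suc (n + k)) i" using f(2)[of "n + k"] that unfolding agree_def by simp
    then show ?case using Suc by simp
  qed simp
  have ag: "agree n x (f n)" for n
    unfolding agree_def
  proof (intro allI impI)
    fix i assume "i < n"
    then have "f (Suc i + (n - Suc i)) i = f (Suc i) i" by (intro fx) simp
    then show "x i = f n i" using \<open>i < n\<close> by (simp add: x_def)
  qed
  have gx: "\<exists>y\<in>W i. agree n x y" for n i
  proof -
    obtain y where "y \<in> W i" "agree n (f n) y" using f(1)[of n] unfolding good_def by blast
    then show ?thesis using ag[of n] by (intro bexI[of _ y]) (auto intro: agree_trans)
  qed
  have sub: "W i \<subseteq> subshift A" for i using cl[of i] by (auto simp: clopens_def determined_def)
  have "A $ x n $ x (Suc n) = 1" for n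
  proof -
    obtain y where "y \<in> W 0" "agree (Suc (Suc n)) x y" using gx by blast
    then show ?thesis using sub[of 0] by (auto simp: subshift_def agree_def)
  qed
  then have "x \<in> subshift A" by (simp add: subshift_def)
  have "x \<in> W i" for i
  proof -
    obtain n where n: "determined A n (W i)" using cl[of i] by (auto simp: clopens_def)
    obtain y where "y \<in> W i" "agree n x y" using gx by blast
    then have "agree n y x" by (blast intro: agree_sym)
    then show ?thesis using n \<open>x \<in> subshift A\<close> \<open>y \<in> W i\<close> unfolding determined_def by blast
  qed
  then show ?thesis by blast
qed

section \<open>Transfer operators and cones of log-Hoelder functions\<close>

definition scons :: "'s \<Rightarrow> (nat \<Rightarrow> 's) \<Rightarrow> nat \<Rightarrow> 's" where
  "scons i x = case_nat i x"

lemma scons_0 [simp]: "scons i x 0 = i" and scons_Suc [simp]: "scons i x (Suc n) = x n"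
  by (simp_all add: scons_def)

lemma shift_map_scons [simp]: "shift_map (scons i x) = x"
  by (simp add: shift_map_def)

lemma scons_shift_map [simp]: "scons (x 0) (shift_map x) = x"
  by (rule ext) (simp add: scons_def shift_map_def split: nat.split)

lemma scons_subshift: "x \<in> subshift A \<Longrightarrow> A $ i $ x 0 = Suc 0 \<Longrightarrow> scons i x \<in> subshift A"
  unfolding subshift_def scons_def by (auto split: nat.split)

lemma agree_scons: "agree n x y \<Longrightarrow> agree (Suc n) (scons i x) (scons i y)"
  unfolding agree_def scons_def by (auto split: nat.split)

lemma funpow_shift_map_scons [simp]: "(shift_map ^^ Suc n) (scons i x) = (shift_map ^^ n) x"
  by (simp add: funpow_swap1)

locale aperiodic_subshift =
  fixes A :: "nat ^ 's::finite ^ 's"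
  assumes aperiodic: "aperiodic_01_matrix A" and nonempty: "subshift A \<noteq> {}"
begin

abbreviation X :: "(nat \<Rightarrow> 's) set" where "X \<equiv> subshift A"

text \<open>A positive entry of a matrix power is a sum of products over paths, so some path has all entries
  \<open>1\<close>.\<close>

lemma path_of_matrix_power:
  assumes "(((**) A ^^ d) (mat 1)) $ i $ j > 0" "x \<in> X" "x 0 = j"
  shows "\<exists>y\<in>X. y 0 = i \<and> (shift_map ^^ d) y = x"
  using assms(1)
proof (induction d arbitrary: i)
  case 0
  then have "i = j" by (simp add: mat_def split: if_splits)
  then show ?case using assms by auto
next
  case (Suc d)
  let ?M = "((**) A ^^ d) (mat 1)"
  have "0 < (\<Sum>k\<in>UNIV. A $ i $ k * ?M $ k $ j)"
    using Suc.prems unfolding funpow.simps o_apply matrix_matrix_mult_def[of A ?M] by (simp only: vec_lambda_beta)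
  then have "\<exists>k. A $ i $ k * ?M $ k $ j \<noteq> 0"
    by (metis (mono_tags, lifting) less_irrefl sum.neutral)
  then obtain k where k: "A $ i $ k > 0" "?M $ k $ j > 0" by auto
  obtain y where y: "y \<in> X" "y 0 = k" "(shift_map ^^ d) y = x" using Suc.IH[OF k(2)] by blast
  have "A $ i $ k \<in> {0, 1}" using aperiodic unfolding aperiodic_01_matrix_def by blast
  then have "A $ i $ y 0 = 1" using k y by auto
  then have "scons i y \<in> X" using y by (intro scons_subshift) auto
  moreover have "(shift_map ^^ Suc d) (scons i y) = x" by (simp only: funpow_shift_map_scons y)
  ultimately show ?case by (intro bexI[of _ "scons i y"] conjI scons_0)
qed

lemma connecting_time:
  obtains d where "\<And>i x. x \<in> X \<Longrightarrow> \<exists>y\<in>X. y 0 = i \<and> (shift_map ^^ d) y = x"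
proof -
  obtain d where "\<And>i j. (((**) A ^^ d) (mat 1)) $ i $ j > 0"
    using aperiodic unfolding aperiodic_01_matrix_def by blast
  then show ?thesis using path_of_matrix_power that by blast
qed

end

locale transfer_operator = aperiodic_subshift A for A :: "nat ^ 's::finite ^ 's" +
  fixes G :: "(nat \<Rightarrow> 's) \<Rightarrow> real" and \<beta> c :: real
  assumes beta: "0 < \<beta>" "\<beta> < 1" and c_nonneg: "0 \<le> c"
    and G_pos: "x \<in> X \<Longrightarrow> 0 < G x"
    and G_var: "x \<in> X \<Longrightarrow> y \<in> X \<Longrightarrow> agree k x y \<Longrightarrow> G x \<le> exp (c * \<beta> ^ k) * G y"
begin

definition L :: "((nat \<Rightarrow> 's) \<Rightarrow> real) \<Rightarrow> (nat \<Rightarrow> 's) \<Rightarrow> real" where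
  "L \<psi> x = (\<Sum>i | A $ i $ x 0 = 1. G (scons i x) * \<psi> (scons i x))"

lemma L_mono: "x \<in> X \<Longrightarrow> (\<And>y. y \<in> X \<Longrightarrow> \<psi> y \<le> \<eta> y) \<Longrightarrow> L \<psi> x \<le> L \<eta> x"
  unfolding L_def
  by (intro sum_mono mult_left_mono) (auto intro!: scons_subshift less_imp_le[OF G_pos])

lemma L_cong: "x \<in> X \<Longrightarrow> (\<And>y. y \<in> X \<Longrightarrow> \<psi> y = \<eta> y) \<Longrightarrow> L \<psi> x = L \<eta> x"
  unfolding L_def by (intro sum.cong) (auto intro!: scons_subshift)

lemma L_add: "L (\<lambda>x. \<psi> x + \<eta> x) = (\<lambda>x. L \<psi> x + L \<eta> x)"
  by (rule ext) (simp add: L_def sum.distrib distrib_left)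

lemma L_scale: "L (\<lambda>x. a * \<psi> x) = (\<lambda>x. a * L \<psi> x)"
  by (rule ext) (simp add: L_def sum_distrib_left mult.left_commute)

lemma Lpow_mono:
  "x \<in> X \<Longrightarrow> (\<And>y. y \<in> X \<Longrightarrow> \<psi> y \<le> \<eta> y) \<Longrightarrow> (L ^^ n) \<psi> x \<le> (L ^^ n) \<eta> x"
  by (induction n arbitrary: x) (auto intro: L_mono)

lemma Lpow_cong:
  "x \<in> X \<Longrightarrow> (\<And>y. y \<in> X \<Longrightarrow> \<psi> y = \<eta> y) \<Longrightarrow> (L ^^ n) \<psi> x = (L ^^ n) \<eta> x"
  by (induction n arbitrary: x) (auto intro: L_cong)

lemma Lpow_add: "(L ^^ n) (\<lambda>x. \<psi> x + \<eta> x) = (\<lambda>x. (L ^^ n) \<psi> x + (L ^^ n) \<eta> x)"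
  by (induction n) (auto simp: L_add)

lemma Lpow_scale: "(L ^^ n) (\<lambda>x. a * \<psi> x) = (\<lambda>x. a * (L ^^ n) \<psi> x)"
  by (induction n) (auto simp: L_scale)

lemma Lpow_zero: "(L ^^ n) (\<lambda>x. 0) = (\<lambda>x. 0)"
  using Lpow_scale[of n 0 "\<lambda>x. 0"] by simp

lemma Lpow_nonneg: "x \<in> X \<Longrightarrow> (\<And>y. y \<in> X \<Longrightarrow> 0 \<le> \<psi> y) \<Longrightarrow> 0 \<le> (L ^^ n) \<psi> x"
  using Lpow_mono[of x "\<lambda>_. 0" \<psi> n] by (simp add: Lpow_zero)

lemma G_bounds: obtains b M where "0 < b" "0 < M" "\<And>x. x \<in> X \<Longrightarrow> b \<le> G x" "\<And>x. x \<in> X \<Longrightarrow> G x \<le> M"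
proof -
  obtain x0 where x0: "x0 \<in> X" using nonempty by blast
  have 1: "G x0 \<le> exp c * G x" "G x \<le> exp c * G x0" if "x \<in> X" for x
    using G_var[OF x0 that, of 0] G_var[OF that x0, of 0] by auto
  show ?thesis
  proof (rule that[of "exp (-c) * G x0" "exp c * G x0"])
    show "exp (- c) * G x0 \<le> G x" if "x \<in> X" for x
      using 1(1)[OF that] by (simp add: exp_minus field_simps)
  qed (use 1 G_pos[OF x0] in auto)
qed

lemma L_ge:
  assumes "y \<in> X" "\<And>x. x \<in> X \<Longrightarrow> 0 \<le> \<psi> x"
  shows "G y * \<psi> y \<le> L \<psi> (shift_map y)"
proof -
  let ?I = "{i. A $ i $ shift_map y 0 = 1}"
  have "y 0 \<in> ?I" using assms(1) by (simp add: subshift_def shift_map_apply)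
  then have "(\<Sum>i\<in>{y 0}. G (scons i (shift_map y)) * \<psi> (scons i (shift_map y))) \<le> L \<psi> (shift_map y)"
    unfolding L_def using assms
    by (intro sum_mono2) (auto intro!: mult_nonneg_nonneg less_imp_le[OF G_pos] assms(2) scons_subshift simp: shift_map_apply)
  then show ?thesis by simp
qed

lemma Lpow_ge:
  assumes "0 < b" "\<And>x. x \<in> X \<Longrightarrow> b \<le> G x" and "y \<in> X" "\<And>x. x \<in> X \<Longrightarrow> 0 \<le> \<psi> x"
  shows "b ^ n * \<psi> y \<le> (L ^^ n) \<psi> ((shift_map ^^ n) y)"
proof (induction n)
  case (Suc n)
  let ?z = "(shift_map ^^ n) y"
  have "b ^ Suc n * \<psi> y \<le> G ?z * (L ^^ n) \<psi> ?z"
    using mult_mono[OF assms(2) Suc] assms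
    by (simp add: mult.assoc less_imp_le[OF G_pos])
  also have "\<dots> \<le> L ((L ^^ n) \<psi>) (shift_map ?z)"
    by (intro L_ge) (use assms in \<open>auto intro: Lpow_nonneg\<close>)
  finally show ?case by simp
qed simp

text \<open>The distance scale \<open>\<beta> ^ k\<close> replaces the metric. Points without a common first
  letter are never compared, because they have different sets of preimages.\<close>

definition cone :: "real \<Rightarrow> nat \<Rightarrow> ((nat \<Rightarrow> 's) \<Rightarrow> real) \<Rightarrow> bool" where
  "cone D j \<psi> \<longleftrightarrow> (\<forall>x\<in>X. 0 \<le> \<psi> x) \<and>
     (\<forall>k\<ge>max 1 j. \<forall>x\<in>X. \<forall>y\<in>X. agree k x y \<longrightarrow> \<psi> x \<le> exp (D * \<beta> ^ k) * \<psi> y)"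

lemma cone_nonneg: "cone D j \<psi> \<Longrightarrow> x \<in> X \<Longrightarrow> 0 \<le> \<psi> x"
  by (simp add: cone_def)

lemma coneD:
  "cone D j \<psi> \<Longrightarrow> j \<le> k \<Longrightarrow> 1 \<le> k \<Longrightarrow> x \<in> X \<Longrightarrow> y \<in> X \<Longrightarrow> agree k x y \<Longrightarrow>
    \<psi> x \<le> exp (D * \<beta> ^ k) * \<psi> y"
  by (simp add: cone_def)

lemma coneI:
  assumes "\<And>x. x \<in> X \<Longrightarrow> 0 \<le> \<psi> x"
    and "\<And>k x y. j \<le> k \<Longrightarrow> 1 \<le> k \<Longrightarrow> x \<in> X \<Longrightarrow> y \<in> X \<Longrightarrow> agree k x y \<Longrightarrow>
      \<psi> x \<le> exp (D * \<beta> ^ k) * \<psi> y"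
  shows "cone D j \<psi>"
  using assms unfolding cone_def by auto

lemma cone_mono:
  assumes "cone D j \<psi>" "D \<le> D'" "j \<le> j'" shows "cone D' j' \<psi>"
proof (rule coneI)
  show "0 \<le> \<psi> x" if "x \<in> X" for x using assms(1) that by (rule cone_nonneg)
  fix k x y assume *: "j' \<le> k" "1 \<le> k" "x \<in> X" "y \<in> X" "agree k x y"
  then have "\<psi> x \<le> exp (D * \<beta> ^ k) * \<psi> y" using assms by (intro coneD[of D j]) auto
  also have "\<dots> \<le> exp (D' * \<beta> ^ k) * \<psi> y"
    using assms * beta by (intro mult_right_mono cone_nonneg[of D j]) (auto intro: mult_right_mono)
  finally show "\<psi> x \<le> exp (D' * \<beta> ^ k) * \<psi> y" .
qed

text \<open>Preimages of points that agree on \<open>k\<close> letters agree on \<open>k + 1\<close> letters;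
  this gains the factor \<open>\<beta>\<close>.\<close>

lemma cone_L:
  assumes "cone D (Suc j) \<psi>" shows "cone (\<beta> * (c + D)) j (L \<psi>)"
proof (rule coneI)
  show "0 \<le> L \<psi> x" if "x \<in> X" for x
    using Lpow_nonneg[of x \<psi> 1] assms that by (simp add: cone_nonneg)
  fix k x y assume *: "j \<le> k" "1 \<le> k" "x \<in> X" "y \<in> X" "agree k x y"
  have x0: "x 0 = y 0" using * by (simp add: agree_def)
  have "L \<psi> x \<le> (\<Sum>i | A $ i $ x 0 = 1. exp (\<beta> * (c + D) * \<beta> ^ k) * (G (scons i y) * \<psi> (scons i y)))"
    unfolding L_def
  proof (rule sum_mono)
    fix i assume "i \<in> {i. A $ i $ x 0 = 1}"
    then have i: "scons i x \<in> X" "scons i y \<in> X"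
      using * x0 by (auto intro: scons_subshift)
    have ag: "agree (Suc k) (scons i x) (scons i y)" using * by (intro agree_scons) auto
    have "G (scons i x) * \<psi> (scons i x) \<le>
      (exp (c * \<beta> ^ Suc k) * G (scons i y)) * (exp (D * \<beta> ^ Suc k) * \<psi> (scons i y))"
      using assms * i by (intro mult_mono G_var[OF i ag] coneD[OF assms _ _ i ag] cone_nonneg[OF assms])
        (auto intro!: mult_nonneg_nonneg intro: less_imp_le[OF G_pos])
    also have "\<dots> = exp (\<beta> * (c + D) * \<beta> ^ k) * (G (scons i y) * \<psi> (scons i y))"
      by (simp add: algebra_simps flip: exp_add)
    finally show "G (scons i x) * \<psi> (scons i x) \<le>
      exp (\<beta> * (c + D) * \<beta> ^ k) * (G (scons i y) * \<psi> (scons i y))" .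
  qed
  also have "\<dots> = exp (\<beta> * (c + D) * \<beta> ^ k) * L \<psi> y"
    by (simp add: L_def x0 sum_distrib_left)
  finally show "L \<psi> x \<le> exp (\<beta> * (c + D) * \<beta> ^ k) * L \<psi> y" .
qed

definition B :: real where "B = c / (1 - \<beta>)"

lemma B_nonneg: "0 \<le> B"
  using beta c_nonneg by (simp add: B_def)

lemma B_step: "\<beta> * (c + B) \<le> B" "c = B * (1 - \<beta>)"
proof -
  show *: "c = B * (1 - \<beta>)" using beta by (simp add: B_def)
  have "\<beta> * (c + B) = B - c * (1 - \<beta>)" using * by (simp add: algebra_simps)
  then show "\<beta> * (c + B) \<le> B" using c_nonneg beta by simp
qed

lemma cone_Lpow:
  assumes "cone D 1 \<psi>" shows "cone (B + \<beta> ^ n * D) 1 ((L ^^ n) \<psi>)"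
proof (induction n)
  case 0
  then show ?case using assms B_nonneg by (auto intro: cone_mono)
next
  case (Suc n)
  then have "cone (B + \<beta> ^ n * D) (Suc 1) ((L ^^ n) \<psi>)" by (rule cone_mono) auto
  then have "cone (\<beta> * (c + (B + \<beta> ^ n * D))) 1 (L ((L ^^ n) \<psi>))" by (rule cone_L)
  then have "cone (B + \<beta> ^ Suc n * D) 1 (L ((L ^^ n) \<psi>))"
    by (rule cone_mono) (use B_step in \<open>auto simp: algebra_simps\<close>)
  then show ?case by simp
qed

lemma cone_Lpow_smoothing:
  assumes "cone B (Suc m) \<psi>" shows "cone B 1 ((L ^^ m) \<psi>)"
  using assms
proof (induction m arbitrary: \<psi>)
  case (Suc m)
  have "cone B (Suc m) (L \<psi>)" using cone_L[OF Suc.prems] B_step by (auto intro: cone_mono)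
  then show ?case using Suc.IH[of "L \<psi>"] by (simp add: funpow_swap1)
qed simp

lemma cone_const: "0 \<le> a \<Longrightarrow> 0 \<le> D \<Longrightarrow> cone D j (\<lambda>x. a)"
  using beta by (auto intro!: coneI simp: mult_le_cancel_right1)

text \<open>The indicator function itself is regular only at scales finer than \<open>n\<close>; each
  application of \<open>L\<close> coarsens this scale by one letter.\<close>

lemma cone_indicator:
  assumes "determined A n U" shows "cone B 1 ((L ^^ n) (indicator U))"
proof (rule cone_Lpow_smoothing, rule coneI)
  fix k x y assume *: "Suc n \<le> k" "1 \<le> k" "x \<in> X" "y \<in> X" "agree k x y"
  then have "agree n x y" by (intro agree_mono[of k x y n]) auto
  then have "indicator U x = (indicator U y :: real)"
    using depends_on_indicator[OF assms] * unfolding depends_on_def by blast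
  moreover have "1 \<le> exp (B * \<beta> ^ k)" using B_nonneg beta by simp
  ultimately show "indicator U x \<le> exp (B * \<beta> ^ k) * (indicator U y :: real)"
    by (simp add: indicator_def)
qed simp

text \<open>A Harnack inequality: after a connecting time \<open>d\<close>, every point has a preimage with
  the same first letter as \<open>y\<close>.\<close>

lemma cone_lower_bound:
  obtains d b where "0 < b" "\<And>D v x y n. 0 \<le> D \<Longrightarrow> cone D 1 v \<Longrightarrow> x \<in> X \<Longrightarrow> y \<in> X \<Longrightarrow>
    b * exp (- D) * v y \<le> (L ^^ d) v x"
proof -
  obtain b M where b: "0 < b" "\<And>x. x \<in> X \<Longrightarrow> b \<le> G x" by (rule G_bounds) auto
  obtain d where d: "\<And>i x. x \<in> X \<Longrightarrow> \<exists>y\<in>X. y 0 = i \<and> (shift_map ^^ d) y = x"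
    using connecting_time by blast
  show ?thesis
  proof (rule that[of "b ^ d" d])
    fix D v x y assume *: "0 \<le> D" "cone D 1 v" "x \<in> X" "y \<in> X"
    then obtain y' where y': "y' \<in> X" "y' 0 = y 0" "(shift_map ^^ d) y' = x" using d by blast
    have "v y \<le> exp (D * \<beta> ^ 1) * v y'"
      by (rule coneD[OF *(2)]) (use * y' in \<open>auto simp: agree_def\<close>)
    also have "\<dots> \<le> exp D * v y'"
      using * beta y' by (intro mult_right_mono cone_nonneg[OF *(2)]) (auto simp: mult_left_le)
    finally have "exp (- D) * v y \<le> v y'" by (simp add: exp_minus field_simps)
    then have "b ^ d * (exp (- D) * v y) \<le> b ^ d * v y'" using b by (intro mult_left_mono) auto
    also have "\<dots> \<le> (L ^^ d) v x"
      using Lpow_ge[OF b y'(1), of v d] cone_nonneg[OF *(2)] y'(3) by auto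
    finally show "b ^ d * exp (- D) * v y \<le> (L ^^ d) v x" by (simp add: mult.assoc)
  qed (use b in simp)
qed

end

section \<open>A positive eigenfunction\<close>

context transfer_operator
begin

lemma L_tendsto:
  assumes "x \<in> X" "\<And>y. y \<in> X \<Longrightarrow> (\<lambda>n. f n y) \<longlonglongrightarrow> g y"
  shows "(\<lambda>n. L (f n) x) \<longlonglongrightarrow> L g x"
  unfolding L_def
  by (intro tendsto_sum tendsto_mult tendsto_const assms(2)) (use assms(1) in \<open>auto intro!: scons_subshift\<close>)

lemma cone_tendsto:
  assumes "\<And>n. cone D j (f n)" "\<And>y. y \<in> X \<Longrightarrow> (\<lambda>n. f n y) \<longlonglongrightarrow> g y"
  shows "cone D j g"
proof (rule coneI)
  show "0 \<le> g x" if "x \<in> X" for x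
    using LIMSEQ_le_const[OF assms(2)[OF that]] cone_nonneg[OF assms(1) that] by blast
  fix k x y assume *: "j \<le> k" "1 \<le> k" "x \<in> X" "y \<in> X" "agree k x y"
  show "g x \<le> exp (D * \<beta> ^ k) * g y"
    by (rule LIMSEQ_le[OF assms(2)[OF *(3)] tendsto_mult[OF tendsto_const assms(2)[OF *(4)]]])
      (use coneD[OF assms(1) *] in blast)
qed

lemma cone_scale: "cone D j \<psi> \<Longrightarrow> 0 \<le> a \<Longrightarrow> cone D j (\<lambda>x. a * \<psi> x)"
  by (rule coneI) (auto simp: cone_nonneg mult.left_commute intro!: mult_left_mono coneD)

lemma cone_B_Lpow: "cone B 1 \<psi> \<Longrightarrow> cone B 1 ((L ^^ n) \<psi>)"
  by (rule cone_Lpow_smoothing, erule cone_mono) auto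

text \<open>With \<open>u n = L\<^sup>n 1\<close> and \<open>lam\<close> the infimum of the
  \<open>n\<close>-th roots of \<open>sup u n\<close>, the Harnack inequality bounds \<open>u n /
  lam\<^sup>n\<close> from above and below. Its upper limit \<open>W\<close> satisfies \<open>lam W \<le> L
  W\<close>, because an upper limit is subadditive; hence \<open>(L / lam)\<^sup>n W\<close> increases, and
  its limit is an eigenfunction.\<close>

theorem eigenfunction:
  obtains lam h a C where "0 < lam" "cone B 1 h" "0 < a" "\<And>x. x \<in> X \<Longrightarrow> a \<le> h x"
    "\<And>x. x \<in> X \<Longrightarrow> h x \<le> C" "\<And>x. x \<in> X \<Longrightarrow> L h x = lam * h x"
proof -
  define u where "u n = (L ^^ n) (\<lambda>_. 1)" for n
  obtain x0 where x0: "x0 \<in> X" using nonempty by blast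
  obtain g M where g: "0 < g" "\<And>x. x \<in> X \<Longrightarrow> g \<le> G x" and M: "0 < M" "\<And>x. x \<in> X \<Longrightarrow> G x \<le> M"
    using G_bounds by metis
  obtain b d where b: "0 < b" and bd: "\<And>D v x y n. 0 \<le> D \<Longrightarrow> cone D 1 v \<Longrightarrow> x \<in> X \<Longrightarrow> y \<in> X \<Longrightarrow>
    b * exp (- D) * v y \<le> (L ^^ d) v x" using cone_lower_bound by metis
  define \<kappa> where "\<kappa> = b * exp (- B)"
  have \<kappa>: "0 < \<kappa>" using b by (simp add: \<kappa>_def)
  have u_add: "u (n + m) = (L ^^ n) (u m)" for n m by (simp add: u_def funpow_add)
  have u_cone: "cone B 1 (u n)" for n
    unfolding u_def by (intro cone_B_Lpow cone_const) (auto simp: B_nonneg)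
  define K where "K = real CARD('s) * M"
  have K: "0 \<le> K" using M by (simp add: K_def)
  have L1: "L (\<lambda>_. 1) x \<le> K" if "x \<in> X" for x
  proof -
    have "L (\<lambda>_. 1) x \<le> (\<Sum>i | A $ i $ x 0 = 1. M)"
      unfolding L_def by (intro sum_mono) (use that in \<open>auto intro!: M scons_subshift\<close>)
    also have "\<dots> \<le> K" unfolding K_def
      using M by (simp add: card_mono mult_right_mono)
    finally show ?thesis .
  qed
  have u_le: "u n x \<le> K ^ n" if "x \<in> X" for n x
    using that
  proof (induction n arbitrary: x)
    case (Suc n)
    have "u (Suc n) x = L (u n) x" by (simp add: u_def)
    also have "\<dots> \<le> L (\<lambda>x. K ^ n * 1) x" using Suc by (intro L_mono) auto
    also have "\<dots> = K ^ n * L (\<lambda>_. 1) x" by (simp only: L_scale)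
    also have "\<dots> \<le> K ^ n * K" using K L1[OF Suc.prems] by (intro mult_left_mono) auto
    finally show ?case by (simp add: mult.commute)
  qed (simp add: u_def)
  define s where "s n = (SUP x\<in>X. u n x)" for n
  have bdd: "bdd_above (u n ` X)" for n using u_le by (intro bdd_aboveI2) auto
  have u_s: "u n x \<le> s n" if "x \<in> X" for n x
    unfolding s_def by (intro cSUP_upper that bdd)
  have s_least: "s n \<le> r" if "\<And>x. x \<in> X \<Longrightarrow> u n x \<le> r" for n r
    unfolding s_def by (intro cSUP_least nonempty that)
  have g_s: "g ^ n \<le> s n" for n
  proof -
    have "g ^ n * 1 \<le> u n ((shift_map ^^ n) x0)" unfolding u_def by (intro Lpow_ge g x0) auto
    also have "\<dots> \<le> s n" using x0 by (intro u_s) auto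
    finally show ?thesis by simp
  qed
  have s_pos: "0 < s n" for n using g_s[of n] g by (meson less_le_trans zero_less_power)
  have s_add: "s (n + m) \<le> s n * s m" for n m
  proof (rule s_least)
    fix x assume x: "x \<in> X"
    have "u (n + m) x \<le> (L ^^ n) (\<lambda>_. s m * 1) x"
      unfolding u_add by (intro Lpow_mono x) (auto intro: u_s)
    also have "\<dots> = s m * u n x" by (simp only: Lpow_scale u_def)
    also have "\<dots> \<le> s m * s n" using u_s[OF x] s_pos[of m] by (intro mult_left_mono) auto
    finally show "u (n + m) x \<le> s n * s m" by (simp add: mult.commute)
  qed
  have s0: "s 0 = 1" unfolding s_def u_def using nonempty by simp
  have s_mult: "s (m * N) \<le> s m ^ N" for m N
  proof (induction N)
    case (Suc N)
    have "s (m * Suc N) \<le> s m * s (m * N)" using s_add[of m "m * N"] by simp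
    also have "\<dots> \<le> s m * s m ^ N" using Suc s_pos[of m] by (intro mult_left_mono) auto
    finally show ?case by simp
  qed (simp add: s0)
  have u_super: "i ^ k \<le> u (k * n) x" if i: "0 \<le> i" "\<And>x. x \<in> X \<Longrightarrow> i \<le> u n x" and x: "x \<in> X" for i k n x
    using x
  proof (induction k arbitrary: x)
    case (Suc k)
    have "i ^ Suc k \<le> i ^ k * u n x" using mult_left_mono[OF i(2)[OF Suc.prems], of "i ^ k"] i(1) by (simp add: mult.commute)
    also have "\<dots> = (L ^^ n) (\<lambda>_. i ^ k * 1) x" by (simp only: Lpow_scale u_def)
    also have "\<dots> \<le> (L ^^ n) (u (k * n)) x" using Suc by (intro Lpow_mono) auto
    also have "\<dots> = u (Suc k * n) x" by (simp add: u_add)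
    finally show ?case .
  qed (simp add: u_def)
  define lam where "lam = (INF m\<in>{1::nat..}. root m (s m))"
  have g_root: "g \<le> root m (s m)" if "1 \<le> m" for m
    using real_root_le_mono[of m, OF _ g_s[of m]] that g by (simp add: real_root_power_cancel)
  have lam_le: "lam \<le> root m (s m)" if "1 \<le> m" for m
    unfolding lam_def by (rule cINF_lower) (use that g_root in \<open>auto intro!: bdd_belowI2\<close>)
  have "g \<le> lam" unfolding lam_def by (rule cINF_greatest) (use g_root in auto)
  then have lam: "0 < lam" using g by simp
  have lam_s: "lam ^ m \<le> s m" for m
  proof (cases "m = 0")
    case False
    then have "lam ^ m \<le> root m (s m) ^ m" using lam lam_le[of m] by (intro power_mono) auto
    then show ?thesis using False s_pos[of m] by simp
  qed (simp add: s0)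
  have i_lam: "i \<le> lam ^ n" if i: "0 \<le> i" "\<And>x. x \<in> X \<Longrightarrow> i \<le> u n x" and n: "1 \<le> n" for i n
  proof -
    have "root n i \<le> root m (s m)" if m: "1 \<le> m" for m
    proof -
      have "i ^ m \<le> u (m * n) x0" by (rule u_super[OF i x0])
      also have "\<dots> \<le> s m ^ n" using u_s[OF x0, of "m * n"] s_mult[of m n] by linarith
      finally have "(root n i ^ n) ^ m \<le> (root m (s m) ^ m) ^ n"
        using n m i(1) s_pos[of m] by simp
      then have "root n i ^ (n * m) \<le> root m (s m) ^ (n * m)"
        by (simp add: power_mult[symmetric] mult.commute)
      then show ?thesis using n m s_pos[of m] i(1)
        by (subst (asm) power_mono_iff) (auto intro: less_imp_le)
    qed
    then have "root n i \<le> lam" unfolding lam_def by (intro cINF_greatest) auto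
    then have "root n i ^ n \<le> lam ^ n" using i n by (intro power_mono) auto
    then show ?thesis using n i by simp
  qed
  have low: "\<kappa> * s n \<le> u (d + n) x" if x: "x \<in> X" for n x
  proof -
    have "s n \<le> u (d + n) x / \<kappa>"
      by (rule s_least) (use bd[OF B_nonneg u_cone x] \<kappa> in \<open>simp add: u_add \<kappa>_def field_simps\<close>)
    then show ?thesis using \<kappa> by (simp add: field_simps)
  qed
  define C1 where "C1 = lam ^ d / \<kappa>"
  define C2 where "C2 = \<kappa> / lam ^ d"
  have C: "0 < C1" "0 < C2" using \<kappa> lam by (auto simp: C1_def C2_def)
  have s_le: "s n \<le> C1 * lam ^ n" if "1 \<le> n" for n
  proof -
    have "\<kappa> * s n \<le> lam ^ (d + n)"
      using that \<kappa> s_pos[of n] by (intro i_lam low) auto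
    then show ?thesis using \<kappa> by (simp add: C1_def field_simps power_add)
  qed
  define v where "v n x = (1 / lam ^ n) * u n x" for n x
  have v_le: "v n x \<le> C1" if "x \<in> X" "1 \<le> n" for n x
    using order_trans[OF u_s[OF that(1)] s_le[OF that(2)]] lam by (simp add: v_def field_simps)
  have v_ge: "C2 \<le> v (d + n) x" if x: "x \<in> X" for n x
  proof -
    have "\<kappa> * lam ^ n \<le> u (d + n) x"
      using order_trans[OF mult_left_mono[OF lam_s[of n]] low[OF x]] \<kappa> by simp
    then show ?thesis using lam by (simp add: v_def C2_def field_simps power_add)
  qed
  have v_cone: "cone B 1 (v n)" for n
    unfolding v_def using lam by (intro cone_scale u_cone) auto
  have L_v: "L (v n) x = lam * v (Suc n) x" for n x
    unfolding v_def L_scale using lam by (simp add: u_def)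

  define w where "w N x = (SUP n\<in>{Suc N..}. v n x)" for N x
  have bddv: "bdd_above ((\<lambda>n. v n x) ` {Suc N..})" if "x \<in> X" for x N
    using v_le[OF that] by (intro bdd_aboveI2[where M=C1]) auto
  have v_w: "v n x \<le> w N x" if "x \<in> X" "Suc N \<le> n" for x n N
    unfolding w_def by (intro cSUP_upper bddv that) (use that in auto)
  have w_least: "w N x \<le> r" if "\<And>n. Suc N \<le> n \<Longrightarrow> v n x \<le> r" for N x r
    unfolding w_def by (intro cSUP_least) (use that in auto)
  have w_ge: "C2 \<le> w N x" if "x \<in> X" for N x
    using v_ge[OF that, of "Suc N"] v_w[OF that, of N "d + Suc N"] by simp
  have w_le: "w N x \<le> C1" if "x \<in> X" for N x
    by (rule w_least) (use v_le[OF that] in auto)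
  have w_cone: "cone B 1 (w N)" for N
  proof (rule coneI)
    show "0 \<le> w N x" if "x \<in> X" for x using w_ge[OF that, of N] C by simp
    fix k x y assume *: "1 \<le> k" "1 \<le> k" "x \<in> X" "y \<in> X" "agree k x y"
    show "w N x \<le> exp (B * \<beta> ^ k) * w N y"
    proof (rule w_least)
      fix n assume n: "Suc N \<le> n"
      have "v n x \<le> exp (B * \<beta> ^ k) * v n y" by (rule coneD[OF v_cone *])
      also have "\<dots> \<le> exp (B * \<beta> ^ k) * w N y" using v_w[OF *(4) n] by (intro mult_left_mono) auto
      finally show "v n x \<le> exp (B * \<beta> ^ k) * w N y" .
    qed
  qed
  have "\<exists>l. (\<lambda>N. w N x) \<longlonglongrightarrow> l" if x: "x \<in> X" for x
  proof -
    have "decseq (\<lambda>N. w N x)"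
      unfolding decseq_def by (intro allI impI w_least v_w[OF x]) auto
    then show ?thesis using decseq_convergent[of "\<lambda>N. w N x" C2] w_ge[OF x] by blast
  qed
  then obtain W where W: "\<And>x. x \<in> X \<Longrightarrow> (\<lambda>N. w N x) \<longlonglongrightarrow> W x" by metis
  have W_cone: "cone B 1 W" by (rule cone_tendsto[OF w_cone W])
  have W_ge: "C2 \<le> W x" if "x \<in> X" for x
    using LIMSEQ_le_const[OF W[OF that]] w_ge[OF that] by blast
  have W_le: "W x \<le> C1" if "x \<in> X" for x
    using LIMSEQ_le_const2[OF W[OF that]] w_le[OF that] by blast
  have L_w: "lam * w (Suc N) x \<le> L (w N) x" if x: "x \<in> X" for N x
  proof -
    have "w (Suc N) x \<le> L (w N) x / lam"
    proof (rule w_least)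
      fix n assume n: "Suc (Suc N) \<le> n"
      then obtain m where m: "n = Suc m" "Suc N \<le> m" by (metis Suc_le_D Suc_le_mono)
      have "lam * v n x \<le> L (w N) x"
        unfolding m(1) L_v[symmetric] using m by (intro L_mono x v_w) auto
      then show "v n x \<le> L (w N) x / lam" using lam by (simp add: field_simps)
    qed
    then show ?thesis using lam by (simp add: field_simps)
  qed
  have L_W: "lam * W x \<le> L W x" if x: "x \<in> X" for x
    by (rule LIMSEQ_le[OF tendsto_mult[OF tendsto_const LIMSEQ_Suc[OF W[OF x]]] L_tendsto[OF x W]])
      (use L_w[OF x] in auto)

  define t where "t n x = (1 / lam ^ n) * (L ^^ n) W x" for n x
  have t_cone: "cone B 1 (t n)" for n
    unfolding t_def using lam by (intro cone_scale cone_B_Lpow W_cone) auto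
  have L_t: "L (t n) x = lam * t (Suc n) x" for n x
    unfolding t_def L_scale using lam by simp
  have t_Suc: "t n x \<le> t (Suc n) x" if x: "x \<in> X" for n x
  proof -
    have "lam * (L ^^ n) W x = (L ^^ n) (\<lambda>x. lam * W x) x" by (simp only: Lpow_scale)
    also have "\<dots> \<le> (L ^^ n) (L W) x" by (intro Lpow_mono x L_W)
    finally show ?thesis using lam by (simp add: t_def field_simps funpow_swap1)
  qed
  have t_inc: "incseq (\<lambda>n. t n x)" if "x \<in> X" for x
    by (rule incseq_SucI) (rule t_Suc[OF that])
  have t_le: "t n x \<le> C1 * C1" if x: "x \<in> X" for n x
  proof -
    have "(L ^^ Suc n) W x \<le> (L ^^ Suc n) (\<lambda>x. C1 * 1) x" by (intro Lpow_mono x) (simp add: W_le)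
    also have "\<dots> = C1 * u (Suc n) x" by (simp only: Lpow_scale u_def)
    also have "\<dots> \<le> C1 * (C1 * lam ^ Suc n)"
      using C u_s[OF x, of "Suc n"] s_le[of "Suc n"] by (intro mult_left_mono) auto
    finally have "t (Suc n) x \<le> C1 * C1" using lam by (simp add: t_def field_simps)
    then show ?thesis using t_Suc[OF x, of n] by simp
  qed
  have "\<exists>l. (\<lambda>n. t n x) \<longlonglongrightarrow> l" if x: "x \<in> X" for x
    using incseq_convergent[OF t_inc[OF x]] t_le[OF x] by metis
  then obtain h where h: "\<And>x. x \<in> X \<Longrightarrow> (\<lambda>N. t N x) \<longlonglongrightarrow> h x" by metis
  have "t 0 x \<le> h x" if "x \<in> X" for x using incseq_le[OF t_inc[OF that] h[OF that]] .
  then have h_ge: "C2 \<le> h x" if "x \<in> X" for x using that W_ge[OF that] by (force simp: t_def)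
  have h_le: "h x \<le> C1 * C1" if "x \<in> X" for x
    using LIMSEQ_le_const2[OF h[OF that]] t_le[OF that] by blast
  have "L h x = lam * h x" if x: "x \<in> X" for x
  proof (rule LIMSEQ_unique[OF L_tendsto[OF x h]])
    show "(\<lambda>n. L (t n) x) \<longlonglongrightarrow> lam * h x"
      unfolding L_t by (intro tendsto_mult tendsto_const LIMSEQ_Suc h x)
  qed
  with that[OF lam cone_tendsto[OF t_cone h] C(2) h_ge h_le] show ?thesis by simp
qed

end

section \<open>Normalized operators: exponential convergence\<close>

locale clopen_prob = aperiodic_subshift A + prob_space \<mu>
  for A :: "nat ^ 's::finite ^ 's" and \<mu> :: "(nat \<Rightarrow> 's) measure" +
  assumes sets_eq: "sets \<mu> = sigma_sets (subshift A) (clopens A)"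
begin

lemma space_eq: "space \<mu> = X"
proof -
  have "sets \<mu> = sets (sigma X (clopens A))"
    using sets_eq by (subst sets_measure_of) (auto simp: clopens_def determined_def)
  then show ?thesis using sets_eq_imp_space_eq[of \<mu>]
    by (simp add: space_measure_of_conv)
qed

lemma clopen_sets [simp]: "U \<in> clopens A \<Longrightarrow> U \<in> sets \<mu>"
  by (simp add: sets_eq)

lemma determined_sets [intro]: "determined A n U \<Longrightarrow> U \<in> sets \<mu>"
  by (rule clopen_sets) (rule clopensI)

lemma shift_measurable [measurable]: "shift_map \<in> measurable \<mu> \<mu>"
proof (rule measurable_sigma_sets[OF sets_eq])
  show "clopens A \<subseteq> Pow X" by (auto simp: clopens_def determined_def)
  show "shift_map \<in> space \<mu> \<rightarrow> X" by (auto simp: space_eq)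
  fix V assume "V \<in> clopens A"
  then obtain n where "determined A n V" by (auto simp: clopens_def)
  then have "determined A (1 + n) (preim A 1 V)" by (rule determined_preim)
  moreover have "shift_map -` V \<inter> space \<mu> = preim A 1 V" by (auto simp: space_eq preim_def)
  ultimately show "shift_map -` V \<inter> space \<mu> \<in> sets \<mu>" by auto
qed

lemma shift_pow_measurable [measurable]: "(shift_map ^^ n) \<in> measurable \<mu> \<mu>"
  by (induction n) (auto intro: measurable_comp simp: measurable_ident)

lemma preim_eq: "preim A n V = (shift_map ^^ n) -` V \<inter> space \<mu>"
  by (auto simp: preim_def space_eq)

lemma preim_sets [intro]: "V \<in> sets \<mu> \<Longrightarrow> preim A n V \<in> sets \<mu>"
  unfolding preim_eq by (rule measurable_sets[OF shift_pow_measurable])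

lemma eq_if_eq_on_clopens:
  assumes "clopen_prob A \<nu>" "\<And>n U. determined A n U \<Longrightarrow> measure \<mu> U = measure \<nu> U"
  shows "\<mu> = \<nu>"
proof (rule measure_eqI_generator_eq[where A = "\<lambda>_. X"])
  interpret N: clopen_prob A \<nu> by fact
  interpret C: algebra X "clopens A" by (rule algebra_clopens)
  show "Int_stable (clopens A)" by (auto simp: Int_stable_def)
  show "clopens A \<subseteq> Pow X" by (rule C.space_closed)
  show "emeasure \<mu> V = emeasure \<nu> V" if "V \<in> clopens A" for V
    using that assms(2) by (auto simp: emeasure_eq_measure N.emeasure_eq_measure clopens_def)
  show "sets \<mu> = sigma_sets X (clopens A)" "sets \<nu> = sigma_sets X (clopens A)"
    by (rule sets_eq N.sets_eq)+
qed (auto simp: clopens_def intro: exI[of _ 0])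

end

locale invariant_measure = clopen_prob A \<mu>
  for A :: "nat ^ 's::finite ^ 's" and \<mu> :: "(nat \<Rightarrow> 's) measure" +
  assumes invariant: "V \<in> sets \<mu> \<Longrightarrow> measure \<mu> (preim A 1 V) = measure \<mu> V"
begin

lemma invariant_pow: "V \<in> sets \<mu> \<Longrightarrow> measure \<mu> (preim A n V) = measure \<mu> V"
proof (induction n)
  case 0
  then show ?case using sets.sets_into_space[of V \<mu>] by (simp add: preim_0 space_eq)
next
  case (Suc n)
  then show ?case using invariant[of "preim A n V"] by (simp add: preim_preim preim_sets)
qed

end

lemma (in clopen_prob) invariant_measure_if_clopens:
  assumes "\<And>n V. determined A n V \<Longrightarrow> measure \<mu> (preim A 1 V) = measure \<mu> V"
  shows "invariant_measure A \<mu>"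
proof unfold_locales
  let ?D = "distr \<mu> \<mu> shift_map"
  have D: "clopen_prob A ?D"
    by (intro clopen_prob.intro aperiodic_subshift_axioms clopen_prob_axioms.intro
        prob_space_distr) (auto simp: sets_eq)
  have "?D = \<mu>"
  proof (rule clopen_prob.eq_if_eq_on_clopens[OF D clopen_prob_axioms])
    fix n U assume U: "determined A n U"
    then have "measure ?D U = measure \<mu> (preim A 1 U)"
      by (simp add: measure_distr determined_sets preim_eq)
    with assms[OF U] show "measure ?D U = measure \<mu> U" by simp
  qed
  then show "measure \<mu> (preim A 1 V) = measure \<mu> V" if "V \<in> sets \<mu>" for V
    using measure_distr[OF shift_measurable that] by (simp add: preim_eq)
qed

locale normalized_operator = transfer_operator A G \<beta> c
  for A :: "nat ^ 's::finite ^ 's" and G :: "(nat \<Rightarrow> 's) \<Rightarrow> real" and \<beta> c :: real +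
  assumes L_one: "x \<in> X \<Longrightarrow> L (\<lambda>_. 1) x = 1"
begin

lemma Lpow_const: "x \<in> X \<Longrightarrow> (L ^^ n) (\<lambda>_. a) x = a"
proof -
  have "(L ^^ n) (\<lambda>_. 1) x = 1" if "x \<in> X" for x
    using that
  proof (induction n arbitrary: x)
    case (Suc n)
    have "L ((L ^^ n) (\<lambda>_. 1)) x = L (\<lambda>_. 1) x" by (rule L_cong) (use Suc in auto)
    then show ?case using L_one Suc.prems by simp
  qed simp
  then show "x \<in> X \<Longrightarrow> ?thesis" using Lpow_scale[of n a "\<lambda>_. 1"] by simp
qed

lemma Lpow_add_const: "x \<in> X \<Longrightarrow> (L ^^ n) (\<lambda>x. a + \<psi> x) x = a + (L ^^ n) \<psi> x"
  by (simp add: Lpow_add Lpow_const)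

text \<open>By the Harnack inequality a fixed fraction \<open>\<kappa> / 2\<close> of the supremum can be
  subtracted from \<open>L\<^sup>N v\<close>. The smoothing of \<open>L\<^sup>N\<close> is used up to stay in
  the cone: subtracting at most half of the function doubles the constant \<open>2 B\<close> to \<open>4 B =
  D\<close>.\<close>

lemma cone_contraction:
  obtains N \<kappa> D where "1 \<le> N" "0 < \<kappa>" "\<kappa> \<le> 1" "B \<le> D"
    "\<And>v x y. cone D 1 v \<Longrightarrow> x \<in> X \<Longrightarrow> y \<in> X \<Longrightarrow> \<kappa> * v y \<le> (L ^^ N) v x"
    "\<And>v S. cone D 1 v \<Longrightarrow> (\<And>x. x \<in> X \<Longrightarrow> v x \<le> S) \<Longrightarrow>
      \<exists>a v'. cone D 1 v' \<and> (\<forall>x\<in>X. (L ^^ N) v x = a + v' x) \<and> (\<forall>x\<in>X. v' x \<le> (1 - \<kappa> / 2) * S)"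
proof -
  obtain b d where b: "0 < b" and bd: "\<And>D v x y n. 0 \<le> D \<Longrightarrow> cone D 1 v \<Longrightarrow> x \<in> X \<Longrightarrow> y \<in> X \<Longrightarrow>
    b * exp (- D) * v y \<le> (L ^^ d) v x" using cone_lower_bound by metis
  \<comment> \<open>The cone constant is four times the constant \<open>B\<close> that the iterates approach, which leaves room for the subtraction.\<close>
  define D where "D = 4 * B"
  have D: "0 \<le> D" "B \<le> D" using B_nonneg by (auto simp: D_def)
  obtain N0 where N0: "\<beta> ^ N0 < 1 / 4" using real_arch_pow_inv[of "1/4" \<beta>] beta by auto
  define N where "N = N0 + d + 1"
  have "\<beta> ^ N \<le> \<beta> ^ N0" using beta by (intro power_decreasing) (auto simp: N_def)
  then have "\<beta> ^ N * (4 * B) \<le> 1 / 4 * (4 * B)" using N0 B_nonneg by (intro mult_right_mono) auto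
  then have N: "B + \<beta> ^ N * D \<le> 2 * B" by (simp add: D_def)
  define \<kappa> where "\<kappa> = b * exp (- D)"
  have \<kappa>: "0 < \<kappa>" using b by (simp add: \<kappa>_def)
  obtain x0 where x0: "x0 \<in> X" using nonempty by blast
  have "\<kappa> * 1 \<le> (L ^^ d) (\<lambda>_. 1) x0"
    unfolding \<kappa>_def by (rule bd[OF D(1) cone_const x0 x0]) (use D in auto)
  then have \<kappa>1: "\<kappa> \<le> 1" using Lpow_const[OF x0] by simp
  have low: "\<kappa> * v y \<le> (L ^^ N) v x" if "cone D 1 v" "x \<in> X" "y \<in> X" for v x y
  proof -
    have "(L ^^ (N - d)) (\<lambda>_. \<kappa> * v y) x \<le> (L ^^ (N - d)) ((L ^^ d) v) x"
      using bd[OF D(1) that(1) _ that(3)] that(2) by (intro Lpow_mono) (auto simp: \<kappa>_def)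
    also have "\<dots> = (L ^^ N) v x"
    proof -
      have "(N - d) + d = N" by (simp add: N_def)
      then show ?thesis using funpow_add[of "N - d" d L] by simp
    qed
    finally show ?thesis using Lpow_const that by simp
  qed
  have contr: "\<exists>a v'. cone D 1 v' \<and> (\<forall>x\<in>X. (L ^^ N) v x = a + v' x) \<and> (\<forall>x\<in>X. v' x \<le> (1 - \<kappa> / 2) * S)"
    if v: "cone D 1 v" and S: "\<And>x. x \<in> X \<Longrightarrow> v x \<le> S" for v S
  proof -
    define T where "T = (SUP x\<in>X. v x)"
    have vT: "v x \<le> T" if "x \<in> X" for x
      unfolding T_def by (rule cSUP_upper[OF that]) (use S in \<open>auto intro!: bdd_aboveI2\<close>)
    have TS: "T \<le> S" unfolding T_def by (intro cSUP_least nonempty S)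
    have T0: "0 \<le> T" using vT[OF x0] cone_nonneg[OF v x0] by simp
    define u where "u = (L ^^ N) v"
    define a where "a = \<kappa> * T / 2"
    have a0: "0 \<le> a" using \<kappa> T0 by (simp add: a_def)
    have ua: "2 * a \<le> u x" if x: "x \<in> X" for x
    proof -
      have "T \<le> u x / \<kappa>" unfolding T_def
        by (rule cSUP_least[OF nonempty]) (use low[OF v x] \<kappa> in \<open>simp add: u_def field_simps\<close>)
      then show ?thesis using \<kappa> by (simp add: a_def field_simps)
    qed
    have uT: "u x \<le> T" if x: "x \<in> X" for x
      using Lpow_mono[OF x, of v "\<lambda>_. T" N] vT Lpow_const[OF x] by (simp add: u_def)
    have ucone: "cone (2 * B) 1 u"
      unfolding u_def using cone_Lpow[OF v, of N] N by (rule cone_mono) simp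
    have "cone D 1 (\<lambda>x. u x - a)"
    proof (rule coneI)
      show "0 \<le> u x - a" if "x \<in> X" for x using ua[OF that] a0 by simp
      fix k x y assume *: "1 \<le> k" "1 \<le> k" "x \<in> X" "y \<in> X" "agree k x y"
      define q where "q = exp (2 * B * \<beta> ^ k)"
      have q: "1 \<le> q" using B_nonneg beta by (simp add: q_def)
      have qq: "exp (D * \<beta> ^ k) = q * q" by (simp add: q_def D_def flip: exp_add)
      have "u x \<le> q * u y" unfolding q_def by (rule coneD[OF ucone *])
      moreover have "a * (q + 1) \<le> q * u y"
      proof -
        have "a * (q + 1) \<le> q * (2 * a)" using mult_left_mono[OF q a0] by (simp add: algebra_simps)
        also have "\<dots> \<le> q * u y" using ua[OF *(4)] q by (intro mult_left_mono) auto
        finally show ?thesis .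
      qed
      then have "0 \<le> (q - 1) * (q * u y - a * (q + 1))" using q by (intro mult_nonneg_nonneg) auto
      then have "q * u y - a \<le> q * q * (u y - a)" by (simp add: algebra_simps)
      ultimately show "u x - a \<le> exp (D * \<beta> ^ k) * (u y - a)" unfolding qq by linarith
    qed
    moreover have "u x - a \<le> (1 - \<kappa> / 2) * S" if "x \<in> X" for x
    proof -
      have "u x - a \<le> (1 - \<kappa> / 2) * T" using uT[OF that] by (simp add: a_def algebra_simps)
      also have "\<dots> \<le> (1 - \<kappa> / 2) * S" using TS \<kappa>1 by (intro mult_left_mono) auto
      finally show ?thesis .
    qed
    ultimately show ?thesis by (intro exI[of _ a] exI[of _ "\<lambda>x. u x - a"]) (auto simp: u_def)
  qed
  show ?thesis by (rule that[OF _ \<kappa> \<kappa>1 D(2) low contr]) (auto simp: N_def)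
qed

text \<open>Iterating the contraction writes \<open>L\<^sup>j v\<close> as a constant plus a geometrically
  small rest. The error is relative to the limit \<open>E\<close>, as \<open>\<psi>\<close>-mixing requires,
  because the Harnack inequality bounds the supremum of \<open>v\<close> by a multiple of
  \<open>E\<close>.\<close>

theorem exponential_convergence:
  obtains r :: "nat \<Rightarrow> real" where "r \<longlonglongrightarrow> 0" "\<And>j. 0 \<le> r j"
    "\<And>v. cone B 1 v \<Longrightarrow> \<exists>E\<ge>0. \<forall>j. \<forall>x\<in>X. \<bar>(L ^^ j) v x - E\<bar> \<le> r j * E"
proof -
  obtain N \<kappa> D where N: "1 \<le> N" and \<kappa>: "0 < \<kappa>" "\<kappa> \<le> 1" and D: "B \<le> D"
    and low: "\<And>v x y. cone D 1 v \<Longrightarrow> x \<in> X \<Longrightarrow> y \<in> X \<Longrightarrow> \<kappa> * v y \<le> (L ^^ N) v x"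
    and contr: "\<And>v S. cone D 1 v \<Longrightarrow> (\<And>x. x \<in> X \<Longrightarrow> v x \<le> S) \<Longrightarrow>
      \<exists>a v'. cone D 1 v' \<and> (\<forall>x\<in>X. (L ^^ N) v x = a + v' x) \<and> (\<forall>x\<in>X. v' x \<le> (1 - \<kappa> / 2) * S)"
    using cone_contraction by metis
  obtain x0 where x0: "x0 \<in> X" using nonempty by blast
  define q where "q = 1 - \<kappa> / 2"
  have q: "0 \<le> q" "q < 1" using \<kappa> by (auto simp: q_def)
  define r where "r j = q ^ (j div N) / \<kappa>" for j
  have "(\<lambda>j. q ^ (j div N) / \<kappa>) \<longlonglongrightarrow> 0 / \<kappa>"
    by (intro tendsto_divide tendsto_const
        filterlim_compose[OF LIMSEQ_power_zero filterlim_at_top_div_const_nat]) (use q \<kappa> N in auto)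
  then have r: "r \<longlonglongrightarrow> 0" by (simp add: r_def[abs_def])
  have "\<exists>E\<ge>0. \<forall>j. \<forall>x\<in>X. \<bar>(L ^^ j) v x - E\<bar> \<le> r j * E" if vB: "cone B 1 v" for v
  proof -
    have v: "cone D 1 v" using vB D by (rule cone_mono) simp
    define S where "S = (SUP x\<in>X. v x)"
    have "v x \<le> (L ^^ N) v x0 / \<kappa>" if "x \<in> X" for x
      using low[OF v x0 that] \<kappa> by (simp add: field_simps)
    then have vS: "v x \<le> S" if "x \<in> X" for x
      unfolding S_def by (rule cSUP_upper[OF that bdd_aboveI2])
    have S_le: "\<kappa> * S \<le> (L ^^ N) v x" if "x \<in> X" for x
    proof -
      have "S \<le> (L ^^ N) v x / \<kappa>" unfolding S_def
        by (rule cSUP_least[OF nonempty]) (use low[OF v that] \<kappa> in \<open>simp add: field_simps\<close>)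
      then show ?thesis using \<kappa> by (simp add: field_simps)
    qed
    have S0: "0 \<le> S" using vS[OF x0] cone_nonneg[OF v x0] by simp
    have it: "\<exists>a v'. cone D 1 v' \<and> (\<forall>x\<in>X. (L ^^ (k * N)) v x = a + v' x) \<and> (\<forall>x\<in>X. v' x \<le> q ^ k * S)" for k
    proof (induction k)
      case 0
      show ?case using v vS by (intro exI[of _ 0] exI[of _ v]) auto
    next
      case (Suc k)
      then obtain a v' where v': "cone D 1 v'" "\<And>x. x \<in> X \<Longrightarrow> (L ^^ (k * N)) v x = a + v' x"
        "\<And>x. x \<in> X \<Longrightarrow> v' x \<le> q ^ k * S" by blast
      from contr[OF v'(1,3)] obtain a' v'' where v'': "cone D 1 v''"
        "\<And>x. x \<in> X \<Longrightarrow> (L ^^ N) v' x = a' + v'' x" "\<And>x. x \<in> X \<Longrightarrow> v'' x \<le> q * (q ^ k * S)"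
        unfolding q_def by blast
      have "(L ^^ (Suc k * N)) v x = (a + a') + v'' x" if x: "x \<in> X" for x
      proof -
        have "(L ^^ (Suc k * N)) v x = (L ^^ N) ((L ^^ (k * N)) v) x" by (simp add: funpow_add)
        also have "\<dots> = (L ^^ N) (\<lambda>x. a + v' x) x" by (rule Lpow_cong[OF x v'(2)])
        finally show ?thesis using x v''(2) by (simp add: Lpow_add_const)
      qed
      then show ?case using v'' by (intro exI[of _ "a + a'"] exI[of _ v'']) (auto simp: mult.assoc)
    qed
    have osc: "\<bar>(L ^^ i) v x - (L ^^ j) v y\<bar> \<le> q ^ (j div N) * S" if "j \<le> i" "x \<in> X" "y \<in> X" for i j x y
    proof -
      define k where "k = j div N"
      obtain a v' where v': "cone D 1 v'" "\<And>x. x \<in> X \<Longrightarrow> (L ^^ (k * N)) v x = a + v' x"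
        "\<And>x. x \<in> X \<Longrightarrow> v' x \<le> q ^ k * S" using it by blast
      have *: "a \<le> (L ^^ i) v x \<and> (L ^^ i) v x \<le> a + q ^ k * S" if "j \<le> i" "x \<in> X" for i x
      proof -
        have "k * N \<le> i" using that by (metis div_times_less_eq_dividend dual_order.trans k_def)
        then have eq: "(L ^^ i) v = (L ^^ (i - k * N)) ((L ^^ (k * N)) v)"
          by (metis comp_apply funpow_add le_add_diff_inverse2)
        have "a \<le> (L ^^ (k * N)) v y \<and> (L ^^ (k * N)) v y \<le> a + q ^ k * S" if "y \<in> X" for y
          using v'(2,3)[OF that] cone_nonneg[OF v'(1) that] by simp
        then have "(L ^^ (i - k * N)) (\<lambda>_. a) x \<le> (L ^^ i) v x"
          "(L ^^ i) v x \<le> (L ^^ (i - k * N)) (\<lambda>_. a + q ^ k * S) x"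
          unfolding eq using \<open>x \<in> X\<close> by (auto intro!: Lpow_mono)
        then show ?thesis using Lpow_const[OF \<open>x \<in> X\<close>] by simp
      qed
      show ?thesis using *[OF that(1,2)] *[OF order_refl that(3)] by (auto simp: k_def)
    qed
    have qlim: "(\<lambda>j. q ^ (j div N) * S) \<longlonglongrightarrow> 0"
      using tendsto_mult[OF r tendsto_const[of "\<kappa> * S"]] \<kappa> by (simp add: r_def)
    have "Cauchy (\<lambda>j. (L ^^ j) v x0)"
    proof (rule CauchyI')
      fix e :: real assume "0 < e"
      then obtain M where M: "\<And>j. j \<ge> M \<Longrightarrow> \<bar>q ^ (j div N) * S\<bar> < e"
        using LIMSEQ_D[OF qlim] by auto
      show "\<exists>M. \<forall>m\<ge>M. \<forall>n>m. dist ((L ^^ m) v x0) ((L ^^ n) v x0) < e"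
      proof (intro exI[of _ M] allI impI)
        fix m n assume "M \<le> m" "m < n"
        then show "dist ((L ^^ m) v x0) ((L ^^ n) v x0) < e"
          using M[of m] osc[of m n x0 x0] x0 by (simp add: dist_real_def abs_minus_commute)
      qed
    qed
    then obtain E where E: "(\<lambda>j. (L ^^ j) v x0) \<longlonglongrightarrow> E"
      using Cauchy_convergent convergent_def by blast
    have SE: "\<kappa> * S \<le> E"
    proof (rule LIMSEQ_le_const[OF E], intro exI allI impI)
      fix n assume "N \<le> n"
      then have "(L ^^ n) v x0 = (L ^^ (n - N)) ((L ^^ N) v) x0"
        by (metis comp_apply funpow_add le_add_diff_inverse2)
      also have "\<dots> \<ge> (L ^^ (n - N)) (\<lambda>_. \<kappa> * S) x0" by (intro Lpow_mono x0 S_le)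
      finally show "\<kappa> * S \<le> (L ^^ n) v x0" using Lpow_const[OF x0] by simp
    qed
    have "\<bar>(L ^^ j) v x - E\<bar> \<le> r j * E" if x: "x \<in> X" for j x
    proof -
      have "(\<lambda>i. \<bar>(L ^^ i) v x0 - (L ^^ j) v x\<bar>) \<longlonglongrightarrow> \<bar>E - (L ^^ j) v x\<bar>"
        by (intro tendsto_intros E)
      then have "\<bar>E - (L ^^ j) v x\<bar> \<le> q ^ (j div N) * S"
        by (rule LIMSEQ_le_const2) (use osc x0 x in blast)
      also have "\<dots> = r j * (\<kappa> * S)" using \<kappa> by (simp add: r_def)
      also have "\<dots> \<le> r j * E" using SE q \<kappa> by (intro mult_left_mono) (auto simp: r_def)
      finally show ?thesis by (simp add: abs_minus_commute)
    qed
    moreover have "0 \<le> E" using SE S0 \<kappa> by (meson mult_nonneg_nonneg less_imp_le order_trans)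
    ultimately show ?thesis by blast
  qed
  then show ?thesis using that[of r] r q \<kappa> by (auto simp: r_def)
qed

end

section \<open>The Gibbs measure and its mixing\<close>

text \<open>The error of \<open>\<psi>\<close>-mixing is relative to the product of the measures, so that it
  remains useful for sets of very small measure.\<close>

locale mixing_measure = invariant_measure A \<mu>
  for A :: "nat ^ 's::finite ^ 's" and \<mu> :: "(nat \<Rightarrow> 's) measure" +
  assumes full_support: "determined A n U \<Longrightarrow> U \<noteq> {} \<Longrightarrow> 0 < measure \<mu> U"
    and psi_mixing: "\<exists>r. r \<longlonglongrightarrow> 0 \<and> (\<forall>g n U k V. determined A n U \<longrightarrow> determined A k V \<longrightarrow>
      \<bar>measure \<mu> (U \<inter> preim A (n + g) V) - measure \<mu> U * measure \<mu> V\<bar>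
        \<le> r g * (measure \<mu> U * measure \<mu> V))"

context normalized_operator
begin

definition mean :: "(nat \<Rightarrow> 's) set \<Rightarrow> real" where
  "mean U = lim (\<lambda>j. (L ^^ j) (indicator U) (SOME x. x \<in> X))"

lemma mean_convergence:
  obtains r :: "nat \<Rightarrow> real" where "r \<longlonglongrightarrow> 0" "\<And>j. 0 \<le> r j"
    "\<And>n U x j. determined A n U \<Longrightarrow> x \<in> X \<Longrightarrow>
      \<bar>(L ^^ (n + j)) (indicator U) x - mean U\<bar> \<le> r j * mean U"
    "\<And>n U x. determined A n U \<Longrightarrow> x \<in> X \<Longrightarrow> (\<lambda>j. (L ^^ j) (indicator U) x) \<longlonglongrightarrow> mean U"
proof -
  obtain r :: "nat \<Rightarrow> real" where r: "r \<longlonglongrightarrow> 0" "\<And>j. 0 \<le> r j"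
    and rE: "\<And>v. cone B 1 v \<Longrightarrow> \<exists>E\<ge>0. \<forall>j. \<forall>x\<in>X. \<bar>(L ^^ j) v x - E\<bar> \<le> r j * E"
    using exponential_convergence by metis
  have *: "(\<forall>j. \<forall>x\<in>X. \<bar>(L ^^ (n + j)) (indicator U) x - mean U\<bar> \<le> r j * mean U) \<and>
      (\<forall>x\<in>X. (\<lambda>j. (L ^^ j) (indicator U) x) \<longlonglongrightarrow> mean U)" if U: "determined A n U" for n U
  proof -
    obtain E where E: "\<And>j x. x \<in> X \<Longrightarrow> \<bar>(L ^^ j) ((L ^^ n) (indicator U)) x - E\<bar> \<le> r j * E"
      using rE[OF cone_indicator[OF U]] by blast
    have eq: "(L ^^ j) ((L ^^ n) (indicator U)) = (L ^^ (n + j)) (indicator U)" for j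
      by (simp add: funpow_add add.commute[of n j])
    have lim: "(\<lambda>j. (L ^^ j) (indicator U) x) \<longlonglongrightarrow> E" if x: "x \<in> X" for x
    proof (rule LIMSEQ_offset[where k = n])
      have "(\<lambda>j. (L ^^ (n + j)) (indicator U) x - E) \<longlonglongrightarrow> 0"
        by (rule Lim_null_comparison[OF _ tendsto_mult_left_zero[OF r(1), of E]])
          (use E[OF x] in \<open>simp add: eq\<close>)
      then show "(\<lambda>j. (L ^^ (j + n)) (indicator U) x) \<longlonglongrightarrow> E"
        by (simp add: LIM_zero_iff add.commute)
    qed
    have "(SOME x. x \<in> X) \<in> X" using nonempty by (simp add: some_in_eq)
    then have "mean U = E" unfolding mean_def by (intro limI lim)
    then show ?thesis using E lim by (simp add: eq)
  qed
  show ?thesis by (rule that[OF r]) (use * in blast)+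
qed

lemma mean_tendsto:
  "determined A n U \<Longrightarrow> x \<in> X \<Longrightarrow> (\<lambda>j. (L ^^ j) (indicator U) x) \<longlonglongrightarrow> mean U"
  using mean_convergence by metis

lemma mean_eqI:
  assumes "determined A n U" "\<And>x. x \<in> X \<Longrightarrow> (\<lambda>j. (L ^^ j) (indicator U) x) \<longlonglongrightarrow> E"
  shows "mean U = E"
proof -
  obtain x where "x \<in> X" using nonempty by blast
  then show ?thesis using LIMSEQ_unique[OF mean_tendsto[OF assms(1)] assms(2)] by blast
qed

lemma mean_nonneg: "determined A n U \<Longrightarrow> 0 \<le> mean U"
proof -
  assume U: "determined A n U"
  obtain x where x: "x \<in> X" using nonempty by blast
  show ?thesis
    by (rule LIMSEQ_le_const[OF mean_tendsto[OF U x]]) (auto intro!: Lpow_nonneg x)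
qed

lemma mean_space: "mean X = 1"
proof (rule mean_eqI[OF determined_space[of A 0]])
  fix x assume x: "x \<in> X"
  have "(L ^^ j) (indicator X) x = 1" for j
    using Lpow_cong[OF x, of "indicator X" "\<lambda>_. 1" j] Lpow_const[OF x] by simp
  then show "(\<lambda>j. (L ^^ j) (indicator X) x) \<longlonglongrightarrow> 1" by simp
qed

lemma mean_Un:
  assumes "determined A n U" "determined A n V" "U \<inter> V = {}"
  shows "mean (U \<union> V) = mean U + mean V"
proof (rule mean_eqI[OF determined_Un[OF assms(1,2)]])
  fix x assume x: "x \<in> X"
  have "indicator (U \<union> V) = (\<lambda>x. indicator U x + indicator V x :: real)"
    using assms(3) by (auto simp: indicator_def fun_eq_iff)
  then show "(\<lambda>j. (L ^^ j) (indicator (U \<union> V)) x) \<longlonglongrightarrow> mean U + mean V"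
    using tendsto_add[OF mean_tendsto[OF assms(1) x] mean_tendsto[OF assms(2) x]]
    by (simp add: Lpow_add)
qed

lemma clopens_common:
  assumes "U \<in> clopens A" "V \<in> clopens A"
  obtains n where "determined A n U" "determined A n V"
proof -
  obtain n m where "determined A n U" "determined A m V" using assms by (auto simp: clopens_def)
  then show ?thesis by (intro that[of "max n m"]) (auto elim: determined_mono)
qed

text \<open>A decreasing sequence of clopen sets with empty intersection is eventually empty by compactness,
  so finite additivity suffices for the extension.\<close>

theorem gibbs_measure_exists:
  "\<exists>\<mu>. clopen_prob A \<mu> \<and> (\<forall>n U. determined A n U \<longrightarrow> measure \<mu> U = mean U)"
proof -
  interpret C: algebra X "clopens A" by (rule algebra_clopens)
  let ?f = "\<lambda>U. ennreal (mean U)"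
  have pos: "positive (clopens A) ?f"
    using mean_Un[of 0 "{}" "{}"] by (simp add: positive_def)
  have add: "additive (clopens A) ?f"
    unfolding additive_def
  proof (intro ballI impI)
    fix U V assume UV: "U \<in> clopens A" "V \<in> clopens A" "U \<inter> V = {}"
    then obtain n where "determined A n U" "determined A n V" using clopens_common by metis
    then show "?f (U \<union> V) = ?f U + ?f V"
      using UV by (simp add: mean_Un mean_nonneg ennreal_plus)
  qed
  have "\<exists>\<mu> :: _ \<Rightarrow> ennreal. (\<forall>s\<in>clopens A. \<mu> s = ?f s) \<and> measure_space X (sigma_sets X (clopens A)) \<mu>"
  proof (rule C.caratheodory_empty_continuous[OF pos add])
    fix W :: "nat \<Rightarrow> (nat \<Rightarrow> 's) set"
    assume W: "range W \<subseteq> clopens A" "decseq W" "(\<Inter>i. W i) = {}"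
    then obtain i where i: "W i = {}" using clopens_compact[of W A] by blast
    have "?f (W j) = 0" if "i \<le> j" for j
    proof -
      have "W j = {}" using W(2) that i unfolding decseq_def by blast
      then show ?thesis using pos by (simp add: positive_def)
    qed
    then have "\<forall>\<^sub>F j in sequentially. ?f (W j) = 0" unfolding eventually_sequentially by blast
    then show "(\<lambda>j. ?f (W j)) \<longlonglongrightarrow> 0" by (rule tendsto_eventually)
  qed simp
  then obtain \<mu> where \<mu>: "\<And>s. s \<in> clopens A \<Longrightarrow> \<mu> s = ?f s"
    "measure_space X (sigma_sets X (clopens A)) \<mu>" by blast
  define M where "M = measure_of X (clopens A) \<mu>"
  have sub: "clopens A \<subseteq> Pow X" by (rule C.space_closed)
  have sets: "sets M = sigma_sets X (clopens A)" and space: "space M = X"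
    using sub by (auto simp: M_def)
  have em: "emeasure M U = ?f U" if "U \<in> clopens A" for U
    using emeasure_measure_of[OF M_def sub, of U] \<mu> that sets by (auto simp: measure_space_def)
  have "X \<in> clopens A" using clopensI[OF determined_space[of A 0]] .
  then have "prob_space M" using em[of X] by (intro prob_spaceI) (simp add: space mean_space)
  then have "clopen_prob A M"
    by (intro clopen_prob.intro aperiodic_subshift_axioms clopen_prob_axioms.intro sets)
  moreover have "measure M U = mean U" if "determined A n U" for n U
    using em[OF clopensI[OF that]] mean_nonneg[OF that] by (simp add: measure_def)
  ultimately show ?thesis by blast
qed

lemma Lpow_mult_shift:
  "(L ^^ n) (\<lambda>x. \<psi> x * \<eta> ((shift_map ^^ n) x)) = (\<lambda>x. \<eta> x * (L ^^ n) \<psi> x)"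
proof (induction n arbitrary: \<psi>)
  case (Suc n)
  have "L (\<lambda>x. \<psi> x * \<eta> ((shift_map ^^ Suc n) x)) = (\<lambda>x. L \<psi> x * \<eta> ((shift_map ^^ n) x))"
    unfolding L_def funpow_shift_map_scons by (simp add: sum_distrib_right mult.assoc)
  then show ?case using Suc[of "L \<psi>"] by (simp only: funpow_Suc_right o_apply)
qed (simp add: mult.commute)

end

locale gibbs_measure = normalized_operator A G \<beta> c + clopen_prob A \<mu>
  for A :: "nat ^ 's::finite ^ 's" and G :: "(nat \<Rightarrow> 's) \<Rightarrow> real" and \<beta> c :: real
    and \<mu> :: "(nat \<Rightarrow> 's) measure" +
  assumes measure_eq_mean: "determined A n U \<Longrightarrow> measure \<mu> U = mean U"
begin

lemma measure_tendsto:
  "determined A n U \<Longrightarrow> x \<in> X \<Longrightarrow> (\<lambda>j. (L ^^ j) (indicator U) x) \<longlonglongrightarrow> measure \<mu> U"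
  using mean_tendsto measure_eq_mean by metis

text \<open>The measure of \<open>U\<close> is the limit of \<open>L\<^sup>j 1\<^sub>U\<close> at any point,
  so a pointwise comparison after \<open>m\<close> steps passes to the measures.\<close>

lemma measure_le_if_Lpow_le:
  assumes U: "determined A n U" and V: "determined A k V"
    and le: "\<And>x. x \<in> X \<Longrightarrow> (L ^^ m) (indicator U) x \<le> a * indicator V x"
  shows "measure \<mu> U \<le> a * measure \<mu> V"
proof -
  obtain x where x: "x \<in> X" using nonempty by blast
  show ?thesis
  proof (rule LIMSEQ_le)
    show "(\<lambda>j. (L ^^ (j + m)) (indicator U) x) \<longlonglongrightarrow> measure \<mu> U"
      by (rule LIMSEQ_ignore_initial_segment[OF measure_tendsto[OF U x]])
    show "(\<lambda>j. a * (L ^^ j) (indicator V) x) \<longlonglongrightarrow> a * measure \<mu> V"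
      by (intro tendsto_intros measure_tendsto[OF V x])
    have "(L ^^ (j + m)) (indicator U) x \<le> a * (L ^^ j) (indicator V) x" for j
      using Lpow_mono[OF x le, where n = j] by (simp add: funpow_add Lpow_scale)
    then show "\<exists>N. \<forall>j\<ge>N. (L ^^ (j + m)) (indicator U) x \<le> a * (L ^^ j) (indicator V) x" by blast
  qed
qed

lemma measure_ge_if_Lpow_ge:
  assumes U: "determined A n U" and V: "determined A k V"
    and le: "\<And>x. x \<in> X \<Longrightarrow> a * indicator V x \<le> (L ^^ m) (indicator U) x"
  shows "a * measure \<mu> V \<le> measure \<mu> U"
proof -
  obtain x where x: "x \<in> X" using nonempty by blast
  show ?thesis
  proof (rule LIMSEQ_le)
    show "(\<lambda>j. (L ^^ (j + m)) (indicator U) x) \<longlonglongrightarrow> measure \<mu> U"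
      by (rule LIMSEQ_ignore_initial_segment[OF measure_tendsto[OF U x]])
    show "(\<lambda>j. a * (L ^^ j) (indicator V) x) \<longlonglongrightarrow> a * measure \<mu> V"
      by (intro tendsto_intros measure_tendsto[OF V x])
    have "a * (L ^^ j) (indicator V) x \<le> (L ^^ (j + m)) (indicator U) x" for j
      using Lpow_mono[OF x le, where n = j] by (simp add: funpow_add Lpow_scale)
    then show "\<exists>N. \<forall>j\<ge>N. a * (L ^^ j) (indicator V) x \<le> (L ^^ (j + m)) (indicator U) x" by blast
  qed
qed

lemma indicator_Int_preim:
  "x \<in> X \<Longrightarrow> indicator (U \<inter> preim A n V) x = indicator U x * (indicator V ((shift_map ^^ n) x) :: real)"
  by (simp add: indicator_def preim_def)

lemma Lpow_Int_preim:
  "x \<in> X \<Longrightarrow> (L ^^ n) (indicator (U \<inter> preim A n V)) x = indicator V x * (L ^^ n) (indicator U) x"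
  using Lpow_cong[of x "indicator (U \<inter> preim A n V)" "\<lambda>x. indicator U x * indicator V ((shift_map ^^ n) x)" n]
  by (simp add: indicator_Int_preim Lpow_mult_shift)

lemma gibbs_invariant: "invariant_measure A \<mu>"
proof (rule invariant_measure_if_clopens)
  fix n V assume V: "determined A n V"
  have eq: "(L ^^ 1) (indicator (preim A 1 V)) x = 1 * indicator V x" if x: "x \<in> X" for x
  proof -
    have "X \<inter> preim A 1 V = preim A 1 V" by (auto simp: preim_def)
    moreover have "(L ^^ 1) (indicator X) x = 1"
      using Lpow_cong[OF x, of "indicator X" "\<lambda>_. 1" 1] L_one[OF x] by simp
    ultimately show ?thesis using Lpow_Int_preim[OF x, of 1 X V] by simp
  qed
  show "measure \<mu> (preim A 1 V) = measure \<mu> V"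
    using measure_le_if_Lpow_le[OF determined_preim[OF V] V, of 1 1 1]
      measure_ge_if_Lpow_ge[OF determined_preim[OF V] V, of 1 1 1] eq by simp
qed

lemma gibbs_full_support:
  assumes U: "determined A n U" "U \<noteq> {}" shows "0 < measure \<mu> U"
proof -
  obtain y where y: "y \<in> U" using U by blast
  then have yX: "y \<in> X" using determined_subset[OF U(1)] by blast
  obtain g M where g: "0 < g" "\<And>x. x \<in> X \<Longrightarrow> g \<le> G x" using G_bounds by metis
  obtain b d where b: "0 < b" and bd: "\<And>D v x y n. 0 \<le> D \<Longrightarrow> cone D 1 v \<Longrightarrow> x \<in> X \<Longrightarrow> y \<in> X \<Longrightarrow>
    b * exp (- D) * v y \<le> (L ^^ d) v x" using cone_lower_bound by metis
  define a where "a = b * exp (- B) * g ^ n"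
  have a: "0 < a" using b g by (simp add: a_def)
  have "a * measure \<mu> X \<le> measure \<mu> U"
  proof (rule measure_ge_if_Lpow_ge[OF U(1) determined_space[of A 0]])
    fix x assume x: "x \<in> X"
    have "g ^ n * indicator U y \<le> (L ^^ n) (indicator U) ((shift_map ^^ n) y)"
      by (rule Lpow_ge[OF g yX]) auto
    then have "a \<le> b * exp (- B) * (L ^^ n) (indicator U) ((shift_map ^^ n) y)"
      using b y by (simp add: a_def mult_left_mono)
    also have "\<dots> \<le> (L ^^ d) ((L ^^ n) (indicator U)) x"
      using yX by (intro bd B_nonneg cone_indicator[OF U(1)] x) auto
    finally show "a * indicator X x \<le> (L ^^ (d + n)) (indicator U) x"
      using x by (simp add: funpow_add)
  qed
  moreover have "measure \<mu> X = 1" using prob_space by (simp add: space_eq)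
  ultimately show ?thesis using a by simp
qed

theorem gibbs_mixing: "mixing_measure A \<mu>"
proof -
  interpret invariant_measure A \<mu> by (rule gibbs_invariant)
  show ?thesis
  proof unfold_locales
    show "0 < measure \<mu> U" if "determined A n U" "U \<noteq> {}" for n U
      using gibbs_full_support that .
    obtain r :: "nat \<Rightarrow> real" where r: "r \<longlonglongrightarrow> 0" "\<And>j. 0 \<le> r j"
      and rE: "\<And>n U x j. determined A n U \<Longrightarrow> x \<in> X \<Longrightarrow>
        \<bar>(L ^^ (n + j)) (indicator U) x - mean U\<bar> \<le> r j * mean U"
      using mean_convergence by metis
    have "\<bar>measure \<mu> (U \<inter> preim A (n + g) V) - measure \<mu> U * measure \<mu> V\<bar>
        \<le> r g * (measure \<mu> U * measure \<mu> V)" if U: "determined A n U" and V: "determined A k V" for g n U k V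
    proof -
      have W: "determined A (n + g + k) (U \<inter> preim A (n + g) V)"
        by (intro determined_Int determined_preim V determined_mono[OF U]) simp
      have *: "\<bar>(L ^^ (n + g)) (indicator U) x - measure \<mu> U\<bar> \<le> r g * measure \<mu> U" if "x \<in> X" for x
        using rE[OF U that, of g] measure_eq_mean[OF U] by simp
      have 1: "measure \<mu> (U \<inter> preim A (n + g) V) \<le> ((1 + r g) * measure \<mu> U) * measure \<mu> V"
      proof (rule measure_le_if_Lpow_le[OF W V])
        fix x assume x: "x \<in> X"
        show "(L ^^ (n + g)) (indicator (U \<inter> preim A (n + g) V)) x \<le> (1 + r g) * measure \<mu> U * indicator V x"
          unfolding Lpow_Int_preim[OF x] using *[OF x] by (auto simp: indicator_def algebra_simps)
      qed
      have 2: "((1 - r g) * measure \<mu> U) * measure \<mu> V \<le> measure \<mu> (U \<inter> preim A (n + g) V)"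
      proof (rule measure_ge_if_Lpow_ge[OF W V])
        fix x assume x: "x \<in> X"
        show "(1 - r g) * measure \<mu> U * indicator V x \<le> (L ^^ (n + g)) (indicator (U \<inter> preim A (n + g) V)) x"
          unfolding Lpow_Int_preim[OF x] using *[OF x] by (auto simp: indicator_def algebra_simps)
      qed
      show ?thesis using 1 2 by (simp add: algebra_simps abs_le_iff)
    qed
    then show "\<exists>r. r \<longlonglongrightarrow> 0 \<and> (\<forall>g n U k V. determined A n U \<longrightarrow> determined A k V \<longrightarrow>
      \<bar>measure \<mu> (U \<inter> preim A (n + g) V) - measure \<mu> U * measure \<mu> V\<bar>
        \<le> r g * (measure \<mu> U * measure \<mu> V))" using r(1) by blast
  qed
qed

definition Gprod :: "nat \<Rightarrow> (nat \<Rightarrow> 's) \<Rightarrow> real" where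
  "Gprod n z = (\<Prod>k<n. G ((shift_map ^^ k) z))"

lemma Gprod_pos: "z \<in> X \<Longrightarrow> 0 < Gprod n z"
  unfolding Gprod_def by (intro prod_pos) (auto intro: G_pos)

lemma Gprod_Suc: "Gprod (Suc n) z = G z * Gprod n (shift_map z)"
  unfolding Gprod_def prod.lessThan_Suc_shift by (simp add: funpow_swap1)

text \<open>Only the branch along \<open>z\<close> contributes. At a point that shares \<open>l + n\<close>
  letters with this branch, one step changes the weight by at most \<open>exp (c
  \<beta>\<^sup>(\<^sup>l\<^sup>+\<^sup>n\<^sup>))\<close>, and \<open>c = B (1 - \<beta>)\<close> makes the
  exponents telescope.\<close>

lemma Lpow_cylinder_preim:
  assumes "z \<in> X" "V \<subseteq> cylinder A ((shift_map ^^ n) z) l" "1 \<le> l" "x \<in> X"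
  shows "(L ^^ n) (indicator (cylinder A z n \<inter> preim A n V)) x
      \<le> exp (B * (\<beta> ^ l - \<beta> ^ (l + n))) * Gprod n z * indicator V x \<and>
    exp (- B * (\<beta> ^ l - \<beta> ^ (l + n))) * Gprod n z * indicator V x
      \<le> (L ^^ n) (indicator (cylinder A z n \<inter> preim A n V)) x"
  using assms(1,2)
proof (induction n arbitrary: z)
  case 0
  have "V \<subseteq> X" using 0 by (auto simp: mem_cylinder)
  then have "cylinder A z 0 \<inter> preim A 0 V = V" by (auto simp: mem_cylinder preim_0)
  then show ?case by (simp add: Gprod_def)
next
  case (Suc n)
  let ?z = "shift_map z"
  let ?W = "cylinder A z (Suc n) \<inter> preim A (Suc n) V"
  let ?W' = "cylinder A ?z n \<inter> preim A n V"
  have z: "?z \<in> X" using Suc.prems by auto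
  have V: "V \<subseteq> cylinder A ((shift_map ^^ n) ?z) l" using Suc.prems by (simp add: funpow_swap1)
  define e where "e = c * \<beta> ^ (l + n)"
  have e: "e = B * (\<beta> ^ (l + n) - \<beta> ^ (l + Suc n))"
  proof -
    have "e = (B * (1 - \<beta>)) * \<beta> ^ (l + n)" unfolding e_def using B_step(2) by simp
    then show ?thesis by (simp add: algebra_simps)
  qed
  have LW: "exp (- e) * G z * indicator ?W' y \<le> L (indicator ?W) y \<and>
      L (indicator ?W) y \<le> exp e * G z * indicator ?W' y" if y: "y \<in> X" for y
  proof (cases "y \<in> ?W'")
    case False
    have "indicator ?W (scons i y) = (0::real)" for i
    proof -
      have "scons i y \<notin> ?W"
      proof
        assume *: "scons i y \<in> ?W"
        then have "(shift_map ^^ n) y \<in> V" by (simp add: preim_def funpow_swap1)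
        moreover have "agree n y ?z"
          using agree_shift[of 1 n "scons i y" z] * by (simp add: mem_cylinder)
        ultimately show False using False y by (simp add: mem_cylinder preim_def)
      qed
      then show ?thesis by simp
    qed
    then have "L (indicator ?W) y = 0" by (simp add: L_def)
    then show ?thesis using False by simp
  next
    case True
    then have "(shift_map ^^ n) y \<in> V" "agree n y ?z" by (auto simp: mem_cylinder preim_def)
    then have "agree l ((shift_map ^^ n) y) ((shift_map ^^ n) ?z)" using V by (auto simp: mem_cylinder)
    have ag: "agree (l + n) y ?z"
      unfolding agree_def
    proof (intro allI impI)
      fix i assume "i < l + n"
      show "y i = ?z i"
      proof (cases "i < n")
        case True
        then show ?thesis using \<open>agree n y ?z\<close> by (simp add: agree_def)
      next
        case False
        then have "(shift_map ^^ n) y (i - n) = (shift_map ^^ n) ?z (i - n)"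
          using \<open>agree l ((shift_map ^^ n) y) ((shift_map ^^ n) ?z)\<close> \<open>i < l + n\<close>
          by (auto simp: agree_def)
        then show ?thesis using False by (simp add: shift_map_funpow_apply)
      qed
    qed
    have y0: "y 0 = z 1" using ag assms(3) by (simp add: agree_def shift_map_apply)
    have Az: "A $ z 0 $ y 0 = 1" using Suc.prems by (simp add: y0 subshift_def)
    let ?y = "scons (z 0) y"
    have yX: "?y \<in> X" using y Az by (intro scons_subshift) auto
    have agy: "agree (Suc (l + n)) ?y z"
      using agree_scons[OF ag, of "z 0"] by simp
    have ind: "indicator ?W (scons i y) = (if i = z 0 then 1 else 0 :: real)" for i
    proof (cases "i = z 0")
      case True
      have "?y \<in> ?W" using yX \<open>(shift_map ^^ n) y \<in> V\<close> agree_mono[OF agy, of "Suc n"]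
        by (simp add: mem_cylinder preim_def funpow_swap1)
      then show ?thesis using True by simp
    next
      case False
      then have "scons i y \<notin> ?W" by (auto simp: mem_cylinder agree_def)
      then show ?thesis using False by simp
    qed
    have "L (indicator ?W) y = (\<Sum>i | A $ i $ y 0 = 1. if i = z 0 then G ?y else 0)"
      unfolding L_def ind by (intro sum.cong) auto
    also have "\<dots> = G ?y" using Az by simp
    finally have Ly: "L (indicator ?W) y = G ?y" .
    have ce: "c * \<beta> ^ Suc (l + n) \<le> e"
      unfolding e_def using beta c_nonneg by (intro mult_left_mono power_decreasing) auto
    have "G ?y \<le> exp (c * \<beta> ^ Suc (l + n)) * G z"
      using Suc.prems by (intro G_var yX agy)
    also have "\<dots> \<le> exp e * G z"
      using ce G_pos[OF Suc.prems(1)] by (intro mult_right_mono) auto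
    finally have 1: "G ?y \<le> exp e * G z" .
    have "G z \<le> exp (c * \<beta> ^ Suc (l + n)) * G ?y"
      using Suc.prems by (intro G_var yX agree_sym[OF agy])
    also have "\<dots> \<le> exp e * G ?y"
      using ce G_pos[OF yX] by (intro mult_right_mono) auto
    finally have 2: "exp (- e) * G z \<le> G ?y" by (simp add: exp_minus field_simps)
    show ?thesis using 1 2 True by (simp add: Ly)
  qed
  define q where "q = B * (\<beta> ^ l - \<beta> ^ (l + n))"
  have qe: "q + e = B * (\<beta> ^ l - \<beta> ^ (l + Suc n))" unfolding q_def e by (simp add: algebra_simps)
  note IH = Suc.IH[OF z V, folded q_def]
  have "(L ^^ Suc n) (indicator ?W) x = (L ^^ n) (L (indicator ?W)) x" by (simp add: funpow_swap1)
  also have "\<dots> \<le> (L ^^ n) (\<lambda>y. (exp e * G z) * indicator ?W' y) x"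
    using LW by (intro Lpow_mono assms(4)) blast
  also have "\<dots> = (exp e * G z) * (L ^^ n) (indicator ?W') x" by (simp only: Lpow_scale)
  also have "\<dots> \<le> (exp e * G z) * (exp q * Gprod n ?z * indicator V x)"
    using IH G_pos[OF Suc.prems(1)] by (intro mult_left_mono) auto
  also have "\<dots> = exp (q + e) * Gprod (Suc n) z * indicator V x"
    by (simp add: Gprod_Suc exp_add)
  finally have 1: "(L ^^ Suc n) (indicator ?W) x \<le> exp (q + e) * Gprod (Suc n) z * indicator V x" .
  have "exp (- (q + e)) * Gprod (Suc n) z * indicator V x
      = (exp (- e) * G z) * (exp (- q) * Gprod n ?z * indicator V x)"
  proof -
    have "exp (- (q + e)) = exp (- e) * exp (- q)" by (simp flip: exp_add)
    then show ?thesis by (simp add: Gprod_Suc)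
  qed
  also have "\<dots> \<le> (exp (- e) * G z) * (L ^^ n) (indicator ?W') x"
    using IH G_pos[OF Suc.prems(1)] by (intro mult_left_mono) (auto simp: q_def)
  also have "\<dots> = (L ^^ n) (\<lambda>y. (exp (- e) * G z) * indicator ?W' y) x" by (simp only: Lpow_scale)
  also have "\<dots> \<le> (L ^^ n) (L (indicator ?W)) x"
    using LW by (intro Lpow_mono assms(4)) blast
  also have "\<dots> = (L ^^ Suc n) (indicator ?W) x" by (simp add: funpow_swap1)
  finally show ?case using 1 unfolding qe by simp
qed

text \<open>For large \<open>l\<close> this says that the measure of the branch of
  \<open>\<sigma>\<^sup>-\<^sup>n V\<close> along \<open>z\<close> is asymptotically \<open>Gprod n z\<close>
  times that of \<open>V\<close>.\<close>

theorem jacobian_bounds: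
  assumes z: "z \<in> X" and V: "determined A k V" "V \<subseteq> cylinder A ((shift_map ^^ n) z) l" and l: "1 \<le> l"
  shows "measure \<mu> (cylinder A z n \<inter> preim A n V) \<le> exp (B * \<beta> ^ l) * Gprod n z * measure \<mu> V"
    and "exp (- B * \<beta> ^ l) * Gprod n z * measure \<mu> V \<le> measure \<mu> (cylinder A z n \<inter> preim A n V)"
proof -
  let ?e = "B * (\<beta> ^ l - \<beta> ^ (l + n))"
  have e: "?e \<le> B * \<beta> ^ l" using B_nonneg beta by (intro mult_left_mono) auto
  have W: "determined A (n + k) (cylinder A z n \<inter> preim A n V)"
    by (intro determined_Int determined_preim V determined_mono[OF determined_cylinder]) simp
  have "measure \<mu> (cylinder A z n \<inter> preim A n V) \<le> (exp ?e * Gprod n z) * measure \<mu> V"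
    by (rule measure_le_if_Lpow_le[OF W V(1)]) (use Lpow_cylinder_preim[OF z V(2) l] in blast)
  also have "\<dots> \<le> exp (B * \<beta> ^ l) * Gprod n z * measure \<mu> V"
    using e Gprod_pos[OF z, of n] by (intro mult_right_mono) auto
  finally show "measure \<mu> (cylinder A z n \<inter> preim A n V) \<le> exp (B * \<beta> ^ l) * Gprod n z * measure \<mu> V" .
  have "exp (- B * \<beta> ^ l) * Gprod n z * measure \<mu> V \<le> (exp (- B * (\<beta> ^ l - \<beta> ^ (l + n))) * Gprod n z) * measure \<mu> V"
    using e Gprod_pos[OF z, of n] by (intro mult_right_mono) auto
  also have "\<dots> \<le> measure \<mu> (cylinder A z n \<inter> preim A n V)"
    by (rule measure_ge_if_Lpow_ge[OF W V(1)]) (use Lpow_cylinder_preim[OF z V(2) l] in blast)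
  finally show "exp (- B * \<beta> ^ l) * Gprod n z * measure \<mu> V \<le> measure \<mu> (cylinder A z n \<inter> preim A n V)" .
qed

theorem gibbs_property:
  obtains C where "0 < C" "\<And>n z. z \<in> X \<Longrightarrow> measure \<mu> (cylinder A z (Suc n)) \<le> exp C * Gprod n z"
    "\<And>n z. z \<in> X \<Longrightarrow> exp (- C) * Gprod n z \<le> measure \<mu> (cylinder A z (Suc n))"
proof -
  have cyl: "cylinder A z (Suc n) = cylinder A z n \<inter> preim A n (cylinder A ((shift_map ^^ n) z) 1)" for n z
    by (auto simp: mem_cylinder preim_def agree_Suc shift_map_funpow_apply)
  define S where "S = (\<lambda>z. measure \<mu> (cylinder A z 1)) ` X"
  have "depends_on A 1 (\<lambda>z. measure \<mu> (cylinder A z 1))"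
    unfolding depends_on_def
  proof (intro ballI impI)
    fix x y :: "nat \<Rightarrow> 's" assume "agree 1 x y"
    then have "cylinder A x 1 = cylinder A y 1" by (auto simp: mem_cylinder agree_def)
    then show "measure \<mu> (cylinder A x 1) = measure \<mu> (cylinder A y 1)" by simp
  qed
  then have fin: "finite S" unfolding S_def by (rule depends_on_finite_range)
  have ne: "S \<noteq> {}" using nonempty by (simp add: S_def)
  define s where "s = Min S"
  have "s \<in> S" unfolding s_def by (rule Min_in[OF fin ne])
  moreover have "0 < measure \<mu> (cylinder A z 1)" if "z \<in> X" for z
    using gibbs_full_support[OF determined_cylinder] mem_cylinder_self[OF that] by blast
  ultimately have s: "0 < s" by (auto simp: S_def)
  have s_le: "s \<le> measure \<mu> (cylinder A z 1)" if "z \<in> X" for z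
    unfolding s_def using that fin by (intro Min_le) (auto simp: S_def)
  have Bb: "B * \<beta> \<le> B" using B_nonneg beta by (simp add: mult_left_le)
  define C where "C = max 1 (B - ln s)"
  have C: "B \<le> C" "exp (- C) \<le> exp (- B) * s" "0 < C"
  proof -
    have "s \<le> 1" using s_le prob_le_1 nonempty by (meson ex_in_conv order_trans)
    then have "ln s \<le> 0" using s by simp
    then show "B \<le> C" by (simp add: C_def max_def)
    have "exp (- C) \<le> exp (- B + ln s)" unfolding exp_le_cancel_iff by (simp add: C_def)
    then show "exp (- C) \<le> exp (- B) * s" unfolding exp_add exp_ln[OF s] .
  qed (simp add: C_def)
  show ?thesis
  proof (rule that[OF C(3)])
    fix n z assume z: "z \<in> X"
    let ?V = "cylinder A ((shift_map ^^ n) z) 1"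
    have zn: "(shift_map ^^ n) z \<in> X" using z by auto
    note J = jacobian_bounds[OF z determined_cylinder[of A 1 "(shift_map ^^ n) z"] order_refl order_refl, folded cyl]
    have "measure \<mu> (cylinder A z (Suc n)) \<le> exp (B * \<beta>) * Gprod n z * 1"
      using Gprod_pos[OF z, of n] by (intro order_trans[OF J(1)[unfolded power_one_right]] mult_left_mono prob_le_1) auto
    also have "\<dots> \<le> exp C * Gprod n z * 1"
      using Bb C Gprod_pos[OF z, of n] by (intro mult_right_mono) auto
    finally show "measure \<mu> (cylinder A z (Suc n)) \<le> exp C * Gprod n z" by simp
    have "exp (- C) * Gprod n z \<le> exp (- B) * s * Gprod n z"
      using C(2) Gprod_pos[OF z, of n] by (intro mult_right_mono) auto
    also have "\<dots> \<le> exp (- B * \<beta>) * measure \<mu> ?V * Gprod n z"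
      using Bb s s_le[OF zn] Gprod_pos[OF z, of n] by (intro mult_right_mono mult_mono) auto
    also have "\<dots> \<le> measure \<mu> (cylinder A z (Suc n))" using J(2) by (simp add: mult_ac)
    finally show "exp (- C) * Gprod n z \<le> measure \<mu> (cylinder A z (Suc n))" .
  qed
qed

end

section \<open>Large deviations from mixing\<close>

lemma depends_onD:
  "depends_on A n \<psi> \<Longrightarrow> x \<in> subshift A \<Longrightarrow> y \<in> subshift A \<Longrightarrow> agree n x y \<Longrightarrow> \<psi> x = \<psi> y"
  unfolding depends_on_def by blast

lemma depends_on_compose: "depends_on A n \<psi> \<Longrightarrow> depends_on A n (\<lambda>x. F (\<psi> x))"
  unfolding depends_on_def by metis

lemma birkhoff_sum_Suc: "birkhoff_sum g (Suc n) x = birkhoff_sum g n x + g ((shift_map ^^ n) x)"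
  by (simp add: birkhoff_sum_def)

lemma birkhoff_sum_add:
  "birkhoff_sum g (n + m) x = birkhoff_sum g n x + birkhoff_sum g m ((shift_map ^^ n) x)"
proof (induction m)
  case (Suc m)
  have "(shift_map ^^ (n + m)) x = (shift_map ^^ m) ((shift_map ^^ n) x)"
    by (metis add.commute comp_apply funpow_add)
  then show ?case using Suc by (simp add: birkhoff_sum_Suc)
qed (simp add: birkhoff_sum_def)

lemma exp_le_quadratic:
  fixes t :: real assumes "\<bar>t\<bar> \<le> 1" shows "exp t \<le> 1 + t + t\<^sup>2"
proof (cases "0 \<le> t")
  case True
  then show ?thesis using exp_bound[of t] assms by simp
next
  case False
  define s where "s = - t"
  have s: "0 < s" using False by (simp add: s_def)
  have "1 \<le> 1 + s ^ 3" using s by simp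
  also have "\<dots> = (1 + s) * (1 - s + s\<^sup>2)" by (simp add: algebra_simps power2_eq_square power3_eq_cube)
  also have "\<dots> \<le> exp s * (1 - s + s\<^sup>2)"
  proof (intro mult_right_mono exp_ge_add_one_self)
    have "0 \<le> (1 - s / 2)\<^sup>2 + 3 / 4 * s\<^sup>2" by simp
    also have "\<dots> = 1 - s + s\<^sup>2" by (simp add: power2_eq_square algebra_simps)
    finally show "0 \<le> 1 - s + s\<^sup>2" .
  qed
  finally have "exp (- s) \<le> 1 - s + s\<^sup>2" by (simp add: exp_minus field_simps)
  then show ?thesis by (simp add: s_def)
qed

context clopen_prob
begin

lemma depends_on_level: "depends_on A n \<psi> \<Longrightarrow> determined A n {x \<in> X. \<psi> x = a}"
  using depends_on_vimage[of A n \<psi> "{a}"] by simp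

lemma depends_on_simple: "depends_on A n \<psi> \<Longrightarrow> simple_function \<mu> \<psi>"
  unfolding simple_function_def
proof (intro conjI ballI)
  assume \<psi>: "depends_on A n \<psi>"
  show "finite (\<psi> ` space \<mu>)" using depends_on_finite_range[OF \<psi>] by (simp add: space_eq)
  fix a
  have "\<psi> -` {a} \<inter> space \<mu> = {x \<in> X. \<psi> x = a}" by (auto simp: space_eq)
  then show "\<psi> -` {a} \<inter> space \<mu> \<in> sets \<mu>" using determined_sets[OF depends_on_level[OF \<psi>]] by simp
qed

lemma simple_integral:
  fixes F :: "'b \<Rightarrow> real"
  assumes Y: "simple_function \<mu> Y"
  shows simple_integrable: "integrable \<mu> (\<lambda>x. F (Y x))"
    and integral_simple: "(\<integral>x. F (Y x) \<partial>\<mu>) = (\<Sum>v\<in>Y ` X. F v * measure \<mu> {x \<in> X. Y x = v})"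
proof -
  let ?f = "\<lambda>x. \<Sum>v\<in>Y ` X. F v * indicator {x \<in> X. Y x = v} x"
  have fin: "finite (Y ` X)" using simple_functionD(1)[OF Y] by (simp add: space_eq)
  have sets: "{x \<in> X. Y x = v} \<in> sets \<mu>" for v
  proof -
    have "{x \<in> X. Y x = v} = Y -` {v} \<inter> space \<mu>" by (auto simp: space_eq)
    then show ?thesis using simple_functionD(2)[OF Y] by simp
  qed
  have eq: "?f x = F (Y x)" if "x \<in> space \<mu>" for x
  proof -
    have "?f x = (\<Sum>v\<in>Y ` X. if v = Y x then F v else 0)"
      using that by (intro sum.cong) (auto simp: indicator_def space_eq)
    also have "\<dots> = F (Y x)" using that fin by (simp add: space_eq)
    finally show ?thesis .
  qed
  have int: "integrable \<mu> (indicator {x \<in> X. Y x = v} :: _ \<Rightarrow> real)" for v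
    using sets by (intro integrable_real_indicator) (auto simp: emeasure_eq_measure)
  have "integrable \<mu> ?f" by (intro Bochner_Integration.integrable_sum integrable_mult_right int)
  then show "integrable \<mu> (\<lambda>x. F (Y x))"
    using Bochner_Integration.integrable_cong[of \<mu> \<mu> ?f "\<lambda>x. F (Y x)"] eq by blast
  have "(\<integral>x. F (Y x) \<partial>\<mu>) = integral\<^sup>L \<mu> ?f"
    by (rule Bochner_Integration.integral_cong[OF refl], rule eq[symmetric])
  also have "\<dots> = (\<Sum>v\<in>Y ` X. integral\<^sup>L \<mu> (\<lambda>x. F v * indicator {x \<in> X. Y x = v} x))"
    by (rule Bochner_Integration.integral_sum) (intro integrable_mult_right int)
  also have "\<dots> = (\<Sum>v\<in>Y ` X. F v * measure \<mu> {x \<in> X. Y x = v})"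
    using sets by simp
  finally show "(\<integral>x. F (Y x) \<partial>\<mu>) = (\<Sum>v\<in>Y ` X. F v * measure \<mu> {x \<in> X. Y x = v})" .
qed

lemmas depends_on_integrable = simple_integrable[where F = "\<lambda>a. a", OF depends_on_simple]
lemmas integral_depends_on = integral_simple[where F = "\<lambda>a. a", OF depends_on_simple]

end

context mixing_measure
begin

text \<open>Decomposing both functions into level sets reduces the claim to the hypothesis on sets.\<close>

lemma integral_mixing:
  fixes \<Phi> Z :: "(nat \<Rightarrow> 's) \<Rightarrow> real"
  assumes \<Phi>: "depends_on A n \<Phi>" "\<And>x. x \<in> X \<Longrightarrow> 0 \<le> \<Phi> x"
    and Z: "depends_on A k Z" "\<And>x. x \<in> X \<Longrightarrow> 0 \<le> Z x"
    and mix: "\<And>U V. determined A n U \<Longrightarrow> determined A k V \<Longrightarrow>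
      measure \<mu> (U \<inter> preim A m V) \<le> R * (measure \<mu> U * measure \<mu> V)"
  shows "(\<integral>x. \<Phi> x * Z ((shift_map ^^ m) x) \<partial>\<mu>) \<le> R * ((\<integral>x. \<Phi> x \<partial>\<mu>) * (\<integral>x. Z x \<partial>\<mu>))"
proof -
  let ?U = "\<lambda>a. {x \<in> X. \<Phi> x = a}" and ?V = "\<lambda>b. {x \<in> X. Z x = b}"
  let ?W = "\<lambda>a b. ?U a \<inter> preim A m (?V b)"
  let ?f = "\<lambda>x. \<Sum>a\<in>\<Phi> ` X. \<Sum>b\<in>Z ` X. a * b * indicator (?W a b) x"
  have fin: "finite (\<Phi> ` X)" "finite (Z ` X)" using depends_on_finite_range \<Phi>(1) Z(1) by blast+
  have dU: "determined A n (?U a)" and dV: "determined A k (?V b)" for a b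
    by (rule depends_on_level[OF \<Phi>(1)], rule depends_on_level[OF Z(1)])
  have W: "?W a b \<in> sets \<mu>" for a b
    using determined_sets[OF dU] determined_sets[OF dV] by auto
  have eq: "\<Phi> x * Z ((shift_map ^^ m) x) = ?f x" if "x \<in> space \<mu>" for x
  proof -
    have x: "x \<in> X" "(shift_map ^^ m) x \<in> X" using that by (auto simp: space_eq)
    have "?f x = (\<Sum>a\<in>\<Phi> ` X. \<Sum>b\<in>Z ` X. if a = \<Phi> x then (if b = Z ((shift_map ^^ m) x) then a * b else 0) else 0)"
      using x by (intro sum.cong) (auto simp: indicator_def preim_def)
    also have "\<dots> = (\<Sum>a\<in>\<Phi> ` X. if a = \<Phi> x then (\<Sum>b\<in>Z ` X. if b = Z ((shift_map ^^ m) x) then a * b else 0) else 0)"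
      by (intro sum.cong) auto
    also have "\<dots> = \<Phi> x * Z ((shift_map ^^ m) x)" using x fin by simp
    finally show ?thesis by simp
  qed
  have int: "integrable \<mu> (indicator (?W a b) :: _ \<Rightarrow> real)" for a b
    using W by (intro integrable_real_indicator) (auto simp: emeasure_eq_measure)
  have "(\<integral>x. \<Phi> x * Z ((shift_map ^^ m) x) \<partial>\<mu>) = (\<integral>x. ?f x \<partial>\<mu>)"
    by (rule Bochner_Integration.integral_cong[OF refl], rule eq)
  also have "\<dots> = (\<Sum>a\<in>\<Phi> ` X. \<Sum>b\<in>Z ` X. (\<integral>x. a * b * indicator (?W a b) x \<partial>\<mu>))"
    by (intro trans[OF Bochner_Integration.integral_sum] sum.cong refl Bochner_Integration.integral_sum
        Bochner_Integration.integrable_sum integrable_mult_right int)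
  also have "\<dots> = (\<Sum>a\<in>\<Phi> ` X. \<Sum>b\<in>Z ` X. a * b * measure \<mu> (?W a b))"
    using W by simp
  also have "\<dots> \<le> (\<Sum>a\<in>\<Phi> ` X. \<Sum>b\<in>Z ` X. a * b * (R * (measure \<mu> (?U a) * measure \<mu> (?V b))))"
    using \<Phi>(2) Z(2) by (intro sum_mono mult_left_mono mix dU dV) auto
  also have "\<dots> = R * ((\<Sum>a\<in>\<Phi> ` X. a * measure \<mu> (?U a)) * (\<Sum>b\<in>Z ` X. b * measure \<mu> (?V b)))"
    by (simp add: sum_product sum_distrib_left mult_ac)
  also have "\<dots> = R * ((\<integral>x. \<Phi> x \<partial>\<mu>) * (\<integral>x. Z x \<partial>\<mu>))"
    by (simp add: integral_depends_on[OF \<Phi>(1)] integral_depends_on[OF Z(1)])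
  finally show ?thesis .
qed

lemma mixing_upper:
  assumes "0 < e"
  obtains g where "\<And>n U k V. determined A n U \<Longrightarrow> determined A k V \<Longrightarrow>
      \<bar>measure \<mu> (U \<inter> preim A (n + g) V) - measure \<mu> U * measure \<mu> V\<bar> \<le> e * (measure \<mu> U * measure \<mu> V)"
proof -
  obtain r where r: "r \<longlonglongrightarrow> 0" "\<And>g n U k V. determined A n U \<Longrightarrow> determined A k V \<Longrightarrow>
      \<bar>measure \<mu> (U \<inter> preim A (n + g) V) - measure \<mu> U * measure \<mu> V\<bar>
        \<le> r g * (measure \<mu> U * measure \<mu> V)"
    using psi_mixing by blast
  obtain g where "r g < e" using order_tendstoD(2)[OF r(1) assms] by (auto simp: eventually_sequentially)
  show ?thesis
  proof (rule that[of g])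
    fix n U k V assume "determined A n U" "determined A k V"
    then have "\<bar>measure \<mu> (U \<inter> preim A (n + g) V) - measure \<mu> U * measure \<mu> V\<bar>
      \<le> r g * (measure \<mu> U * measure \<mu> V)" by (rule r(2))
    also have "\<dots> \<le> e * (measure \<mu> U * measure \<mu> V)"
      using \<open>r g < e\<close> by (intro mult_right_mono) auto
    finally show "\<bar>measure \<mu> (U \<inter> preim A (n + g) V) - measure \<mu> U * measure \<mu> V\<bar>
      \<le> e * (measure \<mu> U * measure \<mu> V)" .
  qed
qed

lemma markov_inequality_set:
  assumes "integrable \<mu> f" "\<And>x. x \<in> X \<Longrightarrow> 0 \<le> f x" "0 < (a::real)"
  shows "measure \<mu> {x \<in> X. a \<le> f x} \<le> (\<integral>x. f x \<partial>\<mu>) / a"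
proof -
  have "AE x in \<mu>. 0 \<le> f x" using assms(2) by (intro AE_I2) (simp add: space_eq)
  then show ?thesis
    using integral_Markov_inequality_measure[of \<mu> f "{}" a] assms by (simp add: space_eq)
qed

lemma depends_on_prod:
  fixes F :: "nat \<Rightarrow> (nat \<Rightarrow> 's) \<Rightarrow> real"
  assumes "\<And>j. j < m \<Longrightarrow> depends_on A n (F j)"
  shows "depends_on A n (\<lambda>x. \<Prod>j<m. F j x)"
  unfolding depends_on_def
  by (intro ballI impI prod.cong refl, rule depends_onD[OF assms]) simp_all

lemma integral_prod_gap:
  fixes Z :: "(nat \<Rightarrow> 's) \<Rightarrow> real"
  assumes Z: "depends_on A k Z" "\<And>x. x \<in> X \<Longrightarrow> 0 \<le> Z x"
    and e: "0 \<le> e"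
    and mix: "\<And>n U k V. determined A n U \<Longrightarrow> determined A k V \<Longrightarrow>
      \<bar>measure \<mu> (U \<inter> preim A (n + g) V) - measure \<mu> U * measure \<mu> V\<bar> \<le> e * (measure \<mu> U * measure \<mu> V)"
  shows "(\<integral>x. (\<Prod>j<m. Z ((shift_map ^^ (j * (k + g))) x)) \<partial>\<mu>) \<le> ((1 + e) * (\<integral>x. Z x \<partial>\<mu>)) ^ m"
proof (induction m)
  case (Suc m)
  let ?q = "k + g"
  define P where "P x = (\<Prod>j<m. Z ((shift_map ^^ (j * ?q)) x))" for x
  have P: "depends_on A (m * ?q + k) P" "\<And>x. x \<in> X \<Longrightarrow> 0 \<le> P x"
  proof -
    show "depends_on A (m * ?q + k) P" unfolding P_def
    proof (rule depends_on_prod)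
      fix j assume "j < m"
      then have "j * ?q + k \<le> m * ?q + k" by simp
      then show "depends_on A (m * ?q + k) (\<lambda>x. Z ((shift_map ^^ (j * ?q)) x))"
        by (rule depends_on_mono[OF depends_on_shift[OF Z(1)]])
    qed
    show "0 \<le> P x" if "x \<in> X" for x unfolding P_def
      using that by (intro prod_nonneg ballI Z(2)) auto
  qed
  have "(\<Prod>j<Suc m. Z ((shift_map ^^ (j * ?q)) x)) = Z x * P ((shift_map ^^ ?q) x)" for x
    unfolding prod.lessThan_Suc_shift P_def by (simp add: funpow_add add.commute[of ?q])
  then have "(\<integral>x. (\<Prod>j<Suc m. Z ((shift_map ^^ (j * ?q)) x)) \<partial>\<mu>)
      = (\<integral>x. Z x * P ((shift_map ^^ ?q) x) \<partial>\<mu>)" by simp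
  also have "\<dots> \<le> (1 + e) * ((\<integral>x. Z x \<partial>\<mu>) * (\<integral>x. P x \<partial>\<mu>))"
  proof (rule integral_mixing[OF Z P])
    fix U V assume "determined A k U" "determined A (m * ?q + k) V"
    from mix[OF this] show "measure \<mu> (U \<inter> preim A ?q V) \<le> (1 + e) * (measure \<mu> U * measure \<mu> V)"
      by (simp add: algebra_simps abs_le_iff)
  qed
  also have "\<dots> \<le> (1 + e) * ((\<integral>x. Z x \<partial>\<mu>) * ((1 + e) * (\<integral>x. Z x \<partial>\<mu>)) ^ m)"
    using Suc e Z(2) by (intro mult_left_mono) (auto simp: P_def space_eq intro!: integral_nonneg_AE)
  finally show ?case by (simp add: mult_ac)
qed (simp add: prob_space)

text \<open>Exponential Chebyshev inequality. The Birkhoff sum splits into \<open>q\<close> sums along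
  arithmetic progressions of step \<open>q\<close>, and one of them is at least the average. Along such a
  progression the terms are separated by gaps, so the exponential moment is bounded by a product; each factor
  is less than \<open>1\<close>, since the first order term of the moment generating function is \<open>- u
  \<epsilon>\<close>.\<close>

theorem large_deviation:
  fixes \<psi> :: "(nat \<Rightarrow> 's) \<Rightarrow> real"
  assumes \<psi>: "depends_on A k \<psi>" and \<epsilon>: "0 < \<epsilon>"
  obtains C \<delta> where "0 < C" "0 < \<delta>"
    "\<And>M. measure \<mu> {x \<in> X. real M * ((\<integral>x. \<psi> x \<partial>\<mu>) + \<epsilon>) \<le> birkhoff_sum \<psi> M x} \<le> C * exp (- \<delta> * real M)"
proof -
  define Y where "Y x = \<psi> x - (\<integral>x. \<psi> x \<partial>\<mu>) - \<epsilon>" for x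
  have Y: "depends_on A k Y"
    unfolding Y_def by (rule depends_on_compose[OF \<psi>])
  obtain K0 where K0: "\<And>x. x \<in> X \<Longrightarrow> \<bar>Y x\<bar> \<le> K0"
    using finite_imp_bounded[OF depends_on_finite_range[OF Y]] unfolding bounded_iff by auto
  define K where "K = max K0 \<epsilon>"
  have K: "\<epsilon> \<le> K" "\<And>x. x \<in> X \<Longrightarrow> \<bar>Y x\<bar> \<le> K" "0 < K" using K0 \<epsilon> by (auto simp: K_def le_max_iff_disj)
  have EY: "(\<integral>x. Y x \<partial>\<mu>) = - \<epsilon>"
    unfolding Y_def using depends_on_integrable[OF \<psi>] by (simp add: prob_space)
  \<comment> \<open>This \<open>u\<close> minimizes \<open>- u \<epsilon> + u\<^sup>2 K\<^sup>2\<close>, the second order bound of the exponential moment.\<close>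
  define u where "u = \<epsilon> / (2 * K\<^sup>2)"
  have u: "0 < u" using \<epsilon> K by (simp add: u_def)
  have uK2: "u\<^sup>2 * K\<^sup>2 = u * \<epsilon> / 2" using K by (simp add: u_def power2_eq_square field_simps)
  have uK: "u * K \<le> 1" using K \<epsilon> by (simp add: u_def power2_eq_square field_simps)
  define Z where "Z x = exp (u * Y x)" for x
  have Z: "depends_on A k Z" unfolding Z_def by (rule depends_on_compose[OF Y])
  have EZ: "(\<integral>x. Z x \<partial>\<mu>) \<le> exp (- (u * \<epsilon> / 2))"
  proof -
    have "(\<integral>x. Z x \<partial>\<mu>) \<le> (\<integral>x. 1 + u * Y x + u\<^sup>2 * K\<^sup>2 \<partial>\<mu>)"
    proof (rule integral_mono)
      show "integrable \<mu> Z" by (rule depends_on_integrable[OF Z])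
      show "integrable \<mu> (\<lambda>x. 1 + u * Y x + u\<^sup>2 * K\<^sup>2)"
        using depends_on_integrable[OF Y] by simp
      fix x assume "x \<in> space \<mu>"
      then have Yx: "\<bar>Y x\<bar> \<le> K" using K by (simp add: space_eq)
      have "\<bar>u * Y x\<bar> \<le> u * K" using Yx u by (simp add: abs_mult)
      then have "Z x \<le> 1 + u * Y x + (u * Y x)\<^sup>2"
        unfolding Z_def using uK by (intro exp_le_quadratic) simp
      moreover have "(u * Y x)\<^sup>2 \<le> u\<^sup>2 * K\<^sup>2"
        using Yx K power_mono[of "\<bar>Y x\<bar>" K 2] by (simp add: power_mult_distrib mult_left_mono)
      ultimately show "Z x \<le> 1 + u * Y x + u\<^sup>2 * K\<^sup>2" by simp
    qed
    also have "\<dots> = 1 + - (u * \<epsilon> / 2)"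
      using depends_on_integrable[OF Y] by (simp add: EY uK2 prob_space)
    also have "\<dots> \<le> exp (- (u * \<epsilon> / 2))" by (rule exp_ge_add_one_self)
    finally show ?thesis .
  qed
  define e where "e = exp (u * \<epsilon> / 4) - 1"
  have e: "0 < e" using u \<epsilon> by (simp add: e_def)
  obtain g where g: "\<And>n U k V. determined A n U \<Longrightarrow> determined A k V \<Longrightarrow>
      \<bar>measure \<mu> (U \<inter> preim A (n + g) V) - measure \<mu> U * measure \<mu> V\<bar> \<le> e * (measure \<mu> U * measure \<mu> V)"
    using mixing_upper[OF e] by metis
  have Z0: "0 \<le> (\<integral>x. Z x \<partial>\<mu>)" by (simp add: Z_def)
  define q where "q = Suc k + g"
  have q: "0 < q" by (simp add: q_def)
  have Zk: "depends_on A (Suc k) Z" "depends_on A (Suc k) Y" using Z Y by (auto elim: depends_on_mono)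
  define P where "P m x = (\<Prod>j<m. Z ((shift_map ^^ (j * q)) x))" for m x
  have P_dep: "depends_on A (m * q + Suc k) (P m)" for m
    unfolding P_def
  proof (rule depends_on_prod)
    fix j assume "j < m"
    then have "j * q + Suc k \<le> m * q + Suc k" by simp
    then show "depends_on A (m * q + Suc k) (\<lambda>x. Z ((shift_map ^^ (j * q)) x))"
      by (rule depends_on_mono[OF depends_on_shift[OF Zk(1)]])
  qed
  have EP: "(\<integral>x. P m x \<partial>\<mu>) \<le> exp (- (u * \<epsilon> / 4) * real m)" for m
  proof -
    have "(\<integral>x. P m x \<partial>\<mu>) \<le> ((1 + e) * (\<integral>x. Z x \<partial>\<mu>)) ^ m"
      unfolding P_def q_def by (rule integral_prod_gap[OF Zk(1) _ _ g]) (use e in \<open>auto simp: Z_def\<close>)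
    also have "\<dots> \<le> (exp (u * \<epsilon> / 4) * exp (- (u * \<epsilon> / 2))) ^ m"
      using EZ Z0 by (intro power_mono mult_mono) (auto simp: e_def)
    also have "\<dots> = exp (- (u * \<epsilon> / 4)) ^ m" by (simp add: mult.commute flip: exp_add)
    also have "\<dots> = exp (- (u * \<epsilon> / 4) * real m)" by (metis exp_of_nat_mult mult.commute)
    finally show ?thesis .
  qed
  have "measure \<mu> {x \<in> X. real M * ((\<integral>x. \<psi> x \<partial>\<mu>) + \<epsilon>) \<le> birkhoff_sum \<psi> M x}
      \<le> (real q * exp (u * K) * exp (u * \<epsilon> / 4)) * exp (- (u * \<epsilon> / (4 * real q)) * real M)" for M
  proof -
    define m where "m = M div q"
    have M: "M = m * q + M mod q" by (simp add: m_def)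
    define Q where "Q = {x \<in> X. exp (- (u * K)) \<le> P m x}"
    have Qd: "determined A (m * q + Suc k) Q"
      unfolding Q_def using depends_on_vimage[OF P_dep, of m "{exp (- (u * K))..}"] by simp
    have \<mu>Q: "measure \<mu> Q \<le> exp (- (u * \<epsilon> / 4) * real m) * exp (u * K)"
    proof -
      have "measure \<mu> Q \<le> (\<integral>x. P m x \<partial>\<mu>) / exp (- (u * K))" unfolding Q_def
        by (rule markov_inequality_set[OF depends_on_integrable[OF P_dep]]) (auto simp: P_def Z_def prod_nonneg)
      also have "\<dots> \<le> exp (- (u * \<epsilon> / 4) * real m) / exp (- (u * K))"
        by (intro divide_right_mono EP) simp
      finally show ?thesis by (simp add: exp_minus field_simps)
    qed
    let ?E = "{x \<in> X. real M * ((\<integral>x. \<psi> x \<partial>\<mu>) + \<epsilon>) \<le> birkhoff_sum \<psi> M x}"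
    have "?E \<subseteq> (\<Union>r<q. preim A r Q)"
    proof
      fix x assume "x \<in> ?E"
      then have x: "x \<in> X" and "real M * ((\<integral>x. \<psi> x \<partial>\<mu>) + \<epsilon>) \<le> birkhoff_sum \<psi> M x" by auto
      moreover have "birkhoff_sum Y M x = birkhoff_sum \<psi> M x - real M * ((\<integral>x. \<psi> x \<partial>\<mu>) + \<epsilon>)"
        by (simp add: birkhoff_sum_def Y_def sum_subtractf algebra_simps)
      ultimately have YM: "0 \<le> birkhoff_sum Y M x" by simp
      have "birkhoff_sum Y M x = birkhoff_sum Y (m * q) x + birkhoff_sum Y (M mod q) ((shift_map ^^ (m * q)) x)"
        by (subst M) (rule birkhoff_sum_add)
      moreover have "birkhoff_sum Y (M mod q) ((shift_map ^^ (m * q)) x) \<le> real q * K"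
      proof -
        have "birkhoff_sum Y (M mod q) ((shift_map ^^ (m * q)) x) \<le> (\<Sum>k<M mod q. K)"
          unfolding birkhoff_sum_def
        proof (rule sum_mono)
          fix i
          have "(shift_map ^^ i) ((shift_map ^^ (m * q)) x) \<in> X" using x by auto
          then show "Y ((shift_map ^^ i) ((shift_map ^^ (m * q)) x)) \<le> K" using K(2) by fastforce
        qed
        also have "\<dots> \<le> real q * K"
          using q K(3) mod_less_divisor[of q M] by (simp add: mult_right_mono)
        finally show ?thesis .
      qed
      ultimately have sum: "- (real q * K) \<le> birkhoff_sum Y (m * q) x" using YM by linarith
      have "birkhoff_sum Y (m * q) x = (\<Sum>j<m. \<Sum>r\<in>{j * q..<j * q + q}. Y ((shift_map ^^ r) x))"
        unfolding birkhoff_sum_def by (rule sum.nat_group[symmetric])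
      also have "\<dots> = (\<Sum>j<m. \<Sum>r<q. Y ((shift_map ^^ (j * q + r)) x))"
        by (rule sum.cong[OF refl], subst sum.atLeastLessThan_shift_0) (simp add: atLeast0LessThan)
      also have "\<dots> = (\<Sum>r<q. \<Sum>j<m. Y ((shift_map ^^ (j * q + r)) x))" by (rule sum.swap)
      finally have sum2: "(\<Sum>r<q. - K) \<le> (\<Sum>r<q. \<Sum>j<m. Y ((shift_map ^^ (j * q + r)) x))"
        using sum by simp
      have "\<exists>r<q. - K \<le> (\<Sum>j<m. Y ((shift_map ^^ (j * q + r)) x))"
      proof (rule ccontr)
        assume "\<not> ?thesis"
        then have "(\<Sum>r<q. \<Sum>j<m. Y ((shift_map ^^ (j * q + r)) x)) < (\<Sum>r<q. - K)"
          using q by (intro sum_strict_mono) (auto simp: not_le)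
        then show False using sum2 by simp
      qed
      then obtain r where r: "r < q" "- K \<le> (\<Sum>j<m. Y ((shift_map ^^ (j * q + r)) x))" by blast
      have "P m ((shift_map ^^ r) x) = exp (u * (\<Sum>j<m. Y ((shift_map ^^ (j * q + r)) x)))"
        by (simp add: P_def Z_def sum_distrib_left exp_sum funpow_add)
      moreover have "u * (- K) \<le> u * (\<Sum>j<m. Y ((shift_map ^^ (j * q + r)) x))"
        using r u by (intro mult_left_mono) auto
      ultimately have "(shift_map ^^ r) x \<in> Q" using x by (simp add: Q_def)
      then show "x \<in> (\<Union>r<q. preim A r Q)" using x r(1) by (auto simp: preim_def)
    qed
    then have "measure \<mu> ?E \<le> measure \<mu> (\<Union>r<q. preim A r Q)"
      using Qd by (intro finite_measure_mono) auto
    also have "\<dots> \<le> (\<Sum>r<q. measure \<mu> (preim A r Q))"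
      using Qd by (intro finite_measure_subadditive_finite) auto
    also have "\<dots> = real q * measure \<mu> Q"
      using invariant_pow[OF determined_sets[OF Qd]] by simp
    also have "\<dots> \<le> real q * (exp (- (u * \<epsilon> / 4) * real m) * exp (u * K))"
      by (intro mult_left_mono \<mu>Q) simp
    also have "\<dots> \<le> real q * (exp (u * \<epsilon> / 4 + - (u * \<epsilon> / (4 * real q)) * real M) * exp (u * K))"
    proof -
      have "real M \<le> real q * (real m + 1)"
      proof -
        have "M \<le> q * (m + 1)" using M mod_less_divisor[OF q, of M] unfolding m_def[symmetric]
          by (simp add: mult.commute)
        then show ?thesis by (metis of_nat_1 of_nat_add of_nat_le_iff of_nat_mult)
      qed
      then have "real M / real q \<le> real m + 1" using q by (simp add: field_simps)
      then have "(u * \<epsilon> / 4) * (real M / real q) \<le> (u * \<epsilon> / 4) * (real m + 1)"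
        using u \<epsilon> by (intro mult_left_mono) auto
      then have "- (u * \<epsilon> / 4) * real m \<le> u * \<epsilon> / 4 + - (u * \<epsilon> / (4 * real q)) * real M"
        by (simp add: algebra_simps)
      then show ?thesis by (intro mult_left_mono mult_right_mono) auto
    qed
    finally show ?thesis unfolding exp_add by (simp add: mult_ac)
  qed
  note main = this
  have pos: "0 < u * \<epsilon> / (4 * real q)" "0 < real q * exp (u * K) * exp (u * \<epsilon> / 4)"
    using u \<epsilon> q by auto
  show ?thesis by (rule that[OF pos(2,1) main])
qed

end

section \<open>Kolmogorov--Sinai entropy on the subshift\<close>

text \<open>Division of \<open>n\<close> with remainder by a \<open>k\<close> that almost attains the
  infimum.\<close>

lemma fekete:
  fixes a :: "nat \<Rightarrow> real"
  assumes sub: "\<And>n m. a (n + m) \<le> a n + a m" and nn: "\<And>n. 0 \<le> a n"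
  obtains L where "(\<lambda>n. a n / real n) \<longlonglongrightarrow> L" "\<And>n. 1 \<le> n \<Longrightarrow> L \<le> a n / real n"
proof -
  define L where "L = (INF n\<in>{1::nat..}. a n / real n)"
  have low: "L \<le> a n / real n" if "1 \<le> n" for n
    unfolding L_def by (rule cINF_lower) (use that nn in \<open>auto intro!: bdd_belowI2[where m=0]\<close>)
  have mult: "a (q * k) \<le> real q * a k + a 0" for q k
  proof (induction q)
    case (Suc q)
    then show ?case using sub[of k "q * k"] by (simp add: algebra_simps)
  qed simp
  have "(\<lambda>n. a n / real n) \<longlonglongrightarrow> L"
  proof (rule LIMSEQ_I)
    fix e :: real assume e: "0 < e"
    have "\<exists>k\<in>{1::nat..}. a k / real k < L + e / 2"
    proof (rule ccontr)
      assume "\<not> ?thesis"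
      then have "L + e / 2 \<le> L" unfolding L_def by (intro cINF_greatest) (auto simp: not_less L_def)
      then show False using e by simp
    qed
    then obtain k where k: "1 \<le> k" "a k / real k < L + e / 2" by auto
    define C where "C = a 0 + (\<Sum>r<k. a r)"
    have C0: "0 \<le> C" unfolding C_def by (intro add_nonneg_nonneg sum_nonneg nn)
    have up: "a n / real n \<le> a k / real k + C / real n" if n: "1 \<le> n" for n
    proof -
      have "a n \<le> a (n div k * k) + a (n mod k)" using sub[of "n div k * k" "n mod k"] by simp
      also have "\<dots> \<le> (real (n div k) * a k + a 0) + (\<Sum>r<k. a r)"
        using k by (intro add_mono mult member_le_sum) (auto intro: nn)
      also have "\<dots> \<le> (real n / real k) * a k + C"
      proof -
        have "real (n div k) \<le> real n / real k" by (rule of_nat_div_le_of_nat)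
        from mult_right_mono[OF this nn[of k]] show ?thesis by (simp add: C_def)
      qed
      finally have "a n / real n \<le> ((real n / real k) * a k + C) / real n"
        by (intro divide_right_mono) auto
      also have "\<dots> = a k / real k + C / real n" using n by (simp add: add_divide_distrib)
      finally show ?thesis .
    qed
    obtain N :: nat where N: "2 * C / e < real N" using reals_Archimedean2 by blast
    show "\<exists>N. \<forall>n\<ge>N. norm (a n / real n - L) < e"
    proof (intro exI[of _ "max 1 N"] allI impI)
      fix n assume n: "max 1 N \<le> n"
      then have "2 * C / e < real n" using N by linarith
      then have "C / real n < e / 2" using e n by (simp add: field_simps)
      then have "a n / real n < L + e" using up[of n] k n by linarith
      then show "norm (a n / real n - L) < e" using low[of n] n by simp
    qed
  qed
  then show ?thesis using low that by blast
qed

text \<open>With \<open>ln 0 = 0\<close> the value at \<open>0\<close> is the usual convention for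
  entropies.\<close>

definition \<eta> :: "real \<Rightarrow> real" where "\<eta> p = - (p * ln p)"

lemma \<eta>_nonneg: "0 \<le> p \<Longrightarrow> p \<le> 1 \<Longrightarrow> 0 \<le> \<eta> p"
  by (cases "p = 0") (auto simp: \<eta>_def mult_nonneg_nonpos)

lemma \<eta>_le_sqrt: "0 \<le> p \<Longrightarrow> \<eta> p \<le> 2 * sqrt p"
proof (cases "p = 0")
  case False
  assume "0 \<le> p"
  then have p: "0 < sqrt p" using False by simp
  then have "ln (1 / sqrt p) \<le> 1 / sqrt p - 1" by (intro ln_le_minus_one) simp
  then have "- ln (sqrt p) \<le> 1 / sqrt p" using p by (simp add: ln_div)
  moreover have "ln p = 2 * ln (sqrt p)" using \<open>0 \<le> p\<close> False by (simp add: ln_sqrt)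
  ultimately have "- ln p \<le> 2 / sqrt p" by simp
  then have "p * - ln p \<le> p * (2 / sqrt p)" using \<open>0 \<le> p\<close> by (intro mult_left_mono)
  also have "\<dots> = 2 * sqrt p" using \<open>0 \<le> p\<close> by (metis mult.commute real_div_sqrt times_divide_eq_right)
  finally show ?thesis by (simp add: \<eta>_def)
qed (simp add: \<eta>_def)

lemma \<eta>_le_compl: "0 \<le> p \<Longrightarrow> p \<le> 1 \<Longrightarrow> \<eta> p \<le> 1 - p"
proof (cases "p = 0")
  case False
  assume p: "0 \<le> p" "p \<le> 1"
  then have "ln (1 / p) \<le> 1 / p - 1" using False by (intro ln_le_minus_one) simp
  then have "p * - ln p \<le> p * (1 / p - 1)" using p False by (intro mult_left_mono) (auto simp: ln_div)
  then show ?thesis using False by (simp add: \<eta>_def algebra_simps)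
qed (simp add: \<eta>_def)

sublocale clopen_prob \<subseteq> information_space \<mu> "exp 1"
  by unfold_locales simp

context clopen_prob
begin

lemma partition_entropy_eq:
  assumes "simple_function \<mu> Y"
  shows "partition_entropy \<mu> Y = (\<Sum>v\<in>Y ` X. \<eta> (measure \<mu> {x \<in> X. Y x = v}))"
proof -
  have "{x \<in> X. Y x = v} = Y -` {v} \<inter> space \<mu>" for v by (auto simp: space_eq)
  then show ?thesis
    unfolding partition_entropy_def
      entropy_simple_distributed[OF simple_distributedI[OF assms measure_nonneg refl]]
    by (simp add: \<eta>_def log_def space_eq sum_negf)
qed

lemma partition_entropy_superset:
  assumes "simple_function \<mu> Y" "finite S" "Y ` X \<subseteq> S"
  shows "partition_entropy \<mu> Y = (\<Sum>v\<in>S. \<eta> (measure \<mu> {x \<in> X. Y x = v}))"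
  unfolding partition_entropy_eq[OF assms(1)]
proof (rule sum.mono_neutral_left[OF assms(2,3)], rule ballI)
  fix v assume "v \<in> S - Y ` X"
  then have "{x \<in> X. Y x = v} = {}" by auto
  then show "\<eta> (measure \<mu> {x \<in> X. Y x = v}) = 0" by (simp only: measure_empty \<eta>_def)
qed

lemma partition_entropy_nonneg: "simple_function \<mu> Y \<Longrightarrow> 0 \<le> partition_entropy \<mu> Y"
  unfolding partition_entropy_eq by (intro sum_nonneg \<eta>_nonneg measure_nonneg prob_le_1)

lemma partition_entropy_cong:
  "(\<And>x. x \<in> X \<Longrightarrow> Y x = Z x) \<Longrightarrow> simple_function \<mu> Y \<Longrightarrow> partition_entropy \<mu> Z = partition_entropy \<mu> Y"
proof -
  assume eq: "\<And>x. x \<in> X \<Longrightarrow> Y x = Z x" and Y: "simple_function \<mu> Y"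
  have Z: "simple_function \<mu> Z" using Y simple_function_cong[of \<mu> Y Z] eq by (simp add: space_eq)
  have "Y ` X = Z ` X" using eq by (intro image_cong) auto
  moreover have "{x \<in> X. Y x = v} = {x \<in> X. Z x = v}" for v using eq by auto
  ultimately show ?thesis by (simp add: partition_entropy_eq Y Z)
qed

lemma partition_entropy_factor:
  assumes Y: "simple_function \<mu> Y" and eq: "\<And>x. x \<in> X \<Longrightarrow> Z x = F (Y x)"
  shows "partition_entropy \<mu> Z \<le> partition_entropy \<mu> Y"
proof -
  have "partition_entropy \<mu> (F \<circ> Y) \<le> partition_entropy \<mu> Y"
    unfolding partition_entropy_def by (rule entropy_data_processing[OF Y])
  moreover have "partition_entropy \<mu> Z = partition_entropy \<mu> (F \<circ> Y)"
    by (rule partition_entropy_cong) (use eq simple_function_compose[OF Y] in auto)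
  ultimately show ?thesis by simp
qed

lemma partition_entropy_Pair:
  assumes "simple_function \<mu> Y" "simple_function \<mu> Z"
  shows "partition_entropy \<mu> (\<lambda>x. (Y x, Z x)) \<le> partition_entropy \<mu> Y + partition_entropy \<mu> Z"
  using entropy_chain_rule[OF assms] conditional_entropy_less_eq_entropy[OF assms(2,1)]
  unfolding partition_entropy_def by simp

lemma partition_entropy_const: "partition_entropy \<mu> (\<lambda>x. a) = 0"
proof -
  have "(\<lambda>x. a) ` X = {a}" using nonempty by auto
  moreover have "measure \<mu> {x \<in> X. True} = 1" using prob_space by (simp add: space_eq)
  ultimately show ?thesis by (subst partition_entropy_eq) (simp_all add: \<eta>_def)
qed

text \<open>The sets that can be approximated form a sigma-algebra which contains the clopen sets.\<close>

lemma clopen_approximation: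
  assumes "V \<in> sets \<mu>" "0 < \<delta>"
  shows "\<exists>n U. determined A n U \<and> measure \<mu> (V - U \<union> (U - V)) < \<delta>"
proof -
  have "V \<in> sigma_sets X (clopens A)" using assms(1) by (simp add: sets_eq)
  then show ?thesis using assms(2)
  proof (induction arbitrary: \<delta>)
    case (Basic V)
    then obtain n where "determined A n V" by (auto simp: clopens_def)
    then show ?case using Basic by (intro exI[of _ n] exI[of _ V]) simp
  next
    case Empty
    then show ?case by (intro exI[of _ 0] exI[of _ "{}"]) simp
  next
    case (Compl V)
    obtain n U where U: "determined A n U" "measure \<mu> (V - U \<union> (U - V)) < \<delta>"
      using Compl.IH[OF Compl.prems] by blast
    have "V \<subseteq> X" using Compl.hyps sets.sets_into_space[of V \<mu>] by (simp add: sets_eq space_eq)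
    then have "(X - V) - (X - U) \<union> ((X - U) - (X - V)) = V - U \<union> (U - V)"
      using determined_subset[OF U(1)] by auto
    then show ?case using U determined_Diff[OF determined_space U(1)]
      by (intro exI[of _ n] exI[of _ "X - U"]) simp
  next
    case (Union V)
    have Vs: "V i \<in> sets \<mu>" for i using Union.hyps by (simp add: sets_eq)
    have "(\<lambda>n. measure \<mu> (\<Union>i\<le>n. V i)) \<longlonglongrightarrow> measure \<mu> (\<Union>n. \<Union>i\<le>n. V i)"
      using Vs by (intro finite_Lim_measure_incseq) (auto simp: incseq_def intro: order_trans)
    moreover have "(\<Union>n. \<Union>i\<le>n. V i) = (\<Union>i. V i)" by auto
    ultimately have "(\<lambda>n. measure \<mu> (\<Union>i\<le>n. V i)) \<longlonglongrightarrow> measure \<mu> (\<Union>i. V i)" by simp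
    from LIMSEQ_D[OF this, of "\<delta> / 2"] Union.prems obtain N
      where "\<And>n. n \<ge> N \<Longrightarrow> norm (measure \<mu> (\<Union>i\<le>n. V i) - measure \<mu> (\<Union>i. V i)) < \<delta> / 2" by auto
    from this[OF order_refl] have N: "measure \<mu> (\<Union>i. V i) - measure \<mu> (\<Union>i\<le>N. V i) < \<delta> / 2"
      unfolding real_norm_def abs_less_iff by linarith
    define \<gamma> where "\<gamma> = \<delta> / (2 * (real N + 1))"
    have \<gamma>: "0 < \<gamma>" using Union.prems by (simp add: \<gamma>_def)
    have "\<forall>i. \<exists>n U. determined A n U \<and> measure \<mu> (V i - U \<union> (U - V i)) < \<gamma>"
      using Union.IH[OF \<gamma>] by blast
    then obtain n U where U: "\<And>i. determined A (n i) (U i)"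
      "\<And>i. measure \<mu> (V i - U i \<union> (U i - V i)) < \<gamma>" by metis
    define m where "m = Max (n ` {..N})"
    have "determined A m (\<Union>i\<le>N. U i)"
    proof (rule determined_UN)
      fix i assume "i \<in> {..N}"
      then show "determined A m (U i)" by (intro determined_mono[OF U(1)]) (auto simp: m_def)
    qed
    moreover have "measure \<mu> ((\<Union>i. V i) - (\<Union>i\<le>N. U i) \<union> ((\<Union>i\<le>N. U i) - (\<Union>i. V i))) < \<delta>"
    proof -
      let ?D = "\<lambda>i. V i - U i \<union> (U i - V i)"
      have Us: "U i \<in> sets \<mu>" for i using U(1) by auto
      have "measure \<mu> ((\<Union>i. V i) - (\<Union>i\<le>N. U i) \<union> ((\<Union>i\<le>N. U i) - (\<Union>i. V i)))
          \<le> measure \<mu> (((\<Union>i. V i) - (\<Union>i\<le>N. V i)) \<union> (\<Union>i\<le>N. ?D i))"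
        using Vs Us by (intro finite_measure_mono) auto
      also have "\<dots> \<le> measure \<mu> ((\<Union>i. V i) - (\<Union>i\<le>N. V i)) + measure \<mu> (\<Union>i\<le>N. ?D i)"
        using Vs Us by (intro measure_Un_le) auto
      also have "measure \<mu> ((\<Union>i. V i) - (\<Union>i\<le>N. V i)) = measure \<mu> (\<Union>i. V i) - measure \<mu> (\<Union>i\<le>N. V i)"
        using Vs by (intro finite_measure_Diff) auto
      also have "measure \<mu> (\<Union>i\<le>N. ?D i) \<le> (\<Sum>i\<le>N. measure \<mu> (?D i))"
        using Vs Us by (intro finite_measure_subadditive_finite) auto
      also have "\<dots> \<le> (\<Sum>i\<le>N. \<gamma>)" using U(2) by (intro sum_mono less_imp_le)
      also have "\<dots> = \<delta> / 2" by (simp add: \<gamma>_def field_simps)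
      finally show ?thesis using N by simp
    qed
    ultimately show ?case by blast
  qed
qed

end

context invariant_measure
begin

lemma simple_function_shift: "simple_function \<mu> Y \<Longrightarrow> simple_function \<mu> (\<lambda>x. Y ((shift_map ^^ n) x))"
proof -
  assume Y: "simple_function \<mu> Y"
  have img: "(\<lambda>x. Y ((shift_map ^^ n) x)) ` X \<subseteq> Y ` X" by auto
  then have "finite ((\<lambda>x. Y ((shift_map ^^ n) x)) ` X)"
    using Y by (auto simp: simple_function_def space_eq intro: finite_subset)
  moreover have "(\<lambda>x. Y ((shift_map ^^ n) x)) -` {v} \<inter> space \<mu> \<in> sets \<mu>" for v
  proof -
    have "(\<lambda>x. Y ((shift_map ^^ n) x)) -` {v} \<inter> space \<mu> = preim A n (Y -` {v} \<inter> space \<mu>)"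
      by (auto simp: preim_def space_eq)
    moreover have "Y -` {v} \<inter> space \<mu> \<in> sets \<mu>" using simple_functionD(2)[OF Y] .
    ultimately show ?thesis by auto
  qed
  ultimately show ?thesis unfolding simple_function_def by (auto simp: space_eq)
qed

lemma partition_entropy_shift:
  assumes Y: "simple_function \<mu> Y"
  shows "partition_entropy \<mu> (\<lambda>x. Y ((shift_map ^^ n) x)) = partition_entropy \<mu> Y"
proof -
  have img: "(\<lambda>x. Y ((shift_map ^^ n) x)) ` X \<subseteq> Y ` X" by auto
  have fin: "finite (Y ` X)" using Y by (auto simp: simple_function_def space_eq)
  have "measure \<mu> {x \<in> X. Y ((shift_map ^^ n) x) = v} = measure \<mu> {x \<in> X. Y x = v}" for v
  proof -
    have "{x \<in> X. Y x = v} = Y -` {v} \<inter> space \<mu>" by (auto simp: space_eq)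
    then have "{x \<in> X. Y x = v} \<in> sets \<mu>" using simple_functionD(2)[OF Y] by simp
    moreover have "{x \<in> X. Y ((shift_map ^^ n) x) = v} = preim A n {x \<in> X. Y x = v}"
      by (auto simp: preim_def)
    ultimately show ?thesis by (simp add: invariant_pow)
  qed
  then show ?thesis
    unfolding partition_entropy_superset[OF simple_function_shift[OF Y] fin img]
      partition_entropy_eq[OF Y] by simp
qed

lemma itinerary_add:
  "itinerary shift_map \<xi> (n + m) x = itinerary shift_map \<xi> n x @ itinerary shift_map \<xi> m ((shift_map ^^ n) x)"
proof -
  have "map (\<lambda>i. \<xi> ((shift_map ^^ i) x)) [n..<n + m] = map (\<lambda>i. \<xi> ((shift_map ^^ i) ((shift_map ^^ n) x))) [0..<m]"
    by (rule nth_equalityI) (simp_all add: funpow_add add.commute[of n] flip: funpow_add comp_apply[of "shift_map ^^ _"])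
  then show ?thesis using upt_add_eq_append[of 0 n m] by (simp add: itinerary_def)
qed

lemma simple_itinerary:
  assumes "simple_function \<mu> \<xi>" shows "simple_function \<mu> (itinerary shift_map \<xi> n)"
proof (induction n)
  case 0
  then show ?case by (simp add: itinerary_def)
next
  case (Suc n)
  have "simple_function \<mu> ((\<lambda>(a, b). a @ [b]) \<circ> (\<lambda>x. (itinerary shift_map \<xi> n x, \<xi> ((shift_map ^^ n) x))))"
    by (rule simple_function_compose[OF simple_function_Pair[OF Suc simple_function_shift[OF assms]]])
  moreover have "(\<lambda>(a, b). a @ [b]) \<circ> (\<lambda>x. (itinerary shift_map \<xi> n x, \<xi> ((shift_map ^^ n) x)))
      = itinerary shift_map \<xi> (Suc n)"
    by (auto simp: itinerary_def fun_eq_iff)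
  ultimately show ?case by simp
qed

lemma itinerary_entropy_subadditive:
  assumes "simple_function \<mu> \<xi>"
  shows "partition_entropy \<mu> (itinerary shift_map \<xi> (n + m))
    \<le> partition_entropy \<mu> (itinerary shift_map \<xi> n) + partition_entropy \<mu> (itinerary shift_map \<xi> m)"
proof -
  note S = simple_itinerary[OF assms]
  have "partition_entropy \<mu> (itinerary shift_map \<xi> (n + m))
      \<le> partition_entropy \<mu> (\<lambda>x. (itinerary shift_map \<xi> n x, itinerary shift_map \<xi> m ((shift_map ^^ n) x)))"
    by (rule partition_entropy_factor[where F = "\<lambda>(a, b). a @ b"])
      (rule simple_function_Pair[OF S simple_function_shift[OF S]], simp add: itinerary_add)
  also have "\<dots> \<le> partition_entropy \<mu> (itinerary shift_map \<xi> n) + partition_entropy \<mu> (\<lambda>x. itinerary shift_map \<xi> m ((shift_map ^^ n) x))"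
    by (rule partition_entropy_Pair[OF S simple_function_shift[OF S]])
  finally show ?thesis by (simp add: partition_entropy_shift[OF S])
qed

lemma itinerary_entropy_le:
  assumes "simple_function \<mu> \<xi>"
  shows "partition_entropy \<mu> (itinerary shift_map \<xi> n) \<le> real n * partition_entropy \<mu> \<xi>"
proof (induction n)
  case 0
  have "itinerary shift_map \<xi> 0 = (\<lambda>x. [])" by (auto simp: itinerary_def)
  then show ?case by (simp add: partition_entropy_const)
next
  case (Suc n)
  have "partition_entropy \<mu> (itinerary shift_map \<xi> 1) \<le> partition_entropy \<mu> \<xi>"
    by (rule partition_entropy_factor[OF assms, where F = "\<lambda>a. [a]"]) (simp add: itinerary_def)
  then show ?case using Suc itinerary_entropy_subadditive[OF assms, of n 1] by (simp add: algebra_simps)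
qed

lemma simple_word: "simple_function \<mu> (word n)"
  by (rule depends_on_simple[OF depends_on_word])

lemma word_add: "word (n + m) x = word n x @ word m ((shift_map ^^ n) x)"
proof -
  have "map x [n..<n + m] = map ((shift_map ^^ n) x) [0..<m]"
    by (rule nth_equalityI) (simp_all add: shift_map_funpow_apply add.commute)
  then show ?thesis using upt_add_eq_append[of 0 n m] by (simp add: word_def)
qed

lemma word_entropy_subadditive:
  "partition_entropy \<mu> (word (n + m)) \<le> partition_entropy \<mu> (word n) + partition_entropy \<mu> (word m)"
proof -
  have "partition_entropy \<mu> (word (n + m)) \<le> partition_entropy \<mu> (\<lambda>x. (word n x, word m ((shift_map ^^ n) x)))"
    by (rule partition_entropy_factor[where F = "\<lambda>(a, b). a @ b"])
      (rule simple_function_Pair[OF simple_word simple_function_shift[OF simple_word]], simp add: word_add)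
  also have "\<dots> \<le> partition_entropy \<mu> (word n) + partition_entropy \<mu> (\<lambda>x. word m ((shift_map ^^ n) x))"
    by (rule partition_entropy_Pair[OF simple_word simple_function_shift[OF simple_word]])
  finally show ?thesis by (simp add: partition_entropy_shift[OF simple_word])
qed

lemma simple_function_approximation:
  fixes \<xi> :: "(nat \<Rightarrow> 's) \<Rightarrow> nat"
  assumes \<xi>: "simple_function \<mu> \<xi>" and e: "0 < e"
  obtains k \<xi>' where "depends_on A k \<xi>'" "measure \<mu> {x \<in> X. \<xi> x \<noteq> \<xi>' x} < e"
proof -
  define R where "R = \<xi> ` X"
  have R: "finite R" "R \<noteq> {}" using \<xi> nonempty by (auto simp: simple_function_def space_eq R_def)
  define V where "V v = {x \<in> X. \<xi> x = v}" for v
  have V: "V v \<in> sets \<mu>" for v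
  proof -
    have "V v = \<xi> -` {v} \<inter> space \<mu>" by (auto simp: V_def space_eq)
    then show ?thesis using simple_functionD(2)[OF \<xi>] by simp
  qed
  define d where "d = e / real (card R)"
  have d: "0 < d" using R e by (simp add: d_def card_gt_0_iff)
  obtain n U where U: "\<And>v. determined A (n v) (U v)" "\<And>v. measure \<mu> (V v - U v \<union> (U v - V v)) < d"
    using clopen_approximation[OF V d] by metis
  define k where "k = Max (n ` R)"
  have Uk: "determined A k (U v)" if "v \<in> R" for v
    by (rule determined_mono[OF U(1)]) (use that R in \<open>auto simp: k_def\<close>)
  define \<xi>' where "\<xi>' x = (SOME v. v \<in> R \<and> x \<in> U v)" for x
  have dep: "depends_on A k \<xi>'"
    unfolding depends_on_def
  proof (intro ballI impI)
    fix x y assume xy: "x \<in> X" "y \<in> X" "agree k x y"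
    have "x \<in> U v \<longleftrightarrow> y \<in> U v" if "v \<in> R" for v
      using Uk[OF that] xy agree_sym[OF xy(3)] unfolding determined_def by blast
    then have "(\<lambda>v. v \<in> R \<and> x \<in> U v) = (\<lambda>v. v \<in> R \<and> y \<in> U v)" by auto
    then show "\<xi>' x = \<xi>' y" unfolding \<xi>'_def by simp
  qed
  have Us: "U v \<in> sets \<mu>" for v using U(1) by auto
  have "{x \<in> X. \<xi> x \<noteq> \<xi>' x} \<subseteq> (\<Union>v\<in>R. V v - U v \<union> (U v - V v))"
  proof
    fix x assume x: "x \<in> {x \<in> X. \<xi> x \<noteq> \<xi>' x}"
    show "x \<in> (\<Union>v\<in>R. V v - U v \<union> (U v - V v))"
    proof (rule ccontr)
      assume "\<not> ?thesis"
      then have *: "x \<in> V v \<longleftrightarrow> x \<in> U v" if "v \<in> R" for v using that by auto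
      have "\<xi> x \<in> R" "x \<in> V (\<xi> x)" using x by (auto simp: R_def V_def)
      then have "\<xi> x \<in> R \<and> x \<in> U (\<xi> x)" using * by auto
      then have "\<xi>' x \<in> R \<and> x \<in> U (\<xi>' x)" unfolding \<xi>'_def by (rule someI[where P="\<lambda>v. v \<in> R \<and> x \<in> U v"])
      then have "x \<in> V (\<xi>' x)" using * by auto
      then show False using x by (auto simp: V_def)
    qed
  qed
  then have "measure \<mu> {x \<in> X. \<xi> x \<noteq> \<xi>' x} \<le> measure \<mu> (\<Union>v\<in>R. V v - U v \<union> (U v - V v))"
    using V Us R by (intro finite_measure_mono) auto
  also have "\<dots> \<le> (\<Sum>v\<in>R. measure \<mu> (V v - U v \<union> (U v - V v)))"
    using V Us R by (intro finite_measure_subadditive_finite) auto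
  also have "\<dots> < (\<Sum>v\<in>R. d)" using R U(2) by (intro sum_strict_mono) auto
  also have "\<dots> = e" using R by (simp add: d_def)
  finally show ?thesis using that dep by blast
qed

text \<open>The function \<open>\<xi>\<close> is determined by a cylinder function \<open>\<xi>'\<close>
  together with the correction \<open>\<zeta>\<close>, which is \<open>0\<close> except on a set of small
  measure. The itinerary of \<open>\<xi>'\<close> is a function of a word, and \<open>\<zeta>\<close> has
  small entropy.\<close>

lemma itinerary_entropy_bound:
  fixes \<xi> :: "(nat \<Rightarrow> 's) \<Rightarrow> nat"
  assumes \<xi>: "simple_function \<mu> \<xi>" and e: "0 < e"
  obtains K where "\<And>n. partition_entropy \<mu> (itinerary shift_map \<xi> n) \<le> partition_entropy \<mu> (word n) + K + real n * e"
proof -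
  define N where "N = real (card (\<xi> ` X))"
  have N: "0 \<le> N" by (simp add: N_def)
  define \<delta> where "\<delta> = min (e / 2) ((e / (4 * (N + 1)))\<^sup>2)"
  have \<delta>: "0 < \<delta>" using e N by (simp add: \<delta>_def)
  have \<delta>e: "\<delta> + N * (2 * sqrt \<delta>) \<le> e"
  proof -
    have "sqrt \<delta> \<le> e / (4 * (N + 1))"
      by (rule real_le_lsqrt) (use e N in \<open>auto simp: \<delta>_def\<close>)
    then have "N * (2 * sqrt \<delta>) \<le> N * (2 * (e / (4 * (N + 1))))" using N by (intro mult_left_mono) auto
    also have "\<dots> \<le> e / 2" using N e by (simp add: field_simps)
    finally show ?thesis by (simp add: \<delta>_def)
  qed
  obtain k \<xi>' where \<xi>': "depends_on A k \<xi>'" and ne: "measure \<mu> {x \<in> X. \<xi> x \<noteq> \<xi>' x} < \<delta>"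
    using simple_function_approximation[OF \<xi> \<delta>] by blast
  have s\<xi>': "simple_function \<mu> \<xi>'" by (rule depends_on_simple[OF \<xi>'])
  define \<zeta> where "\<zeta> x = (if \<xi> x = \<xi>' x then 0 else Suc (\<xi> x))" for x
  have s\<zeta>: "simple_function \<mu> \<zeta>"
  proof -
    have "simple_function \<mu> ((\<lambda>(a, b). if a = b then 0 else Suc a) \<circ> (\<lambda>x. (\<xi> x, \<xi>' x)))"
      by (intro simple_function_compose simple_function_Pair \<xi> s\<xi>')
    moreover have "(\<lambda>(a, b). if a = b then 0 else Suc a) \<circ> (\<lambda>x. (\<xi> x, \<xi>' x)) = \<zeta>"
      by (auto simp: \<zeta>_def)
    ultimately show ?thesis by simp
  qed
  have meas: "{x \<in> X. \<xi> x \<noteq> \<xi>' x} \<in> sets \<mu>" "{x \<in> X. \<zeta> x = 0} \<in> sets \<mu>"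
  proof -
    have "\<zeta> -` {0} \<inter> space \<mu> \<in> sets \<mu>" using simple_functionD(2)[OF s\<zeta>] .
    moreover have "\<zeta> -` {0} \<inter> space \<mu> = {x \<in> X. \<zeta> x = 0}" by (auto simp: space_eq)
    ultimately show *: "{x \<in> X. \<zeta> x = 0} \<in> sets \<mu>" by simp
    have "{x \<in> X. \<xi> x \<noteq> \<xi>' x} = space \<mu> - {x \<in> X. \<zeta> x = 0}" by (auto simp: \<zeta>_def space_eq)
    then show "{x \<in> X. \<xi> x \<noteq> \<xi>' x} \<in> sets \<mu>" using * by simp
  qed
  have finR: "finite (\<xi> ` X)" using \<xi> by (auto simp: simple_function_def space_eq)
  have "partition_entropy \<mu> \<zeta> = (\<Sum>v\<in>insert 0 (Suc ` (\<xi> ` X)). \<eta> (measure \<mu> {x \<in> X. \<zeta> x = v}))"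
    using finR by (intro partition_entropy_superset s\<zeta>) (auto simp: \<zeta>_def)
  also have "\<dots> = \<eta> (measure \<mu> {x \<in> X. \<zeta> x = 0}) + (\<Sum>v\<in>\<xi> ` X. \<eta> (measure \<mu> {x \<in> X. \<zeta> x = Suc v}))"
    using finR by (simp add: sum.reindex)
  also have "\<dots> \<le> \<delta> + (\<Sum>v\<in>\<xi> ` X. 2 * sqrt \<delta>)"
  proof (intro add_mono sum_mono)
    have "{x \<in> X. \<xi> x \<noteq> \<xi>' x} = space \<mu> - {x \<in> X. \<zeta> x = 0}" by (auto simp: \<zeta>_def space_eq)
    then have "1 - measure \<mu> {x \<in> X. \<zeta> x = 0} = measure \<mu> {x \<in> X. \<xi> x \<noteq> \<xi>' x}"
      using prob_compl[OF meas(2)] by simp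
    then show "\<eta> (measure \<mu> {x \<in> X. \<zeta> x = 0}) \<le> \<delta>"
      using \<eta>_le_compl[of "measure \<mu> {x \<in> X. \<zeta> x = 0}"] ne by simp
    fix v
    have "measure \<mu> {x \<in> X. \<zeta> x = Suc v} \<le> measure \<mu> {x \<in> X. \<xi> x \<noteq> \<xi>' x}"
      using meas by (intro finite_measure_mono) (auto simp: \<zeta>_def split: if_splits)
    then have "sqrt (measure \<mu> {x \<in> X. \<zeta> x = Suc v}) \<le> sqrt \<delta>" using ne by simp
    then show "\<eta> (measure \<mu> {x \<in> X. \<zeta> x = Suc v}) \<le> 2 * sqrt \<delta>"
      using \<eta>_le_sqrt[OF measure_nonneg[of \<mu> "{x \<in> X. \<zeta> x = Suc v}"]] by linarith
  qed
  also have "\<dots> \<le> e" using \<delta>e by (simp add: N_def)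
  finally have H\<zeta>: "partition_entropy \<mu> \<zeta> \<le> e" .
  let ?I = "itinerary shift_map"
  have "partition_entropy \<mu> (?I \<xi> n) \<le> partition_entropy \<mu> (word n) + partition_entropy \<mu> (word k) + real n * e" for n
  proof -
    have "partition_entropy \<mu> (?I \<xi> n) \<le> partition_entropy \<mu> (\<lambda>x. (?I \<xi>' n x, ?I \<zeta> n x))"
    proof (rule partition_entropy_factor[where F = "\<lambda>(a, b). map2 (\<lambda>s t. if t = 0 then s else t - 1) a b"])
      show "simple_function \<mu> (\<lambda>x. (?I \<xi>' n x, ?I \<zeta> n x))"
        by (intro simple_function_Pair simple_itinerary s\<xi>' s\<zeta>)
      show "?I \<xi> n x = (case (?I \<xi>' n x, ?I \<zeta> n x) of (a, b) \<Rightarrow> map2 (\<lambda>s t. if t = 0 then s else t - 1) a b)" for x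
        by (rule nth_equalityI) (auto simp: itinerary_def \<zeta>_def)
    qed
    also have "\<dots> \<le> partition_entropy \<mu> (?I \<xi>' n) + partition_entropy \<mu> (?I \<zeta> n)"
      by (intro partition_entropy_Pair simple_itinerary s\<xi>' s\<zeta>)
    also have "partition_entropy \<mu> (?I \<zeta> n) \<le> real n * e"
      using itinerary_entropy_le[OF s\<zeta>, of n] mult_left_mono[OF H\<zeta>, of "real n"] by simp
    also have "partition_entropy \<mu> (?I \<xi>' n) \<le> partition_entropy \<mu> (word (n + k))"
    proof -
      have "depends_on A (n + k) (?I \<xi>' n)"
        unfolding depends_on_def
      proof (intro ballI impI)
        fix x y assume xy: "x \<in> X" "y \<in> X" "agree (n + k) x y"
        have "\<xi>' ((shift_map ^^ i) x) = \<xi>' ((shift_map ^^ i) y)" if "i < n" for i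
          using xy that by (intro depends_onD[OF \<xi>'] agree_shift agree_mono[OF xy(3)]) auto
        then show "?I \<xi>' n x = ?I \<xi>' n y" by (simp add: itinerary_def)
      qed
      then obtain F where "\<And>x. x \<in> X \<Longrightarrow> ?I \<xi>' n x = F (word (n + k) x)"
        using depends_on_factor by blast
      then show ?thesis by (rule partition_entropy_factor[OF simple_word])
    qed
    also have "\<dots> \<le> partition_entropy \<mu> (word n) + partition_entropy \<mu> (word k)"
      by (rule word_entropy_subadditive)
    finally show ?thesis by simp
  qed
  then show ?thesis using that by blast
qed

text \<open>The partition into first letters generates, so words compute the entropy. The infimum property,
  from subadditivity, later turns a lower bound on the entropy into one on the entropy of each finite
  word.\<close>

theorem kolmogorov_sinai:
  obtains h where "(\<lambda>n. partition_entropy \<mu> (word n) / real n) \<longlonglongrightarrow> h"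
    "\<And>n. 1 \<le> n \<Longrightarrow> h \<le> partition_entropy \<mu> (word n) / real n"
    "ks_entropy \<mu> shift_map = ereal h"
proof -
  obtain h where h: "(\<lambda>n. partition_entropy \<mu> (word n) / real n) \<longlonglongrightarrow> h"
    "\<And>n. 1 \<le> n \<Longrightarrow> h \<le> partition_entropy \<mu> (word n) / real n"
    by (rule fekete[of "\<lambda>n. partition_entropy \<mu> (word n)"])
      (auto intro: word_entropy_subadditive partition_entropy_nonneg simple_word)
  let ?H = "\<lambda>\<xi> n. partition_entropy \<mu> (itinerary shift_map \<xi> n)"
  have conv: "\<exists>l. (\<lambda>n. ?H \<xi> n / real n) \<longlonglongrightarrow> l" if \<xi>: "simple_function \<mu> \<xi>" for \<xi> :: "_ \<Rightarrow> nat"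
    by (rule fekete[of "?H \<xi>"])
      (auto intro: itinerary_entropy_subadditive[OF \<xi>] partition_entropy_nonneg simple_itinerary[OF \<xi>])
  have lim_eq: "lim (\<lambda>n. ereal (?H \<xi> n / real n)) = ereal l" if "(\<lambda>n. ?H \<xi> n / real n) \<longlonglongrightarrow> l" for \<xi> l
    by (rule limI) (use that in simp)
  have up: "lim (\<lambda>n. ereal (?H \<xi> n / real n)) \<le> ereal h" if \<xi>: "simple_function \<mu> \<xi>" for \<xi> :: "_ \<Rightarrow> nat"
  proof -
    obtain l where l: "(\<lambda>n. ?H \<xi> n / real n) \<longlonglongrightarrow> l" using conv[OF \<xi>] by blast
    have "l \<le> h + e" if e: "0 < e" for e
    proof -
      obtain K where K: "\<And>n. ?H \<xi> n \<le> partition_entropy \<mu> (word n) + K + real n * e"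
        using itinerary_entropy_bound[OF \<xi> e] by blast
      have "(\<lambda>n. partition_entropy \<mu> (word n) / real n + K / real n + e) \<longlonglongrightarrow> h + 0 + e"
        by (intro tendsto_add h(1) tendsto_const tendsto_divide_0[OF tendsto_const]
            filterlim_at_top_imp_at_infinity filterlim_real_sequentially)
      moreover have "\<exists>N. \<forall>n\<ge>N. ?H \<xi> n / real n \<le> partition_entropy \<mu> (word n) / real n + K / real n + e"
      proof (intro exI[of _ 1] allI impI)
        fix n :: nat assume "1 \<le> n"
        then show "?H \<xi> n / real n \<le> partition_entropy \<mu> (word n) / real n + K / real n + e"
          using divide_right_mono[OF K[of n], of "real n"] by (simp add: add_divide_distrib)
      qed
      ultimately show ?thesis using LIMSEQ_le[OF l] by simp
    qed
    then have "l \<le> h" by (rule field_le_epsilon)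
    then show ?thesis using lim_eq[OF l] by simp
  qed
  obtain c :: "'s \<Rightarrow> nat" where c: "inj c" using finite_imp_inj_to_nat_seg[OF finite] by blast
  define \<xi> where "\<xi> = (\<lambda>x :: nat \<Rightarrow> 's. c (x 0))"
  have \<xi>: "simple_function \<mu> \<xi>"
  proof (rule depends_on_simple[of 1])
    show "depends_on A 1 \<xi>" by (auto simp: depends_on_def \<xi>_def agree_def)
  qed
  obtain l where l: "(\<lambda>n. ?H \<xi> n / real n) \<longlonglongrightarrow> l" using conv[OF \<xi>] by blast
  have "h \<le> l"
  proof (rule LIMSEQ_le[OF h(1) l], intro exI allI impI divide_right_mono)
    fix n
    show "partition_entropy \<mu> (word n) \<le> ?H \<xi> n"
      by (rule partition_entropy_factor[OF simple_itinerary[OF \<xi>], where F = "map (inv c)"])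
        (simp add: itinerary_def word_def \<xi>_def shift_map_funpow_apply inv_f_f[OF c])
  qed simp
  have "ks_entropy \<mu> shift_map = ereal h"
    unfolding ks_entropy_def
  proof (rule antisym)
    show "(SUP \<xi>\<in>{\<xi> :: _ \<Rightarrow> nat. simple_function \<mu> \<xi>}. lim (\<lambda>n. ereal (?H \<xi> n / real n))) \<le> ereal h"
      using up by (intro SUP_least) auto
    have "ereal h \<le> lim (\<lambda>n. ereal (?H \<xi> n / real n))" using lim_eq[OF l] \<open>h \<le> l\<close> by simp
    also have "\<dots> \<le> (SUP \<xi>\<in>{\<xi> :: _ \<Rightarrow> nat. simple_function \<mu> \<xi>}. lim (\<lambda>n. ereal (?H \<xi> n / real n)))"
      using \<xi> by (intro SUP_upper) auto
    finally show "ereal h \<le> (SUP \<xi>\<in>{\<xi> :: _ \<Rightarrow> nat. simple_function \<mu> \<xi>}. lim (\<lambda>n. ereal (?H \<xi> n / real n)))" .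
  qed
  then show ?thesis using that h by blast
qed

end

section \<open>Uniqueness of the measure of maximal free energy\<close>

definition ucont :: "nat ^ 's ^ 's \<Rightarrow> ((nat \<Rightarrow> 's) \<Rightarrow> real) \<Rightarrow> bool" where
  "ucont A f \<longleftrightarrow> (\<forall>e>0. \<exists>n. \<forall>x\<in>subshift A. \<forall>y\<in>subshift A. agree n x y \<longrightarrow> \<bar>f x - f y\<bar> < e)"

lemma ucont_approx:
  fixes A :: "nat ^ 's::finite ^ 's"
  assumes "ucont A f" "0 < e"
  obtains n \<psi> where "depends_on A n \<psi>" "\<And>x. x \<in> subshift A \<Longrightarrow> \<bar>f x - \<psi> x\<bar> < e"
proof -
  obtain n where n: "\<And>x y. x \<in> subshift A \<Longrightarrow> y \<in> subshift A \<Longrightarrow> agree n x y \<Longrightarrow> \<bar>f x - f y\<bar> < e"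
    using assms unfolding ucont_def by blast
  define rep where "rep w = (SOME y. y \<in> subshift A \<and> word n y = w)" for w
  have rep: "rep (word n x) \<in> subshift A \<and> word n (rep (word n x)) = word n x" if "x \<in> subshift A" for x
    unfolding rep_def by (rule someI[of _ x]) (simp add: that)
  show ?thesis
  proof (rule that[of n "\<lambda>x. f (rep (word n x))"])
    show "depends_on A n (\<lambda>x. f (rep (word n x)))"
      by (rule depends_on_compose[OF depends_on_word])
    fix x assume x: "x \<in> subshift A"
    have "agree n x (rep (word n x))" using rep[OF x] by (simp add: agree_commute flip: word_eq_iff)
    then show "\<bar>f x - f (rep (word n x))\<bar> < e" using n x rep[OF x] by blast
  qed
qed

lemma ucont_exp_bound:
  assumes "0 < \<beta>" "\<beta> < 1"
    and "\<And>k x y. 1 \<le> k \<Longrightarrow> x \<in> subshift A \<Longrightarrow> y \<in> subshift A \<Longrightarrow> agree k x y \<Longrightarrow> f x - f y \<le> c * \<beta> ^ k"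
  shows "ucont A f"
  unfolding ucont_def
proof (intro allI impI)
  fix e :: real assume e: "0 < e"
  obtain n where n: "\<beta> ^ n < e / (\<bar>c\<bar> + 1)" using real_arch_pow_inv[of "e / (\<bar>c\<bar> + 1)" \<beta>] assms e by auto
  have "c * \<beta> ^ Suc n < e"
  proof -
    have "c * \<beta> ^ Suc n \<le> (\<bar>c\<bar> + 1) * \<beta> ^ n"
      using assms by (intro mult_mono power_decreasing) auto
    also have "\<dots> < e" using n by (simp add: field_simps)
    finally show ?thesis .
  qed
  then have "\<bar>f x - f y\<bar> < e" if "x \<in> subshift A" "y \<in> subshift A" "agree (Suc n) x y" for x y
    using assms(3)[of "Suc n" x y] assms(3)[of "Suc n" y x] that agree_sym[OF that(3)] by fastforce
  then show "\<exists>n. \<forall>x\<in>subshift A. \<forall>y\<in>subshift A. agree n x y \<longrightarrow> \<bar>f x - f y\<bar> < e" by blast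
qed

context clopen_prob
begin

lemma ucont_bounded:
  assumes "ucont A f" obtains F where "0 < F" "\<And>x. x \<in> X \<Longrightarrow> \<bar>f x\<bar> \<le> F"
proof -
  obtain n \<psi> where \<psi>: "depends_on A n \<psi>" "\<And>x. x \<in> X \<Longrightarrow> \<bar>f x - \<psi> x\<bar> < 1"
    using ucont_approx[OF assms, of 1] by auto
  obtain K where K: "\<And>x. x \<in> X \<Longrightarrow> \<bar>\<psi> x\<bar> \<le> K"
    using finite_imp_bounded[OF depends_on_finite_range[OF \<psi>(1)]] unfolding bounded_iff by auto
  have "\<bar>f x\<bar> \<le> \<bar>K\<bar> + 1" if "x \<in> X" for x using K[OF that] \<psi>(2)[OF that] by linarith
  then show ?thesis by (intro that[of "\<bar>K\<bar> + 1"]) auto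
qed

lemma ucont_measurable: assumes "ucont A f" shows "f \<in> borel_measurable \<mu>"
proof -
  have "\<exists>n \<psi>. depends_on A n \<psi> \<and> (\<forall>x\<in>X. \<bar>f x - \<psi> x\<bar> < 1 / (real j + 1))" for j
    using ucont_approx[OF assms, of "1 / (real j + 1)"] by (metis add_pos_nonneg divide_pos_pos of_nat_0_le_iff zero_less_one add.commute)
  then obtain n \<psi> where \<psi>: "\<And>j. depends_on A (n j) (\<psi> j)" "\<And>j x. x \<in> X \<Longrightarrow> \<bar>f x - \<psi> j x\<bar> < 1 / (real j + 1)"
    by metis
  show ?thesis
  proof (rule borel_measurable_LIMSEQ_real[of \<mu> \<psi>])
    show "\<psi> j \<in> borel_measurable \<mu>" for j
      by (rule borel_measurable_simple_function[OF depends_on_simple[OF \<psi>(1)]])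
    fix x assume "x \<in> space \<mu>"
    then have x: "x \<in> X" by (simp add: space_eq)
    have "(\<lambda>j. 1 / (real j + 1)) \<longlonglongrightarrow> 0" using LIMSEQ_inverse_real_of_nat by (simp add: inverse_eq_divide add.commute)
    then have "(\<lambda>j. \<psi> j x - f x) \<longlonglongrightarrow> 0"
      by (rule Lim_null_comparison[rotated]) (use \<psi>(2)[OF x] in \<open>auto intro!: always_eventually less_imp_le simp: abs_minus_commute\<close>)
    then show "(\<lambda>j. \<psi> j x) \<longlonglongrightarrow> f x" by (simp add: LIM_zero_iff)
  qed
qed

lemma ucont_integrable: assumes "ucont A f" shows "integrable \<mu> f"
proof -
  obtain F where "\<And>x. x \<in> X \<Longrightarrow> \<bar>f x\<bar> \<le> F" using ucont_bounded[OF assms] by metis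
  then show ?thesis
    by (intro integrable_const_bound[where B = F] ucont_measurable assms AE_I2) (simp add: space_eq)
qed

lemma integral_le_bound:
  assumes "integrable \<mu> f" "integrable \<mu> g" "\<And>x. x \<in> X \<Longrightarrow> f x \<le> (g x :: real)"
  shows "(\<integral>x. f x \<partial>\<mu>) \<le> (\<integral>x. g x \<partial>\<mu>)"
  by (rule integral_mono[OF assms(1,2)]) (simp add: assms(3) space_eq)

end

context invariant_measure
begin

lemma integral_shift:
  fixes f :: "(nat \<Rightarrow> 's) \<Rightarrow> real"
  assumes "f \<in> borel_measurable \<mu>"
  shows "(\<integral>x. f ((shift_map ^^ n) x) \<partial>\<mu>) = (\<integral>x. f x \<partial>\<mu>)"
proof -
  have "distr \<mu> \<mu> (shift_map ^^ n) = \<mu>"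
  proof (rule measure_eqI)
    fix V assume "V \<in> sets (distr \<mu> \<mu> (shift_map ^^ n))"
    then have "V \<in> sets \<mu>" by simp
    then show "emeasure (distr \<mu> \<mu> (shift_map ^^ n)) V = emeasure \<mu> V"
      using invariant_pow[of V n] by (simp add: emeasure_distr emeasure_eq_measure preim_eq)
  qed simp
  then show ?thesis using integral_distr[OF shift_pow_measurable assms, of n] by simp
qed

lemma integrable_shift:
  fixes f :: "(nat \<Rightarrow> 's) \<Rightarrow> real"
  assumes "ucont A f" shows "integrable \<mu> (\<lambda>x. f ((shift_map ^^ n) x))"
proof -
  obtain F where "\<And>x. x \<in> X \<Longrightarrow> \<bar>f x\<bar> \<le> F" using ucont_bounded[OF assms] by metis
  then show ?thesis
    by (intro integrable_const_bound[where B = F] AE_I2 measurable_compose[OF shift_pow_measurable ucont_measurable[OF assms]])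
      (auto simp: space_eq)
qed

lemma integral_birkhoff_sum:
  assumes "ucont A f"
  shows "integrable \<mu> (birkhoff_sum f n)" "(\<integral>x. birkhoff_sum f n x \<partial>\<mu>) = real n * (\<integral>x. f x \<partial>\<mu>)"
  unfolding birkhoff_sum_def
  using integrable_shift[OF assms] integral_shift[OF ucont_measurable[OF assms]]
  by (auto simp: Bochner_Integration.integral_sum)

end

lemma ucont_depends_on: "depends_on A n \<psi> \<Longrightarrow> ucont A \<psi>"
  unfolding ucont_def
proof (intro allI impI exI[of _ n] ballI)
  fix e :: real and x y
  assume "0 < e" "depends_on A n \<psi>" "x \<in> subshift A" "y \<in> subshift A" "agree n x y"
  then have "\<psi> x = \<psi> y" by (intro depends_onD)
  then show "\<bar>\<psi> x - \<psi> y\<bar> < e" using \<open>0 < e\<close> by simp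
qed

context gibbs_measure
begin

lemma ucont_ln_G: "ucont A (\<lambda>x. ln (G x))"
proof (rule ucont_exp_bound[OF beta])
  fix k x y assume xy: "x \<in> X" "y \<in> X" "agree k x y"
  have "ln (G x) \<le> ln (exp (c * \<beta> ^ k) * G y)"
    using G_var[OF xy] G_pos xy by simp
  also have "\<dots> = c * \<beta> ^ k + ln (G y)" using G_pos[OF xy(2)] by (simp add: ln_mult)
  finally show "ln (G x) - ln (G y) \<le> c * \<beta> ^ k" by simp
qed

lemma ln_Gprod: "z \<in> X \<Longrightarrow> ln (Gprod n z) = birkhoff_sum (\<lambda>x. ln (G x)) n z"
  unfolding Gprod_def birkhoff_sum_def
  by (intro ln_prod less_imp_neq[OF G_pos, symmetric]) auto

definition word_mass :: "nat \<Rightarrow> 's list \<Rightarrow> real" where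
  "word_mass n w = measure \<mu> {x \<in> X. word n x = w}"

lemma cylinder_eq_word: "cylinder A z n = {x \<in> X. word n x = word n z}"
  by (auto simp: mem_cylinder word_eq_iff)

lemma word_mass_pos: "z \<in> X \<Longrightarrow> 0 < word_mass n (word n z)"
  unfolding word_mass_def cylinder_eq_word[symmetric]
  using gibbs_full_support[OF determined_cylinder] mem_cylinder_self by blast

text \<open>By the Gibbs property the logarithm of the mass of a cylinder differs from a Birkhoff sum of
  \<open>ln G\<close> by a bounded amount; this is integrated with respect to \<open>\<nu>\<close>.\<close>

lemma cross_entropy:
  obtains C where "0 < C" "\<And>\<nu> n. invariant_measure A \<nu> \<Longrightarrow>
    \<bar>(\<Sum>w\<in>word (Suc n) ` X. measure \<nu> {x \<in> X. word (Suc n) x = w} * ln (word_mass (Suc n) w))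
      - real n * (\<integral>x. ln (G x) \<partial>\<nu>)\<bar> \<le> C"
proof -
  obtain C where C: "0 < C" "\<And>n z. z \<in> X \<Longrightarrow> measure \<mu> (cylinder A z (Suc n)) \<le> exp C * Gprod n z"
    "\<And>n z. z \<in> X \<Longrightarrow> exp (- C) * Gprod n z \<le> measure \<mu> (cylinder A z (Suc n))"
    using gibbs_property by metis
  show ?thesis
  proof (rule that[OF C(1)])
    fix \<nu> n assume "invariant_measure A \<nu>"
    then interpret N: invariant_measure A \<nu> .
    let ?g = "birkhoff_sum (\<lambda>x. ln (G x)) n"
    let ?f = "\<lambda>x. ln (word_mass (Suc n) (word (Suc n) x))"
    have bound: "\<bar>?f z - ?g z\<bar> \<le> C" if z: "z \<in> X" for z
    proof -
      have m: "word_mass (Suc n) (word (Suc n) z) = measure \<mu> (cylinder A z (Suc n))"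
        by (simp add: word_mass_def cylinder_eq_word)
      have "?f z \<le> ln (exp C * Gprod n z)"
        using C(2)[OF z, of n] word_mass_pos[OF z, of "Suc n"] Gprod_pos[OF z, of n] by (simp add: m)
      moreover have "ln (exp (- C) * Gprod n z) \<le> ?f z"
        using C(3)[OF z, of n] word_mass_pos[OF z, of "Suc n"] Gprod_pos[OF z, of n] by (simp add: m)
      ultimately show ?thesis using Gprod_pos[OF z, of n] by (simp add: ln_mult ln_Gprod[OF z] abs_le_iff)
    qed
    note g = N.integral_birkhoff_sum[OF ucont_ln_G, of n]
    note f = N.simple_integrable[OF N.simple_word, of "\<lambda>w. ln (word_mass (Suc n) w)" "Suc n"]
    have "\<bar>(\<integral>x. ?f x \<partial>\<nu>) - (\<integral>x. ?g x \<partial>\<nu>)\<bar> = \<bar>\<integral>x. ?f x - ?g x \<partial>\<nu>\<bar>"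
      by (simp add: Bochner_Integration.integral_diff[OF f g(1)])
    also have "\<dots> \<le> (\<integral>x. \<bar>?f x - ?g x\<bar> \<partial>\<nu>)" by (rule integral_abs_bound)
    also have "\<dots> \<le> (\<integral>x. C \<partial>\<nu>)"
      by (rule N.integral_le_bound) (use bound f g(1) in auto)
    finally have "\<bar>(\<integral>x. ?f x \<partial>\<nu>) - (\<integral>x. ?g x \<partial>\<nu>)\<bar> \<le> C" by (simp add: N.prob_space)
    moreover have "(\<integral>x. ?f x \<partial>\<nu>) = (\<Sum>w\<in>word (Suc n) ` X. measure \<nu> {x \<in> X. word (Suc n) x = w} * ln (word_mass (Suc n) w))"
      unfolding N.integral_simple[OF N.simple_word, of "\<lambda>w. ln (word_mass (Suc n) w)" "Suc n"]
      by (simp add: mult.commute)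
    ultimately show "\<bar>(\<Sum>w\<in>word (Suc n) ` X. measure \<nu> {x \<in> X. word (Suc n) x = w} * ln (word_mass (Suc n) w))
      - real n * (\<integral>x. ln (G x) \<partial>\<nu>)\<bar> \<le> C" by (simp add: g)
  qed
qed

theorem gibbs_entropy: "ks_entropy \<mu> shift_map = ereal (- (\<integral>x. ln (G x) \<partial>\<mu>))"
proof -
  interpret mixing_measure A \<mu> by (rule gibbs_mixing)
  obtain C where C: "0 < C" "\<And>\<nu> n. invariant_measure A \<nu> \<Longrightarrow>
    \<bar>(\<Sum>w\<in>word (Suc n) ` X. measure \<nu> {x \<in> X. word (Suc n) x = w} * ln (word_mass (Suc n) w))
      - real n * (\<integral>x. ln (G x) \<partial>\<nu>)\<bar> \<le> C" by (rule cross_entropy) (rule that)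
  obtain h where h: "(\<lambda>n. partition_entropy \<mu> (word n) / real n) \<longlonglongrightarrow> h" "ks_entropy \<mu> shift_map = ereal h"
    using kolmogorov_sinai by metis
  let ?I = "\<integral>x. ln (G x) \<partial>\<mu>"
  have "\<bar>partition_entropy \<mu> (word (Suc n)) + real n * ?I\<bar> \<le> C" for n
    using C(2)[OF invariant_measure_axioms, of n]
    unfolding partition_entropy_eq[OF simple_word] \<eta>_def word_mass_def sum_negf by linarith
  then have bound: "\<bar>partition_entropy \<mu> (word (Suc n)) / real (Suc n) + ?I\<bar> \<le> (C + \<bar>?I\<bar>) / real (Suc n)" for n
  proof -
    have "\<bar>partition_entropy \<mu> (word (Suc n)) + real (Suc n) * ?I\<bar> \<le> C + \<bar>?I\<bar>"
      using \<open>\<And>n. \<bar>partition_entropy \<mu> (word (Suc n)) + real n * ?I\<bar> \<le> C\<close>[of n] by (simp add: algebra_simps)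
    then have "\<bar>partition_entropy \<mu> (word (Suc n)) + real (Suc n) * ?I\<bar> / real (Suc n) \<le> (C + \<bar>?I\<bar>) / real (Suc n)"
      by (intro divide_right_mono) auto
    moreover have "\<bar>partition_entropy \<mu> (word (Suc n)) / real (Suc n) + ?I\<bar> = \<bar>partition_entropy \<mu> (word (Suc n)) + real (Suc n) * ?I\<bar> / real (Suc n)"
    proof -
      have "partition_entropy \<mu> (word (Suc n)) / real (Suc n) + ?I = (partition_entropy \<mu> (word (Suc n)) + real (Suc n) * ?I) / real (Suc n)"
        by (simp add: add_divide_distrib del: of_nat_Suc)
      then show ?thesis by (simp only: abs_divide abs_of_nat)
    qed
    ultimately show ?thesis by simp
  qed
  have "(\<lambda>n. (C + \<bar>?I\<bar>) / real (Suc n)) \<longlonglongrightarrow> 0"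
    by (rule LIMSEQ_Suc) (intro tendsto_divide_0[OF tendsto_const] filterlim_at_top_imp_at_infinity filterlim_real_sequentially)
  then have "(\<lambda>n. partition_entropy \<mu> (word (Suc n)) / real (Suc n) + ?I) \<longlonglongrightarrow> 0"
    by (rule Lim_null_comparison[rotated]) (use bound in \<open>auto intro!: always_eventually\<close>)
  moreover have "(\<lambda>n. partition_entropy \<mu> (word (Suc n)) / real (Suc n) + ?I) \<longlonglongrightarrow> h + ?I"
    by (intro tendsto_add tendsto_const LIMSEQ_Suc[OF h(1)])
  ultimately have "h + ?I = 0" using LIMSEQ_unique by blast
  then show ?thesis using h(2) by simp
qed

text \<open>The hypothesis says that the relative entropy of \<open>\<nu>\<close> with respect to
  \<open>\<mu>\<close> on words of length \<open>n\<close> stays bounded. The conclusion is the variational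
  inequality of Donsker and Varadhan for the function \<open>s 1\<^sub>E\<close>, which here is \<open>ln y
  \<le> y - 1\<close> summed over words.\<close>

lemma relative_entropy_bound:
  assumes \<nu>: "invariant_measure A \<nu>" and ge: "ereal (- (\<integral>x. ln (G x) \<partial>\<nu>)) \<le> ks_entropy \<nu> shift_map"
  obtains D where "\<And>n E s. determined A n E \<Longrightarrow> 0 < s \<Longrightarrow> s * measure \<nu> E \<le> D + exp s * measure \<mu> E"
proof -
  interpret N: invariant_measure A \<nu> by (rule \<nu>)
  obtain C where C: "0 < C" "\<And>n.
    \<bar>(\<Sum>w\<in>word (Suc n) ` X. measure \<nu> {x \<in> X. word (Suc n) x = w} * ln (word_mass (Suc n) w))
      - real n * (\<integral>x. ln (G x) \<partial>\<nu>)\<bar> \<le> C"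
    by (rule cross_entropy) (rule that, assumption, use \<nu> in blast)
  let ?I = "\<integral>x. ln (G x) \<partial>\<nu>"
  obtain h where h: "\<And>n. 1 \<le> n \<Longrightarrow> h \<le> partition_entropy \<nu> (word n) / real n" "ks_entropy \<nu> shift_map = ereal h"
    using N.kolmogorov_sinai by metis
  have hI: "- ?I \<le> h" using ge h(2) by simp
  have "s * measure \<nu> E \<le> (C + \<bar>?I\<bar>) + exp s * measure \<mu> E"
    if E: "determined A n E" and s: "0 < s" for n E s
  proof -
    let ?W = "word (Suc n) ` X"
    let ?n = "\<lambda>w. measure \<nu> {x \<in> X. word (Suc n) x = w}"
    let ?m = "word_mass (Suc n)"
    have E': "determined A (Suc n) E" by (rule determined_mono[OF E]) simp
    obtain F :: "'s list \<Rightarrow> real" where F: "\<And>x. x \<in> X \<Longrightarrow> indicator E x = F (word (Suc n) x)"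
      using depends_on_factor[OF depends_on_indicator[OF E']] by metis
    have fin: "finite ?W" by (rule finite_words)
    have nE: "(\<Sum>w\<in>?W. F w * ?n w) = measure \<nu> E"
    proof -
      have "(\<Sum>w\<in>?W. F w * ?n w) = (\<integral>x. F (word (Suc n) x) \<partial>\<nu>)" by (rule N.integral_simple[OF N.simple_word, symmetric])
      also have "\<dots> = (\<integral>x. indicator E x \<partial>\<nu>)" by (intro Bochner_Integration.integral_cong) (auto simp: F N.space_eq)
      finally show ?thesis using N.determined_sets[OF E] by simp
    qed
    interpret M: mixing_measure A \<mu> by (rule gibbs_mixing)
    have mE: "(\<Sum>w\<in>?W. exp (s * F w) * ?m w) = 1 + (exp s - 1) * measure \<mu> E"
    proof -
      have "(\<Sum>w\<in>?W. exp (s * F w) * ?m w) = (\<integral>x. exp (s * F (word (Suc n) x)) \<partial>\<mu>)"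
        unfolding word_mass_def by (rule integral_simple[OF M.simple_word, symmetric])
      also have "\<dots> = (\<integral>x. 1 + (exp s - 1) * indicator E x \<partial>\<mu>)"
        by (intro Bochner_Integration.integral_cong) (auto simp: space_eq indicator_def simp flip: F)
      finally show ?thesis using determined_sets[OF E] by (simp add: prob_space emeasure_eq_measure)
    qed
    have n1: "(\<Sum>w\<in>?W. ?n w) = 1"
    proof -
      have "(\<Sum>w\<in>?W. 1 * ?n w) = (\<integral>x. 1 \<partial>\<nu>)"
        by (rule N.integral_simple[OF N.simple_word, of "\<lambda>_. 1" "Suc n", symmetric])
      then show ?thesis by (simp add: N.prob_space)
    qed
    have pt: "?n w * (s * F w) + ?n w * ln (?m w) + \<eta> (?n w) \<le> exp (s * F w) * ?m w - ?n w" if w: "w \<in> ?W" for w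
    proof (cases "?n w = 0")
      case True
      have "0 < ?m w" using w word_mass_pos by auto
      then show ?thesis using True by (simp add: \<eta>_def)
    next
      case False
      have m: "0 < ?m w" using w word_mass_pos by auto
      have n: "0 < ?n w" using False by (simp add: zero_less_measure_iff)
      have "ln (exp (s * F w) * ?m w / ?n w) \<le> exp (s * F w) * ?m w / ?n w - 1"
        using m n by (intro ln_le_minus_one) auto
      then have "s * F w + ln (?m w) - ln (?n w) \<le> exp (s * F w) * ?m w / ?n w - 1"
        using m n by (simp add: ln_div ln_mult)
      then have "?n w * (s * F w + ln (?m w) - ln (?n w)) \<le> ?n w * (exp (s * F w) * ?m w / ?n w - 1)"
        using n by (intro mult_left_mono) auto
      also have "\<dots> = exp (s * F w) * ?m w - ?n w" using n by (simp add: field_simps)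
      finally show ?thesis by (simp add: \<eta>_def algebra_simps)
    qed
    have "(\<Sum>w\<in>?W. ?n w * (s * F w) + ?n w * ln (?m w) + \<eta> (?n w)) \<le> (\<Sum>w\<in>?W. exp (s * F w) * ?m w - ?n w)"
      by (rule sum_mono[OF pt])
    then have main: "s * measure \<nu> E + (\<Sum>w\<in>?W. ?n w * ln (?m w)) + partition_entropy \<nu> (word (Suc n))
        \<le> (exp s - 1) * measure \<mu> E"
      unfolding N.partition_entropy_eq[OF N.simple_word] sum.distrib sum_subtractf mE n1 nE[symmetric] sum_distrib_left
      by (simp add: mult_ac)
    have "h * real (Suc n) \<le> partition_entropy \<nu> (word (Suc n))"
      using h(1)[of "Suc n"] by (simp add: field_simps)
    moreover have "- ?I * real (Suc n) \<le> h * real (Suc n)" using hI by (intro mult_right_mono) auto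
    ultimately have "- ?I * real (Suc n) \<le> partition_entropy \<nu> (word (Suc n))" by linarith
    moreover have "real n * ?I - C \<le> (\<Sum>w\<in>?W. ?n w * ln (?m w))" using C(2)[of n] by (simp add: abs_le_iff)
    ultimately have "s * measure \<nu> E \<le> C + ?I + (exp s - 1) * measure \<mu> E" using main by (simp add: algebra_simps)
    then have "s * measure \<nu> E \<le> C + ?I + exp s * measure \<mu> E - measure \<mu> E" by (simp add: algebra_simps)
    then show ?thesis using measure_nonneg[of \<mu> E] abs_ge_self[of ?I] by linarith
  qed
  then show ?thesis using that by blast
qed

text \<open>The event that the frequency of visits to \<open>U\<close> exceeds \<open>\<mu> U\<close> is
  exponentially unlikely for \<open>\<mu>\<close>, hence unlikely for \<open>\<nu>\<close> by the relative
  entropy bound. The \<open>\<nu>\<close>-mean of the frequency is \<open>\<nu> U\<close>, so \<open>\<nu> U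
  \<le> \<mu> U\<close>; complements give equality.\<close>

theorem gibbs_unique:
  assumes \<nu>: "invariant_measure A \<nu>" and ge: "ereal (- (\<integral>x. ln (G x) \<partial>\<nu>)) \<le> ks_entropy \<nu> shift_map"
  shows "\<nu> = \<mu>"
proof -
  interpret N: invariant_measure A \<nu> by (rule \<nu>)
  interpret M: mixing_measure A \<mu> by (rule gibbs_mixing)
  obtain D where D: "\<And>n E s. determined A n E \<Longrightarrow> 0 < s \<Longrightarrow> s * measure \<nu> E \<le> D + exp s * measure \<mu> E"
    using relative_entropy_bound[OF \<nu> ge] by metis
  have le: "measure \<nu> U \<le> measure \<mu> U" if U: "determined A k U" for k U
  proof (rule field_le_epsilon)
    fix e :: real assume e: "0 < e"
    let ?\<psi> = "indicator U :: _ \<Rightarrow> real"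
    have \<psi>: "depends_on A k ?\<psi>" by (rule depends_on_indicator[OF U])
    have E\<psi>: "(\<integral>x. ?\<psi> x \<partial>\<mu>) = measure \<mu> U" "(\<integral>x. ?\<psi> x \<partial>\<nu>) = measure \<nu> U"
      using determined_sets[OF U] N.determined_sets[OF U] by simp_all
    obtain C \<delta> where C: "0 < C" "0 < \<delta>"
      "\<And>M. measure \<mu> {x \<in> X. real M * (measure \<mu> U + e / 2) \<le> birkhoff_sum ?\<psi> M x} \<le> C * exp (- \<delta> * real M)"
      using M.large_deviation[OF \<psi>, of "e / 2"] e unfolding E\<psi> by auto
    define s where "s = 4 * (\<bar>D\<bar> + 1) / e"
    have s: "0 < s" using e by (simp add: s_def)
    have Ds: "D / s \<le> e / 4"
    proof -
      have "D / (\<bar>D\<bar> + 1) \<le> 1" using abs_ge_self[of D] abs_ge_zero[of D]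
        by (intro divide_le_eq_1_pos[THEN iffD2]) linarith+
      then have "(e / 4) * (D / (\<bar>D\<bar> + 1)) \<le> e / 4 * 1" using e by (intro mult_left_mono) auto
      moreover have "D / s = (e / 4) * (D / (\<bar>D\<bar> + 1))" by (simp add: s_def)
      ultimately show ?thesis by linarith
    qed
    have "(\<lambda>M. exp s / s * (C * exp (- \<delta> * real M))) \<longlonglongrightarrow> exp s / s * (C * 0)"
    proof (intro tendsto_mult tendsto_const)
      have "(\<lambda>M. exp (- \<delta>) ^ M) \<longlonglongrightarrow> 0" using C by (intro LIMSEQ_power_zero) auto
      then show "(\<lambda>M. exp (- \<delta> * real M)) \<longlonglongrightarrow> 0"
        by (simp add: mult.commute flip: exp_of_nat_mult)
    qed
    then have "\<forall>\<^sub>F M in sequentially. exp s / s * (C * exp (- \<delta> * real M)) < e / 4"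
      using e by (intro order_tendstoD(2)[where y = 0]) auto
    then obtain M0 where "\<And>M. M0 \<le> M \<Longrightarrow> exp s / s * (C * exp (- \<delta> * real M)) < e / 4"
      by (auto simp: eventually_sequentially)
    then obtain M where M: "1 \<le> M" "exp s / s * (C * exp (- \<delta> * real M)) < e / 4"
      by (metis max.cobounded1 max.cobounded2)
    let ?E = "{x \<in> X. real M * (measure \<mu> U + e / 2) \<le> birkhoff_sum ?\<psi> M x}"
    have dep: "depends_on A (M + k) (birkhoff_sum ?\<psi> M)"
      unfolding depends_on_def
    proof (intro ballI impI)
      fix x y assume xy: "x \<in> X" "y \<in> X" "agree (M + k) x y"
      have "?\<psi> ((shift_map ^^ i) x) = ?\<psi> ((shift_map ^^ i) y)" if "i < M" for i
        using xy that by (intro depends_onD[OF \<psi>] agree_shift agree_mono[OF xy(3)]) auto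
      then show "birkhoff_sum ?\<psi> M x = birkhoff_sum ?\<psi> M y" by (simp add: birkhoff_sum_def)
    qed
    have dE: "determined A (M + k) ?E"
      using depends_on_vimage[OF dep, of "{real M * (measure \<mu> U + e / 2)..}"] by simp
    have "s * measure \<nu> ?E \<le> D + exp s * (C * exp (- \<delta> * real M))"
    proof -
      have "exp s * measure \<mu> ?E \<le> exp s * (C * exp (- \<delta> * real M))" by (intro mult_left_mono C(3)) simp
      then show ?thesis using D[OF dE s] by linarith
    qed
    then have "measure \<nu> ?E \<le> D / s + exp s / s * (C * exp (- \<delta> * real M))"
      using s by (simp add: field_simps)
    then have \<nu>E: "measure \<nu> ?E \<le> e / 2" using Ds M(2) by linarith
    have "real M * measure \<nu> U = (\<integral>x. birkhoff_sum ?\<psi> M x \<partial>\<nu>)"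
      using N.integral_birkhoff_sum(2)[OF ucont_depends_on[OF \<psi>], of M] by (simp only: E\<psi>)
    also have "\<dots> \<le> (\<integral>x. real M * (measure \<mu> U + e / 2) + real M * indicator ?E x \<partial>\<nu>)"
    proof (rule N.integral_le_bound)
      show "integrable \<nu> (birkhoff_sum ?\<psi> M)" by (rule N.depends_on_integrable[OF dep])
      show "integrable \<nu> (\<lambda>x. real M * (measure \<mu> U + e / 2) + real M * indicator ?E x)"
        using N.determined_sets[OF dE] by (simp add: N.emeasure_eq_measure)
      fix x assume x: "x \<in> X"
      have "birkhoff_sum ?\<psi> M x \<le> (\<Sum>i<M. 1)"
        unfolding birkhoff_sum_def by (intro sum_mono) (simp add: indicator_def)
      moreover have "0 \<le> real M * (measure \<mu> U + e / 2)" using e by simp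
      ultimately show "birkhoff_sum ?\<psi> M x \<le> real M * (measure \<mu> U + e / 2) + real M * indicator ?E x"
        using x by (cases "x \<in> ?E") auto
    qed
    also have "\<dots> = real M * (measure \<mu> U + e / 2) + real M * measure \<nu> ?E"
      using N.determined_sets[OF dE] by (simp add: N.prob_space N.emeasure_eq_measure)
    also have "\<dots> \<le> real M * (measure \<mu> U + e / 2) + real M * (e / 2)"
      using \<nu>E by (intro add_left_mono mult_left_mono) auto
    finally have "real M * measure \<nu> U \<le> real M * (measure \<mu> U + e)" by (simp add: algebra_simps)
    then show "measure \<nu> U \<le> measure \<mu> U + e" using M(1) by simp
  qed
  show ?thesis
  proof (rule N.eq_if_eq_on_clopens[OF clopen_prob_axioms])
    fix n U assume U: "determined A n U"
    have "measure \<nu> (X - U) = 1 - measure \<nu> U" "measure \<mu> (X - U) = 1 - measure \<mu> U"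
      using N.prob_compl[OF N.determined_sets[OF U]] prob_compl[OF determined_sets[OF U]]
      by (simp_all add: N.space_eq space_eq)
    then show "measure \<nu> U = measure \<mu> U"
      using le[OF U] le[OF determined_Diff[OF determined_space U]] by linarith
  qed
qed

end

section \<open>Equilibrium states are Gibbs measures\<close>

lemma invariant_prob_iff:
  fixes A :: "nat ^ 's::finite ^ 's"
  assumes "aperiodic_subshift A" "0 < \<theta>" "\<theta> < 1"
  shows "invariant_prob \<theta> A \<mu> \<longleftrightarrow> invariant_measure A \<mu>"
proof
  assume \<mu>: "invariant_prob \<theta> A \<mu>"
  then have "clopen_prob A \<mu>"
    by (intro clopen_prob.intro clopen_prob_axioms.intro assms)
      (auto simp: invariant_prob_def sets_borel_subshift[OF assms(2,3)])
  then interpret clopen_prob A \<mu> .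
  show "invariant_measure A \<mu>"
  proof
    fix V assume "V \<in> sets \<mu>"
    then have "emeasure \<mu> (shift_map -` V \<inter> space \<mu>) = emeasure \<mu> V"
      using \<mu> by (simp add: invariant_prob_def)
    then show "measure \<mu> (preim A 1 V) = measure \<mu> V" by (simp add: preim_eq measure_def)
  qed
next
  assume "invariant_measure A \<mu>"
  then interpret invariant_measure A \<mu> .
  show "invariant_prob \<theta> A \<mu>"
    unfolding invariant_prob_def
  proof (intro conjI ballI)
    show "sets \<mu> = sets (borel_subshift \<theta> A)" by (simp add: sets_eq sets_borel_subshift[OF assms(2,3)])
    show "prob_space \<mu>" by (rule prob_space_axioms)
    fix V assume "V \<in> sets \<mu>"
    then show "emeasure \<mu> (shift_map -` V \<inter> space \<mu>) = emeasure \<mu> V"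
      using invariant[of V] by (simp add: preim_eq emeasure_eq_measure)
  qed
qed

text \<open>The functions \<open>ln G\<close> and \<open>\<phi> - ln lam\<close> differ by a coboundary, which
  has integral zero with respect to invariant measures and telescopes along periodic orbits.\<close>

theorem equilibrium_gibbs:
  fixes A :: "nat ^ 's::finite ^ 's"
  assumes ap: "aperiodic_01_matrix A" and \<theta>: "0 < \<theta>" "\<theta> < 1"
    and \<phi>: "Hoelder_on (subshift_metric \<theta> A) \<phi>" and \<mu>: "equilibrium_state \<theta> A \<phi> \<mu>"
  obtains G \<beta> c where "gibbs_measure A G \<beta> c \<mu>"
    "\<And>z p. z \<in> subshift A \<Longrightarrow> (shift_map ^^ p) z = z \<Longrightarrow>
      (\<Prod>k<p. G ((shift_map ^^ k) z)) = exp ((\<Sum>k<p. \<phi> ((shift_map ^^ k) z)) - real p * pressure \<phi> \<mu>)"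
proof -
  have inv\<mu>: "invariant_prob \<theta> A \<mu>" using \<mu> by (simp add: equilibrium_state_def)
  have ne: "subshift A \<noteq> {}"
  proof
    assume "subshift A = {}"
    moreover have "sets \<mu> = sigma_sets (subshift A) (clopens A)" and "prob_space \<mu>"
      using inv\<mu> by (auto simp: invariant_prob_def sets_borel_subshift[OF \<theta>])
    moreover have "clopens A \<subseteq> Pow (subshift A)" by (auto simp: clopens_def determined_def)
    ultimately have "space \<mu> \<subseteq> {}"
      using sigma_sets_into_sp[of "clopens A" "subshift A" "space \<mu>"] sets.top[of \<mu>] by simp
    then show False using prob_space.not_empty[OF \<open>prob_space \<mu>\<close>] by simp
  qed
  have sub: "aperiodic_subshift A" by unfold_locales (rule ap, rule ne)
  interpret aperiodic_subshift A by (rule sub)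
  interpret \<mu>: invariant_measure A \<mu> using inv\<mu> invariant_prob_iff[OF sub \<theta>] by simp

  obtain \<alpha> C0 where \<alpha>: "0 < \<alpha>"
    and hoelder: "\<And>x y. x \<in> X \<Longrightarrow> y \<in> X \<Longrightarrow> \<bar>\<phi> x - \<phi> y\<bar> \<le> C0 * d_theta \<theta> x y powr \<alpha>"
    using \<phi> unfolding Hoelder_on_def mspace_subshift_metric[OF \<theta>] mdist_subshift_metric[OF \<theta>] by blast
  define \<beta> where "\<beta> = \<theta> powr \<alpha>"
  have \<beta>: "0 < \<beta>" "\<beta> < 1" using \<theta> \<alpha> powr_less_mono2[of \<alpha> \<theta> 1] by (auto simp: \<beta>_def)
  define C where "C = \<bar>C0\<bar>"
  have C: "0 \<le> C" by (simp add: C_def)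
  have \<phi>_var: "\<phi> x - \<phi> y \<le> C * \<beta> ^ k" if "x \<in> X" "y \<in> X" "agree k x y" for x y k
  proof -
    have d: "0 \<le> d_theta \<theta> x y" using \<theta> by (simp add: d_theta_def)
    have "\<phi> x - \<phi> y \<le> C0 * d_theta \<theta> x y powr \<alpha>" using hoelder[OF that(1,2)] by simp
    also have "\<dots> \<le> C * d_theta \<theta> x y powr \<alpha>" by (intro mult_right_mono) (auto simp: C_def)
    also have "\<dots> \<le> C * (\<theta> ^ k) powr \<alpha>"
      using d_theta_le[OF \<theta> that(3)] d \<alpha> C by (intro mult_left_mono powr_mono2) auto
    also have "(\<theta> ^ k) powr \<alpha> = \<beta> ^ k"
    proof -
      have "(\<theta> ^ k) powr \<alpha> = (\<theta> powr real k) powr \<alpha>" using \<theta> by (simp add: powr_realpow)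
      also have "\<dots> = (\<theta> powr \<alpha>) powr real k" by (simp add: powr_powr mult.commute)
      also have "\<dots> = \<beta> ^ k" using \<beta> by (simp add: \<beta>_def powr_realpow)
      finally show ?thesis .
    qed
    finally show ?thesis .
  qed
  interpret P: transfer_operator A "\<lambda>x. exp (\<phi> x)" \<beta> C
  proof
    fix x y k assume "x \<in> X" "y \<in> X" "agree k x y"
    then have "exp (\<phi> x) \<le> exp (C * \<beta> ^ k + \<phi> y)" using \<phi>_var[of x y k] by simp
    then show "exp (\<phi> x) \<le> exp (C * \<beta> ^ k) * exp (\<phi> y)" by (simp add: exp_add)
  qed (use \<beta> C in auto)
  obtain lam h a M where lam: "0 < lam" and h_cone: "P.cone P.B 1 h" and a: "0 < a"
    and h_ge: "\<And>x. x \<in> X \<Longrightarrow> a \<le> h x" and h_le: "\<And>x. x \<in> X \<Longrightarrow> h x \<le> M"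
    and Lh: "\<And>x. x \<in> X \<Longrightarrow> P.L h x = lam * h x"
    by (rule P.eigenfunction) (rule that)
  have h_pos: "0 < h x" if "x \<in> X" for x using h_ge[OF that] a by simp
  have aM: "a \<le> M" using ne h_ge h_le by (meson ex_in_conv order_trans)
  \<comment> \<open>The second summand covers points without a common first letter.\<close>
  define H where "H = P.B + ln (M / a)"
  have lnMa: "0 \<le> ln (M / a)" using aM a by simp
  have H0: "0 \<le> H" "P.B \<le> H" "ln (M / a) \<le> H" using P.B_nonneg lnMa by (auto simp: H_def)
  have h_var: "h x \<le> exp (H * \<beta> ^ k) * h y" if xy: "x \<in> X" "y \<in> X" "agree k x y" for x y k
  proof (cases "k = 0")
    case True
    have "h x \<le> M" by (rule h_le[OF xy(1)])
    also have "\<dots> = exp (ln (M / a)) * a" using a aM by simp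
    also have "\<dots> \<le> exp H * h y" using H0 h_ge[OF xy(2)] a by (intro mult_mono) auto
    finally show ?thesis using True by simp
  next
    case False
    then have "h x \<le> exp (P.B * \<beta> ^ k) * h y" using xy by (intro P.coneD[OF h_cone]) auto
    also have "\<dots> \<le> exp (H * \<beta> ^ k) * h y"
      using H0 \<beta> h_pos[OF xy(2)] by (intro mult_right_mono) (auto intro: mult_right_mono)
    finally show ?thesis .
  qed
  define G where "G x = exp (\<phi> x) * h x / (lam * h (shift_map x))" for x
  define c where "c = C + H + H / \<beta>"
  have G_pos: "0 < G x" if "x \<in> X" for x
    using that lam h_pos[OF that] h_pos[of "shift_map x"] by (auto simp: G_def)
  have top: "transfer_operator A G \<beta> c"
  proof
    show "0 \<le> c" using C H0 \<beta> by (simp add: c_def)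
    show "0 < G x" if "x \<in> X" for x by (rule G_pos[OF that])
    fix x y k assume xy: "x \<in> X" "y \<in> X" "agree k x y"
    have 1: "exp (\<phi> x) \<le> exp (C * \<beta> ^ k) * exp (\<phi> y)" using xy by (rule P.G_var)
    have 2: "h x \<le> exp (H * \<beta> ^ k) * h y" by (rule h_var[OF xy])
    have 3: "h (shift_map y) \<le> exp (H / \<beta> * \<beta> ^ k) * h (shift_map x)"
    proof (cases k)
      case 0
      have "h (shift_map y) \<le> exp (H * \<beta> ^ 0) * h (shift_map x)" using xy by (intro h_var) auto
      also have "\<dots> \<le> exp (H / \<beta> * \<beta> ^ k) * h (shift_map x)"
      proof (intro mult_right_mono)
        have "H \<le> H / \<beta>" using H0 \<beta> by (simp add: field_simps mult_left_le)
        then show "exp (H * \<beta> ^ 0) \<le> exp (H / \<beta> * \<beta> ^ k)" using 0 by simp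
        show "0 \<le> h (shift_map x)" using h_pos[of "shift_map x"] xy by auto
      qed
      finally show ?thesis .
    next
      case (Suc j)
      have "agree j ((shift_map ^^ 1) y) ((shift_map ^^ 1) x)"
        using xy(3) Suc by (intro agree_shift) (simp add: agree_commute)
      then have "h (shift_map y) \<le> exp (H * \<beta> ^ j) * h (shift_map x)"
        using xy by (intro h_var) auto
      then show ?thesis using \<beta> Suc by simp
    qed
    have pos: "0 < h (shift_map x)" "0 < h (shift_map y)" using h_pos xy by auto
    have "G x = (exp (\<phi> x) * h x) / (lam * h (shift_map x))" by (simp add: G_def)
    also have "\<dots> \<le> ((exp (C * \<beta> ^ k) * exp (\<phi> y)) * (exp (H * \<beta> ^ k) * h y)) / (lam * h (shift_map x))"
      using 1 2 lam pos h_pos[OF xy(1)] by (intro divide_right_mono mult_mono) auto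
    also have "\<dots> \<le> ((exp (C * \<beta> ^ k) * exp (\<phi> y)) * (exp (H * \<beta> ^ k) * h y)) * (exp (H / \<beta> * \<beta> ^ k) / (lam * h (shift_map y)))"
    proof -
      have "1 / (lam * h (shift_map x)) \<le> exp (H / \<beta> * \<beta> ^ k) / (lam * h (shift_map y))"
        using 3 lam pos by (simp add: field_simps)
      from mult_left_mono[OF this, of "(exp (C * \<beta> ^ k) * exp (\<phi> y)) * (exp (H * \<beta> ^ k) * h y)"]
      show ?thesis using h_pos[OF xy(2)] by simp
    qed
    also have "\<dots> = exp (c * \<beta> ^ k) * G y"
      by (simp add: G_def c_def distrib_right exp_add)
    finally show "G x \<le> exp (c * \<beta> ^ k) * G y" .
  qed (use \<beta> in auto)
  interpret N: normalized_operator A G \<beta> c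
  proof (intro normalized_operator.intro normalized_operator_axioms.intro top)
    fix x assume x: "x \<in> X"
    have "(\<Sum>i | A $ i $ x 0 = 1. G (scons i x)) = P.L h x / (lam * h x)"
      unfolding P.L_def sum_divide_distrib G_def by simp
    also have "\<dots> = 1" using Lh[OF x] lam h_pos[OF x] by simp
    finally show "transfer_operator.L A G (\<lambda>_. 1) x = 1"
      by (simp add: transfer_operator.L_def[OF top])
  qed
  obtain m where m: "clopen_prob A m" "\<And>n U. determined A n U \<Longrightarrow> measure m U = N.mean U"
    using N.gibbs_measure_exists by blast
  have gm: "gibbs_measure A G \<beta> c m"
    by (intro gibbs_measure.intro gibbs_measure_axioms.intro m N.normalized_operator_axioms)
  interpret m: gibbs_measure A G \<beta> c m by (rule gm)
  have im: "invariant_measure A m" by (rule m.gibbs_invariant)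

  have uh: "ucont A (\<lambda>x. ln (h x))"
  proof (rule ucont_exp_bound[OF \<beta>])
    fix k x y assume xy: "x \<in> X" "y \<in> X" "agree k x y"
    have "ln (h x) \<le> ln (exp (H * \<beta> ^ k) * h y)" using h_var[OF xy] h_pos xy by simp
    then show "ln (h x) - ln (h y) \<le> H * \<beta> ^ k" using h_pos[OF xy(2)] by (simp add: ln_mult)
  qed
  have u\<phi>: "ucont A \<phi>" by (rule ucont_exp_bound[OF \<beta> \<phi>_var])
  have lnG: "ln (G x) = \<phi> x + ln (h x) - ln (h (shift_map x)) - ln lam" if "x \<in> X" for x
    using h_pos[OF that] h_pos[of "shift_map x"] that lam by (simp add: G_def ln_mult ln_div)
  have int_lnG: "(\<integral>x. ln (G x) \<partial>\<nu>) = (\<integral>x. \<phi> x \<partial>\<nu>) - ln lam" if "invariant_measure A \<nu>" for \<nu>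
  proof -
    interpret \<nu>: invariant_measure A \<nu> by fact
    have i1: "integrable \<nu> \<phi>" "integrable \<nu> (\<lambda>x. ln (h x))" by (rule \<nu>.ucont_integrable, fact)+
    have i2: "integrable \<nu> (\<lambda>x. ln (h (shift_map x)))" "(\<integral>x. ln (h (shift_map x)) \<partial>\<nu>) = (\<integral>x. ln (h x) \<partial>\<nu>)"
      using \<nu>.integrable_shift[OF uh, of 1] \<nu>.integral_shift[OF \<nu>.ucont_measurable[OF uh], of 1] by simp_all
    have "(\<integral>x. ln (G x) \<partial>\<nu>) = (\<integral>x. \<phi> x + ln (h x) - ln (h (shift_map x)) - ln lam \<partial>\<nu>)"
      by (rule Bochner_Integration.integral_cong) (simp_all add: lnG \<nu>.space_eq)
    also have "\<dots> = (\<integral>x. \<phi> x \<partial>\<nu>) - ln lam"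
      using i1 i2 by (simp add: \<nu>.prob_space)
    finally show ?thesis .
  qed
  have fm: "free_energy \<phi> m = ereal (ln lam)"
    unfolding free_energy_def m.gibbs_entropy by (simp add: int_lnG[OF im])
  have "free_energy \<phi> m \<le> free_energy \<phi> \<mu>"
    using \<mu> im invariant_prob_iff[OF sub \<theta>] by (simp add: equilibrium_state_def)
  then have "ereal (ln lam) \<le> ks_entropy \<mu> shift_map + ereal (\<integral>x. \<phi> x \<partial>\<mu>)"
    unfolding fm by (simp add: free_energy_def)
  moreover obtain hh where "ks_entropy \<mu> shift_map = ereal hh" using \<mu>.kolmogorov_sinai by metis
  ultimately have "ereal (- (\<integral>x. ln (G x) \<partial>\<mu>)) \<le> ks_entropy \<mu> shift_map"
    by (simp add: int_lnG[OF \<mu>.invariant_measure_axioms])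
  then have eq: "\<mu> = m" by (rule m.gibbs_unique[OF \<mu>.invariant_measure_axioms])
  have pr: "pressure \<phi> \<mu> = ln lam" unfolding pressure_def eq fm by simp
  show ?thesis
  proof (rule that)
    show "gibbs_measure A G \<beta> c \<mu>" using gm eq by simp
    fix z p assume z: "z \<in> X" "(shift_map ^^ p) z = z"
    have zk: "(shift_map ^^ k) z \<in> X" for k using z by auto
    have "(\<Prod>k<p. G ((shift_map ^^ k) z)) = exp (\<Sum>k<p. ln (G ((shift_map ^^ k) z)))"
      using G_pos[OF zk] by (simp add: exp_sum)
    also have "(\<Sum>k<p. ln (G ((shift_map ^^ k) z))) =
      (\<Sum>k<p. \<phi> ((shift_map ^^ k) z) - ln lam - (ln (h ((shift_map ^^ Suc k) z)) - ln (h ((shift_map ^^ k) z))))"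
      using lnG[OF zk] by (intro sum.cong) auto
    also have "\<dots> = (\<Sum>k<p. \<phi> ((shift_map ^^ k) z)) - real p * ln lam"
    proof -
      have "(\<Sum>k<p. ln (h ((shift_map ^^ Suc k) z)) - ln (h ((shift_map ^^ k) z))) = 0"
        by (subst sum_lessThan_telescope) (simp add: z(2))
      then show ?thesis by (subst sum_subtractf) (simp add: sum_subtractf)
    qed
    finally show "(\<Prod>k<p. G ((shift_map ^^ k) z)) = exp ((\<Sum>k<p. \<phi> ((shift_map ^^ k) z)) - real p * pressure \<phi> \<mu>)"
      by (simp add: pr)
  qed
qed

section \<open>Hitting times of small sets for the shift\<close>

definition surv :: "nat ^ 's ^ 's \<Rightarrow> nat \<Rightarrow> (nat \<Rightarrow> 's) set \<Rightarrow> (nat \<Rightarrow> 's) set" where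
  "surv A K U = {x \<in> subshift A. \<forall>j<K. (shift_map ^^ j) x \<notin> U}"

lemma surv_subset: "surv A K U \<subseteq> subshift A"
  by (auto simp: surv_def)

lemma surv_0 [simp]: "surv A 0 U = subshift A"
  by (simp add: surv_def)

lemma surv_antimono: "K \<le> K' \<Longrightarrow> surv A K' U \<subseteq> surv A K U"
  by (auto simp: surv_def)

lemma surv_add: "surv A (K + m) U = surv A K U \<inter> preim A K (surv A m U)"
proof (intro equalityI subsetI)
  fix x assume x: "x \<in> surv A K U \<inter> preim A K (surv A m U)"
  have "(shift_map ^^ j) x \<notin> U" if "j < K + m" for j
  proof (cases "j < K")
    case True
    then show ?thesis using x by (simp add: surv_def)
  next
    case False
    then have "(shift_map ^^ (j - K)) ((shift_map ^^ K) x) \<notin> U"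
      using x that by (simp add: surv_def preim_def)
    moreover have "(shift_map ^^ (j - K)) ((shift_map ^^ K) x) = (shift_map ^^ j) x"
      using False by (metis comp_apply funpow_add le_add_diff_inverse2 not_less)
    ultimately show ?thesis by simp
  qed
  then show "x \<in> surv A (K + m) U" using x by (simp add: surv_def)
next
  fix x assume x: "x \<in> surv A (K + m) U"
  have "(shift_map ^^ j) ((shift_map ^^ K) x) \<notin> U" if "j < m" for j
  proof -
    have "(shift_map ^^ (j + K)) x \<notin> U" using x that by (auto simp: surv_def)
    then show ?thesis by (simp add: funpow_add)
  qed
  then show "x \<in> surv A K U \<inter> preim A K (surv A m U)" using x by (auto simp: surv_def preim_def)
qed

lemma determined_surv:
  assumes U: "determined A n U" shows "determined A (K + n) (surv A K U)"
proof -
  have "surv A K U = subshift A - (\<Union>j\<in>{..<K}. preim A j U)"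
    by (auto simp: surv_def preim_def)
  moreover have "determined A (K + n) (\<Union>j\<in>{..<K}. preim A j U)"
    by (intro determined_UN determined_mono[OF determined_preim[OF U]]) auto
  ultimately show ?thesis using determined_Diff[OF determined_space] by simp
qed

context mixing_measure
begin

lemma measure_space_one: "measure \<mu> X = 1"
  using prob_space by (simp add: space_eq)

lemma measure_surv_antimono:
  assumes "determined A n U" "K \<le> K'" shows "measure \<mu> (surv A K' U) \<le> measure \<mu> (surv A K U)"
  using assms by (intro finite_measure_mono surv_antimono determined_sets[OF determined_surv])

text \<open>The hits in the gap after each block are ignored, which can only increase the survival
  probability.\<close>

lemma surv_block_upper:
  assumes U: "determined A n U" and e: "e \<le> 1"
    and mix: "\<And>n U k V. determined A n U \<Longrightarrow> determined A k V \<Longrightarrow>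
      \<bar>measure \<mu> (U \<inter> preim A (n + g) V) - measure \<mu> U * measure \<mu> V\<bar> \<le> e * (measure \<mu> U * measure \<mu> V)"
  shows "measure \<mu> (surv A (k * (N + n + g)) U) \<le> (1 - (1 - e) * (1 - measure \<mu> (surv A N U))) ^ k"
proof (induction k)
  case (Suc k)
  let ?T = "N + n + g"
  let ?S = "surv A (k * ?T) U"
  let ?H = "X - surv A N U"
  let ?p = "1 - measure \<mu> (surv A N U)"
  have dS: "determined A (k * ?T + n) ?S" by (rule determined_surv[OF U])
  have dH: "determined A (N + n) ?H" by (intro determined_Diff determined_space determined_surv[OF U])
  have mH: "measure \<mu> ?H = ?p"
    using prob_compl[OF determined_sets[OF determined_surv[OF U, of N]]] by (simp add: space_eq)
  let ?P = "preim A (k * ?T + n + g) ?H"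
  have dP: "?P \<in> sets \<mu>" using dH by auto
  have "surv A (Suc k * ?T) U \<subseteq> ?S - (?S \<inter> ?P)"
  proof
    fix x assume x: "x \<in> surv A (Suc k * ?T) U"
    have "Suc k * ?T = (k * ?T + n + g) + N" by simp
    then have "x \<in> surv A (k * ?T + n + g) U \<inter> preim A (k * ?T + n + g) (surv A N U)"
      using x unfolding surv_add[symmetric] by (simp only:)
    moreover from this have "x \<in> ?S" using surv_antimono[of "k * ?T" "k * ?T + n + g" A U] by fastforce
    ultimately show "x \<in> ?S - (?S \<inter> ?P)" by (auto simp: preim_def)
  qed
  then have "measure \<mu> (surv A (Suc k * ?T) U) \<le> measure \<mu> (?S - (?S \<inter> ?P))"
    using determined_sets[OF dS] dP by (intro finite_measure_mono) auto
  also have "\<dots> = measure \<mu> ?S - measure \<mu> (?S \<inter> ?P)"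
    using determined_sets[OF dS] dP by (intro finite_measure_Diff) auto
  also have "\<dots> \<le> measure \<mu> ?S * (1 - (1 - e) * ?p)"
    using mix[OF dS dH] unfolding mH by (simp add: algebra_simps abs_le_iff)
  also have "\<dots> \<le> (1 - (1 - e) * ?p) ^ k * (1 - (1 - e) * ?p)"
  proof (intro mult_right_mono Suc)
    have "0 \<le> ?p" "?p \<le> 1" by auto
    moreover have "0 \<le> e"
    proof -
      have "\<bar>measure \<mu> (X \<inter> preim A (0 + g) X) - measure \<mu> X * measure \<mu> X\<bar> \<le> e * (measure \<mu> X * measure \<mu> X)"
        by (rule mix[OF determined_space determined_space])
      then show ?thesis by (simp add: preim_space measure_space_one)
    qed
    ultimately have "(1 - e) * ?p \<le> 1 * 1" using e by (intro mult_mono) auto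
    then show "0 \<le> 1 - (1 - e) * ?p" by simp
  qed
  finally show ?case by (simp add: mult.commute)
qed (simp add: measure_space_one)

text \<open>To separate the past from the new block, the end of the past is forgotten. This costs a factor
  \<open>surv (k - 1) / surv k\<close>, which the induction hypothesis bounds by \<open>1 / (1 -
  \<delta>)\<close>.\<close>

lemma surv_block_lower:
  assumes U: "determined A n U" and N: "n + g \<le> N" and e: "0 \<le> e" and \<delta>: "0 \<le> \<delta>" "\<delta> < 1"
    and p: "1 - measure \<mu> (surv A N U) \<le> \<delta>" "(1 + e) * (1 - measure \<mu> (surv A N U)) \<le> \<delta> * (1 - \<delta>)"
    and mix: "\<And>n U k V. determined A n U \<Longrightarrow> determined A k V \<Longrightarrow>
      \<bar>measure \<mu> (U \<inter> preim A (n + g) V) - measure \<mu> U * measure \<mu> V\<bar> \<le> e * (measure \<mu> U * measure \<mu> V)"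
  shows "(1 - \<delta>) ^ k \<le> measure \<mu> (surv A (k * N) U)"
proof -
  let ?q = "\<lambda>K. measure \<mu> (surv A K U)"
  let ?H = "X - surv A N U"
  let ?p = "1 - ?q N"
  have dH: "determined A (N + n) ?H" by (intro determined_Diff determined_space determined_surv[OF U])
  have mH: "measure \<mu> ?H = ?p"
    using prob_compl[OF determined_sets[OF determined_surv[OF U, of N]]] by (simp add: space_eq)
  have step: "(1 - \<delta>) * ?q (k * N) \<le> ?q (Suc k * N)" for k
  proof (induction k)
    case 0
    then show ?case using p(1) by (simp add: measure_space_one)
  next
    case (Suc k)
    define K where "K = Suc k * N - (n + g)"
    have K: "K + (n + g) = Suc k * N" "k * N \<le> K" using N by (auto simp: K_def)
    let ?S = "surv A (Suc k * N) U"
    let ?P = "preim A (Suc k * N) ?H"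
    have sets: "?S \<in> sets \<mu>" "?P \<in> sets \<mu>" "surv A K U \<in> sets \<mu>"
      using determined_sets[OF determined_surv[OF U]] determined_sets[OF dH] by auto
    have "surv A (Suc (Suc k) * N) U = ?S - (?S \<inter> ?P)"
    proof -
      have "Suc (Suc k) * N = Suc k * N + N" by simp
      then have "surv A (Suc (Suc k) * N) U = ?S \<inter> preim A (Suc k * N) (surv A N U)"
        using surv_add[of A "Suc k * N" N U] by (simp only:)
      then show ?thesis using surv_subset[of A "Suc k * N" U] by (auto simp: preim_def)
    qed
    then have "?q (Suc (Suc k) * N) = ?q (Suc k * N) - measure \<mu> (?S \<inter> ?P)"
      using sets by (simp only:) (intro finite_measure_Diff, auto)
    moreover have "measure \<mu> (?S \<inter> ?P) \<le> measure \<mu> (surv A K U \<inter> ?P)"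
      using sets surv_antimono[of K "Suc k * N" A U] K by (intro finite_measure_mono) auto
    moreover have "measure \<mu> (surv A K U \<inter> ?P) \<le> (1 + e) * (?q K * ?p)"
      using mix[OF determined_surv[OF U, of K] dH] K(1) unfolding mH by (simp add: algebra_simps abs_le_iff)
    moreover have "(1 + e) * (?q K * ?p) \<le> \<delta> * ?q (Suc k * N)"
    proof -
      have "(1 + e) * (?q K * ?p) = ((1 + e) * ?p) * ?q K" by simp
      also have "\<dots> \<le> (\<delta> * (1 - \<delta>)) * ?q (k * N)"
        by (rule mult_mono[OF p(2) measure_surv_antimono[OF U K(2)]]) (use \<delta> in auto)
      also have "\<dots> = \<delta> * ((1 - \<delta>) * ?q (k * N))" by simp
      also have "\<dots> \<le> \<delta> * ?q (Suc k * N)" using Suc \<delta> by (intro mult_left_mono)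
      finally show ?thesis .
    qed
    ultimately show ?case by (simp only: algebra_simps)
  qed
  show ?thesis
  proof (induction k)
    case (Suc k)
    have "(1 - \<delta>) ^ Suc k \<le> (1 - \<delta>) * ?q (k * N)" using Suc \<delta> by (simp add: mult_left_mono)
    then show ?case using step[of k] by linarith
  qed (simp add: measure_space_one)
qed

text \<open>The mass of the points of \<open>U\<close> that do not return to \<open>U\<close> during the next
  \<open>K\<close> steps.\<close>

definition fresh :: "(nat \<Rightarrow> 's) set \<Rightarrow> nat \<Rightarrow> real" where
  "fresh U K = measure \<mu> (U \<inter> preim A 1 (surv A K U))"

lemma fresh_antimono: "determined A n U \<Longrightarrow> K \<le> K' \<Longrightarrow> fresh U K' \<le> fresh U K"
  unfolding fresh_def
  using surv_antimono[of K K' A U] determined_sets determined_sets[OF determined_surv]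
  by (intro finite_measure_mono) (auto simp: preim_def)

lemma fresh_le: "determined A n U \<Longrightarrow> fresh U K \<le> measure \<mu> U"
  unfolding fresh_def by (intro finite_measure_mono) auto

lemma surv_Suc:
  assumes U: "determined A n U"
  shows "measure \<mu> (surv A (Suc K) U) = measure \<mu> (surv A K U) - fresh U K"
proof -
  let ?P = "preim A 1 (surv A K U)"
  have S: "surv A K U \<in> sets \<mu>" using determined_sets[OF determined_surv[OF U]] .
  have P: "?P \<in> sets \<mu>" using S by auto
  have "surv A (1 + K) U = ?P - (U \<inter> ?P)"
    unfolding surv_add using surv_subset by (auto simp: surv_def preim_def)
  then have "measure \<mu> (surv A (Suc K) U) = measure \<mu> ?P - measure \<mu> (U \<inter> ?P)"
    using P determined_sets[OF U] by (simp only: plus_1_eq_Suc) (intro finite_measure_Diff, auto)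
  then show ?thesis using invariant[OF S] by (simp add: fresh_def)
qed

lemma hit_sum:
  assumes U: "determined A n U"
  shows "1 - measure \<mu> (surv A N U) = (\<Sum>K<N. fresh U K)"
  by (induction N) (simp_all add: measure_space_one surv_Suc[OF U])

lemma fresh_lower:
  assumes U: "determined A n U" and "r \<le> K"
  shows "fresh U r - (\<Sum>j\<in>{r<..K}. measure \<mu> (U \<inter> preim A j U)) \<le> fresh U K"
proof -
  have sets: "U \<inter> preim A 1 (surv A k U) \<in> sets \<mu>" "U \<inter> preim A k U \<in> sets \<mu>" for k
    using determined_sets[OF determined_surv[OF U, of k]] determined_sets[OF U] by auto
  have V: "(\<Union>j\<in>{r<..K}. U \<inter> preim A j U) \<in> sets \<mu>"
    by (intro sets.finite_UN sets(2)) simp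
  have "U \<inter> preim A 1 (surv A r U) \<subseteq>
    (U \<inter> preim A 1 (surv A K U)) \<union> (\<Union>j\<in>{r<..K}. U \<inter> preim A j U)"
  proof
    fix x assume x: "x \<in> U \<inter> preim A 1 (surv A r U)"
    show "x \<in> (U \<inter> preim A 1 (surv A K U)) \<union> (\<Union>j\<in>{r<..K}. U \<inter> preim A j U)"
    proof (cases "\<forall>i<K. (shift_map ^^ i) (shift_map x) \<notin> U")
      case True
      then show ?thesis using x by (auto simp: preim_def surv_def)
    next
      case False
      then obtain i where i: "i < K" "(shift_map ^^ i) (shift_map x) \<in> U" by blast
      have "r \<le> i" using x i(2) by (force simp: preim_def surv_def not_less)
      moreover have "(shift_map ^^ Suc i) x \<in> U" using i(2) by (simp add: funpow_swap1)
      ultimately have "x \<in> U \<inter> preim A (Suc i) U" using x by (auto simp: preim_def simp del: funpow.simps)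
      then show ?thesis using i(1) \<open>r \<le> i\<close> by fastforce
    qed
  qed
  then have "fresh U r \<le> measure \<mu> ((U \<inter> preim A 1 (surv A K U)) \<union> (\<Union>j\<in>{r<..K}. U \<inter> preim A j U))"
    unfolding fresh_def by (intro finite_measure_mono sets.Un sets(1) V)
  also have "\<dots> \<le> fresh U K + measure \<mu> (\<Union>j\<in>{r<..K}. U \<inter> preim A j U)"
    unfolding fresh_def by (rule measure_Un_le[OF sets(1) V])
  also have "measure \<mu> (\<Union>j\<in>{r<..K}. U \<inter> preim A j U) \<le> (\<Sum>j\<in>{r<..K}. measure \<mu> (U \<inter> preim A j U))"
    using sets by (intro finite_measure_subadditive_finite) auto
  finally show ?thesis by simp
qed

text \<open>By invariance each time contributes the mass of the points whose next visit comes only after the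
  end of the block.\<close>

lemma hit_bounds:
  assumes U: "determined A n U" and r: "r \<le> N"
  shows "1 - measure \<mu> (surv A N U) \<le> real r * measure \<mu> U + real N * fresh U r"
    and "(real N - real r) * (fresh U r - (\<Sum>j\<in>{r<..N}. measure \<mu> (U \<inter> preim A j U))) \<le> 1 - measure \<mu> (surv A N U)"
proof -
  have split: "(\<Sum>K<N. fresh U K) = (\<Sum>K<r. fresh U K) + (\<Sum>K\<in>{r..<N}. fresh U K)"
    using r by (simp add: lessThan_atLeast0 sum.atLeastLessThan_concat)
  have "(\<Sum>K<r. fresh U K) \<le> (\<Sum>K<r. measure \<mu> U)" by (intro sum_mono fresh_le[OF U])
  moreover have "(\<Sum>K\<in>{r..<N}. fresh U K) \<le> (\<Sum>K\<in>{r..<N}. fresh U r)"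
    by (intro sum_mono fresh_antimono[OF U]) auto
  moreover have "real (N - r) * fresh U r \<le> real N * fresh U r"
    by (intro mult_right_mono) (auto simp: fresh_def)
  ultimately show "1 - measure \<mu> (surv A N U) \<le> real r * measure \<mu> U + real N * fresh U r"
    unfolding hit_sum[OF U] split by simp
  let ?s = "\<Sum>j\<in>{r<..N}. measure \<mu> (U \<inter> preim A j U)"
  have "(\<Sum>K\<in>{r..<N}. fresh U r - ?s) \<le> (\<Sum>K\<in>{r..<N}. fresh U K)"
  proof (rule sum_mono)
    fix K assume K: "K \<in> {r..<N}"
    have "(\<Sum>j\<in>{r<..K}. measure \<mu> (U \<inter> preim A j U)) \<le> ?s"
      using K by (intro sum_mono2) auto
    then show "fresh U r - ?s \<le> fresh U K" using fresh_lower[OF U, of r K] K by simp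
  qed
  moreover have "0 \<le> (\<Sum>K<r. fresh U K)" by (intro sum_nonneg) (simp add: fresh_def)
  ultimately show "(real N - real r) * (fresh U r - ?s) \<le> 1 - measure \<mu> (surv A N U)"
    unfolding hit_sum[OF U] split using r by (simp add: of_nat_diff)
qed

lemma quasi_bernoulli:
  obtains R where "1 \<le> R" "\<And>n U k V. determined A n U \<Longrightarrow> determined A k V \<Longrightarrow>
    measure \<mu> (U \<inter> preim A n V) \<le> R * (measure \<mu> U * measure \<mu> V)"
proof -
  obtain r where r: "\<And>g n U k V. determined A n U \<Longrightarrow> determined A k V \<Longrightarrow>
      \<bar>measure \<mu> (U \<inter> preim A (n + g) V) - measure \<mu> U * measure \<mu> V\<bar>
        \<le> r g * (measure \<mu> U * measure \<mu> V)"
    using psi_mixing by blast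
  show ?thesis
  proof (rule that[of "max 1 (1 + r 0)"])
    fix n U k V assume "determined A n U" "determined A k V"
    from r[OF this, of 0] have "measure \<mu> (U \<inter> preim A n V) \<le> (1 + r 0) * (measure \<mu> U * measure \<mu> V)"
      by (simp add: algebra_simps abs_le_iff)
    also have "\<dots> \<le> max 1 (1 + r 0) * (measure \<mu> U * measure \<mu> V)"
      by (intro mult_right_mono) auto
    finally show "measure \<mu> (U \<inter> preim A n V) \<le> max 1 (1 + r 0) * (measure \<mu> U * measure \<mu> V)" .
  qed simp
qed

text \<open>A return after \<open>j < n\<close> steps is bounded by replacing the first copy of \<open>I
  n\<close> by the larger set \<open>I j\<close>, which depends on \<open>j\<close> letters only, so that the
  two visits are almost independent.\<close>

lemma return_sum:
  assumes I: "\<And>n. 1 \<le> n \<Longrightarrow> determined A n (I n)" "\<And>n. 1 \<le> n \<Longrightarrow> I (Suc n) \<subseteq> I n"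
    and \<rho>: "0 < \<rho>" "\<rho> < 1" "\<And>n. 1 \<le> n \<Longrightarrow> measure \<mu> (I n) \<le> c * \<rho> ^ n"
  obtains C where "0 < C" "\<And>n r N. 1 \<le> n \<Longrightarrow>
    (\<Sum>j\<in>{r<..N}. measure \<mu> (I n \<inter> preim A j (I n))) \<le> C * (\<rho> ^ r + real N * \<rho> ^ n) * measure \<mu> (I n)"
proof -
  obtain R where R: "1 \<le> R" "\<And>n U k V. determined A n U \<Longrightarrow> determined A k V \<Longrightarrow>
    measure \<mu> (U \<inter> preim A n V) \<le> R * (measure \<mu> U * measure \<mu> V)"
    by (rule quasi_bernoulli) (rule that)
  have "0 \<le> c * \<rho>" using order_trans[OF measure_nonneg \<rho>(3)[of 1]] by simp
  then have c: "0 \<le> c" using \<rho>(1) by (simp add: zero_le_mult_iff)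
  have anti: "I n \<subseteq> I j" if "1 \<le> j" "j \<le> n" for j n
    using that(2)
  proof (induction n rule: dec_induct)
    case (step n)
    then have "I (Suc n) \<subseteq> I n" using that(1) by (intro I(2)) simp
    then show ?case using step by blast
  qed simp
  define C where "C = R * (c + 1) / (1 - \<rho>)"
  have term_bound: "measure \<mu> (I n \<inter> preim A j (I n)) \<le> R * c * (\<rho> ^ j + \<rho> ^ n) * measure \<mu> (I n)"
    if n: "1 \<le> n" and j: "1 \<le> j" for n j
  proof -
    define k where "k = min j n"
    have k: "1 \<le> k" "k \<le> n" "k \<le> j" using n j by (auto simp: k_def)
    have dk: "determined A j (I k)" by (rule determined_mono[OF I(1)[OF k(1)] k(3)])
    have "measure \<mu> (I n \<inter> preim A j (I n)) \<le> measure \<mu> (I k \<inter> preim A j (I n))"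
      using anti[OF k(1,2)] determined_sets[OF dk] determined_sets[OF I(1)[OF n]]
      by (intro finite_measure_mono) auto
    also have "\<dots> \<le> R * (measure \<mu> (I k) * measure \<mu> (I n))" by (rule R(2)[OF dk I(1)[OF n]])
    also have "\<dots> \<le> R * ((c * \<rho> ^ k) * measure \<mu> (I n))"
      using R(1) \<rho>(3)[OF k(1)] by (intro mult_left_mono mult_right_mono) auto
    also have "\<dots> \<le> R * ((c * (\<rho> ^ j + \<rho> ^ n)) * measure \<mu> (I n))"
      using R(1) c \<rho> by (intro mult_left_mono mult_right_mono) (auto simp: k_def min_def)
    finally show ?thesis by (simp add: mult_ac)
  qed
  have geo: "(\<Sum>j\<in>{r<..N}. \<rho> ^ j) \<le> \<rho> ^ r / (1 - \<rho>)" for r N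
  proof -
    have "(\<Sum>j\<in>{r<..N}. \<rho> ^ j) = (\<Sum>i\<in>(\<lambda>j. j - r) ` {r<..N}. \<rho> ^ (r + i))"
      by (subst sum.reindex) (auto simp: inj_on_def intro!: sum.cong)
    also have "\<dots> \<le> (\<Sum>i<Suc N. \<rho> ^ (r + i))"
      using \<rho> by (intro sum_mono2) auto
    also have "\<dots> = \<rho> ^ r * (\<Sum>i<Suc N. \<rho> ^ i)" by (simp only: power_add sum_distrib_left)
    also have "\<dots> = \<rho> ^ r * ((1 - \<rho> ^ Suc N) / (1 - \<rho>))"
      using \<rho> by (subst sum_gp_strict) auto
    also have "\<dots> \<le> \<rho> ^ r * (1 / (1 - \<rho>))"
      using \<rho> by (intro mult_left_mono divide_right_mono) auto
    finally show ?thesis by simp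
  qed
  have "(\<Sum>j\<in>{r<..N}. measure \<mu> (I n \<inter> preim A j (I n))) \<le> C * (\<rho> ^ r + real N * \<rho> ^ n) * measure \<mu> (I n)"
    if n: "1 \<le> n" for n r N
  proof -
    have "(\<Sum>j\<in>{r<..N}. measure \<mu> (I n \<inter> preim A j (I n))) \<le> (\<Sum>j\<in>{r<..N}. R * c * (\<rho> ^ j + \<rho> ^ n) * measure \<mu> (I n))"
      by (intro sum_mono term_bound n) auto
    also have "\<dots> = R * c * ((\<Sum>j\<in>{r<..N}. \<rho> ^ j) + real (N - r) * \<rho> ^ n) * measure \<mu> (I n)"
      by (simp add: sum.distrib flip: sum_distrib_left sum_distrib_right)
    also have "\<dots> \<le> R * (c + 1) * (\<rho> ^ r / (1 - \<rho>) + real N * \<rho> ^ n / (1 - \<rho>)) * measure \<mu> (I n)"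
    proof -
      have "real (N - r) * \<rho> ^ n \<le> real N * \<rho> ^ n" using \<rho> by (intro mult_right_mono) auto
      also have "\<dots> \<le> real N * \<rho> ^ n / (1 - \<rho>)"
        using \<rho> by (simp add: le_divide_eq mult_left_le)
      finally have le: "(\<Sum>j\<in>{r<..N}. \<rho> ^ j) + real (N - r) * \<rho> ^ n \<le> \<rho> ^ r / (1 - \<rho>) + real N * \<rho> ^ n / (1 - \<rho>)"
        by (intro add_mono geo)
      have Rc: "R * c \<le> R * (c + 1)" "0 \<le> R * (c + 1)" using R(1) c by auto
      have nn: "0 \<le> (\<Sum>j\<in>{r<..N}. \<rho> ^ j) + real (N - r) * \<rho> ^ n"
        using \<rho> by (intro add_nonneg_nonneg sum_nonneg) auto
      show ?thesis by (rule mult_right_mono[OF mult_mono[OF Rc(1) le Rc(2) nn] measure_nonneg])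
    qed
    also have "\<dots> = C * (\<rho> ^ r + real N * \<rho> ^ n) * measure \<mu> (I n)"
      unfolding C_def add_divide_distrib[symmetric] by (simp only: times_divide_eq_left times_divide_eq_right)
    finally show ?thesis .
  qed
  moreover have "0 < C" using R c \<rho> by (simp add: C_def)
  ultimately show ?thesis using that by blast
qed

end

section \<open>Escape rate of the shift through small holes\<close>

context mixing_measure
begin

text \<open>If \<open>d \<le> \<epsilon>\<close> the claimed bound is at least \<open>1\<close>.\<close>

lemma surv_upper_rate:
  fixes d e \<epsilon> :: real
  assumes U: "determined A n U" and e: "0 < e" "e \<le> 1 / 2" and N: "1 \<le> N" "real r \<le> e * real N" "real (n + g) \<le> e * real N"
    and mix: "\<And>n U k V. determined A n U \<Longrightarrow> determined A k V \<Longrightarrow>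
      \<bar>measure \<mu> (U \<inter> preim A (n + g) V) - measure \<mu> U * measure \<mu> V\<bar> \<le> e * (measure \<mu> U * measure \<mu> V)"
    and ret: "(\<Sum>j\<in>{r<..N}. measure \<mu> (U \<inter> preim A j U)) \<le> e * measure \<mu> U"
    and fr: "(d - e) * measure \<mu> U \<le> fresh U r"
    and d: "d \<le> 1" and \<epsilon>: "5 * e \<le> \<epsilon>"
  shows "\<exists>C>0. \<forall>K. measure \<mu> (surv A K U) \<le> C * exp (- (d - \<epsilon>) * measure \<mu> U * real K)"
proof (cases "d - \<epsilon> \<le> 0")
  case True
  have "measure \<mu> (surv A K U) \<le> 1 * exp (- (d - \<epsilon>) * measure \<mu> U * real K)" for K
  proof -
    have "0 \<le> - (d - \<epsilon>) * measure \<mu> U * real K" using True by (intro mult_nonneg_nonneg) auto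
    then have "1 \<le> exp (- (d - \<epsilon>) * measure \<mu> U * real K)" by simp
    then show ?thesis using prob_le_1[of "surv A K U"] by linarith
  qed
  then show ?thesis by (intro exI[of _ 1]) simp
next
  case False
  define m where "m = measure \<mu> U"
  define x where "x = d - \<epsilon>"
  define p where "p = 1 - measure \<mu> (surv A N U)"
  define T where "T = N + n + g"
  have m: "0 \<le> m" by (simp add: m_def)
  have x: "0 < x" using False by (simp add: x_def)
  have T: "0 < T" "real T \<le> (1 + e) * real N" using N by (auto simp: T_def algebra_simps)
  have rN: "r \<le> N"
  proof -
    have "e * real N \<le> 1 * real N" using e by (intro mult_right_mono) auto
    then have "real r \<le> real N" using N(2) by linarith
    then show ?thesis by simp
  qed
  have d2: "0 < d - 2 * e" using x \<epsilon> e by (simp add: x_def)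
  have "(1 - e) * real N * ((d - 2 * e) * m) \<le> (real N - real r) * ((d - 2 * e) * m)"
  proof (rule mult_right_mono)
    show "(1 - e) * real N \<le> real N - real r" using N(2) by (simp add: algebra_simps)
    show "0 \<le> (d - 2 * e) * m" using d2 m by simp
  qed
  also have "\<dots> \<le> (real N - real r) * (fresh U r - (\<Sum>j\<in>{r<..N}. measure \<mu> (U \<inter> preim A j U)))"
    using ret fr rN unfolding m_def[symmetric] by (intro mult_left_mono) (auto simp: algebra_simps)
  also have "\<dots> \<le> p" unfolding p_def by (rule hit_bounds(2)[OF U rN])
  finally have p: "(1 - e) * real N * ((d - 2 * e) * m) \<le> p" .
  have key: "(1 + e) * x \<le> (1 - e) * ((1 - e) * (d - 2 * e))"
  proof -
    have "e * x \<le> e * 1" using e d \<epsilon> by (intro mult_left_mono) (auto simp: x_def)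
    then have "(1 + e) * x \<le> x + e" by (simp add: algebra_simps)
    also have "\<dots> \<le> d - 4 * e" using \<epsilon> by (simp add: x_def)
    also have "\<dots> \<le> (1 - 2 * e) * (d - 2 * e)"
    proof -
      have "e * d \<le> e * 1" using d e by (intro mult_left_mono) auto
      moreover have "(1 - 2 * e) * (d - 2 * e) = d - 2 * e - 2 * (e * d) + 4 * (e * e)"
        by (simp add: algebra_simps)
      ultimately show ?thesis using zero_le_square[of e] by linarith
    qed
    also have "\<dots> \<le> ((1 - e) * (1 - e)) * (d - 2 * e)"
      using d2 by (intro mult_right_mono) (auto simp: algebra_simps)
    finally show ?thesis by (simp only: mult.assoc)
  qed
  have pT: "real T * m * x \<le> (1 - e) * p"
  proof -
    have "real T * (m * x) \<le> ((1 + e) * real N) * (m * x)" using T m x by (intro mult_right_mono) auto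
    also have "\<dots> = real N * m * ((1 + e) * x)" by (simp add: mult_ac)
    also have "\<dots> \<le> real N * m * ((1 - e) * ((1 - e) * (d - 2 * e)))" using m by (intro mult_left_mono key) auto
    also have "\<dots> = (1 - e) * ((1 - e) * real N * ((d - 2 * e) * m))" by (simp add: mult_ac)
    also have "\<dots> \<le> (1 - e) * p" using p e by (intro mult_left_mono) auto
    finally show ?thesis by (simp add: mult_ac)
  qed
  have p01: "0 \<le> p" "p \<le> 1" by (auto simp: p_def)
  have "measure \<mu> (surv A K U) \<le> exp (real T * m * x) * exp (- x * m * real K)" for K
  proof -
    define k where "k = K div T"
    have "K \<le> (k + 1) * T"
      using dividend_less_div_times[OF T(1), of K] unfolding k_def by simp
    then have "real K \<le> (real k + 1) * real T" by (metis of_nat_1 of_nat_add of_nat_le_iff of_nat_mult)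
    then have "real K * (m * x) \<le> ((real k + 1) * real T) * (m * x)" using m x by (intro mult_right_mono) auto
    then have KT: "- (real k * (real T * m * x)) \<le> real T * m * x + - x * m * real K"
      by (simp add: algebra_simps)
    have "measure \<mu> (surv A K U) \<le> measure \<mu> (surv A (k * T) U)"
      by (rule measure_surv_antimono[OF U]) (simp add: k_def)
    also have "\<dots> \<le> (1 - (1 - e) * p) ^ k"
      unfolding T_def p_def using e by (intro surv_block_upper[OF U _ mix]) auto
    also have "\<dots> \<le> exp (- ((1 - e) * p)) ^ k"
    proof (rule power_mono)
      show "1 - (1 - e) * p \<le> exp (- ((1 - e) * p))" using exp_ge_add_one_self[of "- ((1 - e) * p)"] by simp
      have "(1 - e) * p \<le> 1 * 1" using p01 e by (intro mult_mono) auto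
      then show "0 \<le> 1 - (1 - e) * p" by simp
    qed
    also have "\<dots> = exp (- (real k * ((1 - e) * p)))" by (simp add: exp_of_nat_mult[symmetric])
    also have "\<dots> \<le> exp (- (real k * (real T * m * x)))" using pT by (simp add: mult_left_mono)
    also have "\<dots> \<le> exp (real T * m * x + - x * m * real K)" using KT by simp
    finally show ?thesis by (simp only: exp_add)
  qed
  then show ?thesis unfolding x_def m_def by (intro exI[of _ "exp (real T * measure \<mu> U * (d - \<epsilon>))"]) simp
qed

lemma surv_lower_rate:
  fixes d e \<epsilon> :: real
  assumes U: "determined A n U" and e: "0 < e" "e \<le> 1 / 2" and N: "1 \<le> N" "real r \<le> e * real N" "real (n + g) \<le> e * real N"
    and mix: "\<And>n U k V. determined A n U \<Longrightarrow> determined A k V \<Longrightarrow>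
      \<bar>measure \<mu> (U \<inter> preim A (n + g) V) - measure \<mu> U * measure \<mu> V\<bar> \<le> e * (measure \<mu> U * measure \<mu> V)"
    and fr: "fresh U r \<le> (d + e) * measure \<mu> U"
    and Nm: "9 * real N * measure \<mu> U \<le> e"
    and d: "0 \<le> d" "d \<le> 1" and \<epsilon>: "22 * e \<le> \<epsilon>"
  shows "\<exists>C>0. \<forall>K. C * exp (- (d + \<epsilon>) * measure \<mu> U * real K) \<le> measure \<mu> (surv A K U)"
proof -
  define m where "m = measure \<mu> U"
  define x where "x = d + \<epsilon>"
  define p where "p = 1 - measure \<mu> (surv A N U)"
  define \<delta> where "\<delta> = (1 + 4 * e) * p"
  have m: "0 \<le> m" by (simp add: m_def)
  have p01: "0 \<le> p" by (simp add: p_def)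
  have eN: "e * real N \<le> 1 * real N" using e by (intro mult_right_mono) auto
  have rN: "r \<le> N" "n + g \<le> N" using N eN by linarith+
  have Nm0: "0 \<le> real N * m" using m by simp
  have "p \<le> real r * m + real N * fresh U r" unfolding p_def m_def by (rule hit_bounds(1)[OF U rN(1)])
  also have "\<dots> \<le> (e * real N) * m + real N * ((d + e) * m)"
    using N(2) fr m unfolding m_def[symmetric] by (intro add_mono mult_right_mono mult_left_mono) auto
  also have "\<dots> = (d + 2 * e) * (real N * m)" by (simp add: algebra_simps)
  finally have p: "p \<le> (d + 2 * e) * (real N * m)" .
  have p3: "3 * p \<le> e"
  proof -
    have "p \<le> 3 * (real N * m)" using p mult_right_mono[OF _ Nm0, of "d + 2 * e" 3] d e by linarith
    then show ?thesis using Nm by (simp add: m_def)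
  qed
  have \<delta>3: "\<delta> \<le> 3 * p" unfolding \<delta>_def using e p01 by (intro mult_right_mono) auto
  have \<delta>e: "\<delta> \<le> e" using \<delta>3 p3 by linarith
  have \<delta>0: "0 \<le> \<delta>" unfolding \<delta>_def using e p01 by simp
  have \<delta>1: "\<delta> < 1" using \<delta>e e by linarith
  have p\<delta>: "p \<le> \<delta>" unfolding \<delta>_def using mult_right_mono[OF _ p01, of 1 "1 + 4 * e"] e by simp
  have step: "(1 + e) * p \<le> \<delta> * (1 - \<delta>)"
  proof -
    have "1 + e \<le> (1 + 4 * e) * (1 - e)"
    proof -
      have "4 * (e * e) \<le> 4 * (e * (1 / 2))" using e by (intro mult_left_mono) auto
      then show ?thesis by (simp add: algebra_simps)
    qed
    also have "\<dots> \<le> (1 + 4 * e) * (1 - \<delta>)" using \<delta>e e by (intro mult_left_mono) auto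
    finally have "(1 + e) * p \<le> ((1 + 4 * e) * (1 - \<delta>)) * p" using p01 by (rule mult_right_mono)
    then show ?thesis by (simp add: \<delta>_def mult_ac)
  qed
  have ln\<delta>: "exp (- ((1 + 2 * e) * \<delta>)) \<le> 1 - \<delta>"
  proof -
    have "1 \<le> (1 - \<delta>) * (1 + (1 + 2 * e) * \<delta>)"
    proof -
      have "\<delta> * (1 + 2 * e) \<le> e * 2" using \<delta>e \<delta>0 e by (intro mult_mono) auto
      then have "0 \<le> \<delta> * (2 * e - (1 + 2 * e) * \<delta>)" using \<delta>0 by (intro mult_nonneg_nonneg) (auto simp: mult.commute)
      then show ?thesis by (simp add: algebra_simps)
    qed
    also have "\<dots> \<le> (1 - \<delta>) * exp ((1 + 2 * e) * \<delta>)"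
      using \<delta>1 exp_ge_add_one_self[of "(1 + 2 * e) * \<delta>"] by (intro mult_left_mono) auto
    finally have "exp (- ((1 + 2 * e) * \<delta>)) * 1 \<le> exp (- ((1 + 2 * e) * \<delta>)) * ((1 - \<delta>) * exp ((1 + 2 * e) * \<delta>))"
      by (intro mult_left_mono) auto
    also have "\<dots> = 1 - \<delta>" by (simp add: exp_minus)
    finally show ?thesis by simp
  qed
  have rate: "(1 + 2 * e) * \<delta> \<le> real N * m * x"
  proof -
    have ee: "e * e \<le> e * (1 / 2)" using e by (intro mult_left_mono) auto
    have de: "d * e \<le> 1 * e" using d e by (intro mult_right_mono) auto
    have "(1 + 2 * e) * (1 + 4 * e) \<le> 1 + 10 * e" using ee by (simp add: algebra_simps)
    then have "(1 + 2 * e) * (1 + 4 * e) * (d + 2 * e) \<le> (1 + 10 * e) * (d + 2 * e)"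
      using d e by (intro mult_right_mono) auto
    also have "\<dots> \<le> x" using ee de \<epsilon> by (simp add: x_def algebra_simps)
    finally have *: "(1 + 2 * e) * (1 + 4 * e) * (d + 2 * e) \<le> x" .
    have "(1 + 2 * e) * \<delta> = (1 + 2 * e) * (1 + 4 * e) * p" by (simp add: \<delta>_def)
    also have "\<dots> \<le> (1 + 2 * e) * (1 + 4 * e) * ((d + 2 * e) * (real N * m))"
      using p e by (intro mult_left_mono) auto
    also have "\<dots> = ((1 + 2 * e) * (1 + 4 * e) * (d + 2 * e)) * (real N * m)" by (simp add: mult_ac)
    also have "\<dots> \<le> x * (real N * m)" using * Nm0 by (rule mult_right_mono)
    finally show ?thesis by (simp add: mult_ac)
  qed
  have x0: "0 \<le> x" using d \<epsilon> e by (simp add: x_def)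
  have "exp (- (real N * m * x)) * exp (- x * m * real K) \<le> measure \<mu> (surv A K U)" for K
  proof -
    define k where "k = K div N + 1"
    have "K \<le> k * N"
      using dividend_less_div_times[of N K] N(1) unfolding k_def by simp
    have "(K div N) * N \<le> K" by simp
    then have "real (K div N) * real N \<le> real K" by (metis of_nat_le_iff of_nat_mult)
    then have "(real k * real N) * (m * x) \<le> (real N + real K) * (m * x)"
      using m x0 unfolding k_def by (intro mult_right_mono) (auto simp: algebra_simps)
    then have "- (real N * m * x) + - x * m * real K \<le> - (real k * (real N * m * x))"
      by (simp add: algebra_simps)
    then have "exp (- (real N * m * x)) * exp (- x * m * real K) \<le> exp (- (real k * (real N * m * x)))"
      by (simp flip: exp_add)
    also have "\<dots> \<le> exp (- (real k * ((1 + 2 * e) * \<delta>)))" using rate by (simp add: mult_left_mono)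
    also have "\<dots> = exp (- ((1 + 2 * e) * \<delta>)) ^ k" by (simp add: exp_of_nat_mult[symmetric])
    also have "\<dots> \<le> (1 - \<delta>) ^ k" using ln\<delta> by (intro power_mono) auto
    also have "\<dots> \<le> measure \<mu> (surv A (k * N) U)"
      by (rule surv_block_lower[OF U rN(2) _ \<delta>0 \<delta>1 p\<delta>[unfolded p_def] step[unfolded p_def] mix]) (use e in auto)
    also have "\<dots> \<le> measure \<mu> (surv A K U)" by (rule measure_surv_antimono[OF U \<open>K \<le> k * N\<close>])
    finally show ?thesis .
  qed
  then show ?thesis unfolding x_def m_def by (intro exI[of _ "exp (- (real N * measure \<mu> U * (d + \<epsilon>)))"]) simp
qed

theorem base_escape:
  assumes I: "\<And>n. 1 \<le> n \<Longrightarrow> determined A n (I n)" "\<And>n. 1 \<le> n \<Longrightarrow> I (Suc n) \<subseteq> I n" "\<And>n. 1 \<le> n \<Longrightarrow> I n \<noteq> {}"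
    and \<rho>: "0 < \<rho>" "\<rho> < 1" "\<And>n. 1 \<le> n \<Longrightarrow> measure \<mu> (I n) \<le> c * \<rho> ^ n"
    and lim: "\<And>r. r0 \<le> r \<Longrightarrow> (\<lambda>n. fresh (I n) r / measure \<mu> (I n)) \<longlonglongrightarrow> d"
    and d: "0 \<le> d" "d \<le> 1" and \<epsilon>: "0 < \<epsilon>"
  shows "\<forall>\<^sub>F n in sequentially.
    (\<exists>C>0. \<forall>K. measure \<mu> (surv A K (I n)) \<le> C * exp (- (d - \<epsilon>) * measure \<mu> (I n) * real K)) \<and>
    (\<exists>C>0. \<forall>K. C * exp (- (d + \<epsilon>) * measure \<mu> (I n) * real K) \<le> measure \<mu> (surv A K (I n)))"
proof -
  define e where "e = min (1 / 2) (\<epsilon> / 22)"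
  have e: "0 < e" "e \<le> 1 / 2" "22 * e \<le> \<epsilon>" using \<epsilon> by (auto simp: e_def)
  obtain g where mix: "\<And>n U k V. determined A n U \<Longrightarrow> determined A k V \<Longrightarrow>
      \<bar>measure \<mu> (U \<inter> preim A (n + g) V) - measure \<mu> U * measure \<mu> V\<bar> \<le> e * (measure \<mu> U * measure \<mu> V)"
    by (rule mixing_upper[OF e(1)]) (rule that)
  obtain C where C: "0 < C" "\<And>n r N. 1 \<le> n \<Longrightarrow>
    (\<Sum>j\<in>{r<..N}. measure \<mu> (I n \<inter> preim A j (I n))) \<le> C * (\<rho> ^ r + real N * \<rho> ^ n) * measure \<mu> (I n)"
    by (rule return_sum[OF I(1,2) \<rho>]) (assumption | rule that)+
  obtain r1 where r1: "\<rho> ^ r1 < e / (2 * C)" using real_arch_pow_inv[of "e / (2 * C)" \<rho>] \<rho> e C by auto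
  define r where "r = max r0 r1"
  have "\<rho> ^ r \<le> \<rho> ^ r1" using \<rho> by (intro power_decreasing) (auto simp: r_def)
  then have "C * \<rho> ^ r \<le> C * (e / (2 * C))" using r1 C(1) by (intro mult_left_mono) auto
  then have r: "C * \<rho> ^ r \<le> e / 2" using C(1) by simp
  have sq: "(\<lambda>n. (real n)\<^sup>2 * \<rho> ^ n) \<longlonglongrightarrow> 0"
  proof -
    have "(\<lambda>n. real n * sqrt \<rho> ^ n) \<longlonglongrightarrow> 0" using \<rho> by (intro powser_times_n_limit_0) auto
    then have "(\<lambda>n. (real n * sqrt \<rho> ^ n)\<^sup>2) \<longlonglongrightarrow> 0\<^sup>2" by (rule tendsto_power)
    moreover have "(real n * sqrt \<rho> ^ n)\<^sup>2 = (real n)\<^sup>2 * \<rho> ^ n" for n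
    proof -
      have "(sqrt \<rho> ^ n)\<^sup>2 = (sqrt \<rho> ^ 2) ^ n" by (simp only: power_mult[symmetric] mult.commute)
      then show ?thesis using \<rho> by (simp add: power_mult_distrib)
    qed
    ultimately show ?thesis by simp
  qed
  have big: "\<forall>\<^sub>F n in sequentially. Z \<le> real n" for Z
    using filterlim_real_sequentially unfolding filterlim_at_top by blast
  have E1: "\<forall>\<^sub>F n in sequentially. dist (fresh (I n) r / measure \<mu> (I n)) d < e"
    using tendstoD[OF lim e(1)] by (simp add: r_def)
  have E2: "\<forall>\<^sub>F n in sequentially. C * ((real n)\<^sup>2 * \<rho> ^ n) < e / 2"
    by (rule order_tendstoD(2)[OF tendsto_mult[OF tendsto_const sq]]) (use e in auto)
  have E3: "\<forall>\<^sub>F n in sequentially. 9 * c * ((real n)\<^sup>2 * \<rho> ^ n) < e"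
    by (rule order_tendstoD(2)[OF tendsto_mult[OF tendsto_const sq]]) (use e in auto)
  show ?thesis
    using E1 E2 E3 big[of 1] big[of "real g"] big[of "2 / e"] big[of "real r / e"]
  proof eventually_elim
    case (elim n)
    define m where "m = measure \<mu> (I n)"
    \<comment> \<open>Long compared with the gap \<open>n + g\<close>, short compared with \<open>1 / m\<close>, which grows exponentially.\<close>
    define N where "N = n\<^sup>2"
    have n: "1 \<le> n" using elim(4) by simp
    have rN: "real N = (real n)\<^sup>2" by (simp add: N_def)
    have m: "0 < m" unfolding m_def by (rule full_support[OF I(1)[OF n] I(3)[OF n]])
    have N: "1 \<le> N" "real n \<le> real N" using n by (auto simp: N_def power2_eq_square)
    have "real r / e \<le> real N" using elim(7) N(2) by linarith
    then have N2: "real r \<le> e * real N" using e by (simp add: field_simps)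
    have N3: "real (n + g) \<le> e * real N"
    proof -
      have "real (n + g) \<le> 2 * real n" using elim(5) by simp
      also have "\<dots> \<le> (e * real n) * real n" using elim(6) e by (intro mult_right_mono) (auto simp: field_simps)
      also have "\<dots> = e * real N" by (simp add: rN power2_eq_square)
      finally show ?thesis .
    qed
    have fr: "(d - e) * m \<le> fresh (I n) r" "fresh (I n) r \<le> (d + e) * m"
    proof -
      have "\<bar>fresh (I n) r / m - d\<bar> < e" using elim(1) by (simp add: dist_real_def m_def)
      then have "d - e \<le> fresh (I n) r / m" "fresh (I n) r / m \<le> d + e" by (simp_all only: abs_less_iff) linarith+
      then show "(d - e) * m \<le> fresh (I n) r" "fresh (I n) r \<le> (d + e) * m" using m by (simp_all add: field_simps)
    qed
    have ret: "(\<Sum>j\<in>{r<..N}. measure \<mu> (I n \<inter> preim A j (I n))) \<le> e * m"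
    proof -
      have "C * (\<rho> ^ r + real N * \<rho> ^ n) \<le> e" using r elim(2) by (simp add: rN distrib_left)
      from mult_right_mono[OF this less_imp_le[OF m]] show ?thesis
        using C(2)[OF n, of r N] unfolding m_def by linarith
    qed
    have e5: "5 * e \<le> \<epsilon>" using e(1) e(3) by simp
    have Nm: "9 * real N * m \<le> e"
    proof -
      have "9 * real N * m \<le> 9 * real N * (c * \<rho> ^ n)"
        using \<rho>(3)[OF n] by (intro mult_left_mono) (auto simp: m_def)
      also have "\<dots> \<le> e" using elim(3) by (simp add: rN mult_ac)
      finally show ?thesis .
    qed
    show ?case
    proof
      show "\<exists>C>0. \<forall>K. measure \<mu> (surv A K (I n)) \<le> C * exp (- (d - \<epsilon>) * measure \<mu> (I n) * real K)"
        by (rule surv_upper_rate[OF I(1)[OF n] e(1,2) N(1) N2 N3 mix ret[unfolded m_def] fr(1)[unfolded m_def] d(2) e5])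
      show "\<exists>C>0. \<forall>K. C * exp (- (d + \<epsilon>) * measure \<mu> (I n) * real K) \<le> measure \<mu> (surv A K (I n))"
        by (rule surv_lower_rate[OF I(1)[OF n] e(1,2) N(1) N2 N3 mix fr(2)[unfolded m_def] Nm[unfolded m_def] d e(3)])
    qed
  qed
qed

end

section \<open>Escape rate of the special flow\<close>

lemma birkhoff_sum_0 [simp]: "birkhoff_sum f 0 x = 0"
  by (simp add: birkhoff_sum_def)

lemma roof_ge:
  assumes "\<forall>x\<in>subshift A. 1 < f x" "x \<in> subshift A"
  shows "real m \<le> birkhoff_sum f m x"
proof (induction m)
  case (Suc m)
  have "1 < f ((shift_map ^^ m) x)" using assms by auto
  then show ?case using Suc by (simp add: birkhoff_sum_Suc)
qed simp

lemma roof_strict_mono: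
  assumes "\<forall>x\<in>subshift A. 1 < f x" "x \<in> subshift A" "m < m'"
  shows "birkhoff_sum f m x < birkhoff_sum f m' x"
  using assms(3)
proof (induction rule: less_Suc_induct)
  case (1 i)
  have "1 < f ((shift_map ^^ i) x)" using assms(1,2) by auto
  then show ?case by (simp add: birkhoff_sum_Suc)
qed auto

lemma roof_lap:
  assumes f: "\<forall>x\<in>subshift A. 1 < f x" "x \<in> subshift A" and u: "0 \<le> u"
  shows "\<exists>!m. birkhoff_sum f m x \<le> u \<and> u < birkhoff_sum f (Suc m) x"
proof -
  obtain N where "u < real N" using reals_Archimedean2 by blast
  then have ex: "u < birkhoff_sum f (Suc N) x" using roof_ge[OF f, where m = "Suc N"] by simp
  define m where "m = (LEAST m. u < birkhoff_sum f (Suc m) x)"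
  have 1: "u < birkhoff_sum f (Suc m) x" unfolding m_def by (rule LeastI[of _ N]) (rule ex)
  have 2: "birkhoff_sum f m x \<le> u"
  proof (cases m)
    case (Suc k)
    then have "\<not> u < birkhoff_sum f (Suc k) x"
      using not_less_Least[of k "\<lambda>m. u < birkhoff_sum f (Suc m) x"] by (simp add: m_def)
    then show ?thesis using Suc by simp
  qed (use u in simp)
  show ?thesis
  proof (rule ex1I[of _ m])
    fix m' assume m': "birkhoff_sum f m' x \<le> u \<and> u < birkhoff_sum f (Suc m') x"
    have "\<not> m < m'"
    proof
      assume "m < m'"
      then have "Suc m = m' \<or> Suc m < m'" by auto
      then have "birkhoff_sum f (Suc m) x \<le> birkhoff_sum f m' x" using roof_strict_mono[OF f] by fastforce
      then show False using 1 m' by linarith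
    qed
    moreover have "\<not> m' < m"
    proof
      assume "m' < m"
      then have "Suc m' = m \<or> Suc m' < m" by auto
      then have "birkhoff_sum f (Suc m') x \<le> birkhoff_sum f m x" using roof_strict_mono[OF f] by fastforce
      then show False using 2 m' by linarith
    qed
    ultimately show "m' = m" by simp
  qed (use 1 2 in simp)
qed

text \<open>The section \<open>U \<times> {0}\<close> is met exactly when the flow completes a lap.\<close>

lemma special_flow_section:
  assumes f: "\<forall>x\<in>subshift A. 1 < f x" "x \<in> subshift A" and u: "0 \<le> l + s"
  shows "special_flow f s (x, l) \<in> U \<times> {0} \<longleftrightarrow> (\<exists>m. birkhoff_sum f m x = l + s \<and> (shift_map ^^ m) x \<in> U)"
proof -
  let ?P = "\<lambda>m. birkhoff_sum f m x \<le> l + s \<and> l + s < birkhoff_sum f (Suc m) x"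
  define m where "m = (THE m. ?P m)"
  have ex1: "\<exists>!m. ?P m" by (rule roof_lap[OF f u])
  have m: "?P m" unfolding m_def by (rule theI'[OF ex1])
  have flow: "special_flow f s (x, l) = ((shift_map ^^ m) x, l + s - birkhoff_sum f m x)"
    by (simp add: special_flow_def m_def Let_def)
  have "m' = m" if "birkhoff_sum f m' x = l + s" for m'
  proof -
    have "?P m'" using that roof_strict_mono[OF f, where m = m' and m' = "Suc m'"] by simp
    then show ?thesis using ex1 m by blast
  qed
  then show ?thesis unfolding flow by auto
qed

lemma disjoint_UN_singletons: "(\<Union>s\<in>J. {g s}) \<inter> V = {} \<longleftrightarrow> \<not> (\<exists>s\<in>J. g s \<in> V)"
  by blast

lemma survivor_set_section:
  assumes f: "\<forall>x\<in>subshift A. 1 < f x"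
  shows "survivor_set A f (U \<times> {0}) t =
    {p \<in> susp_space A f. \<forall>m. 1 \<le> m \<longrightarrow> birkhoff_sum f m (fst p) < snd p + t \<longrightarrow> (shift_map ^^ m) (fst p) \<notin> U}"
proof -
  have main: "(\<exists>s\<in>{0<..<t}. special_flow f s (x, l) \<in> U \<times> {0}) \<longleftrightarrow>
      (\<exists>m. 1 \<le> m \<and> birkhoff_sum f m x < l + t \<and> (shift_map ^^ m) x \<in> U)"
    if xl: "(x, l) \<in> susp_space A f" for x l
  proof -
    have x: "x \<in> subshift A" and l: "0 \<le> l" "l < f x" using xl by (auto simp: susp_space_def)
    show ?thesis
    proof
      assume "\<exists>s\<in>{0<..<t}. special_flow f s (x, l) \<in> U \<times> {0}"
      then obtain s where s: "0 < s" "s < t" "special_flow f s (x, l) \<in> U \<times> {0}" by auto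
      have ls: "0 \<le> l + s" using s l by simp
      obtain m where m: "birkhoff_sum f m x = l + s" "(shift_map ^^ m) x \<in> U"
        using iffD1[OF special_flow_section[OF f x ls] s(3)] by blast
      have "m \<noteq> 0" using m(1) s l by (cases m) auto
      then show "\<exists>m. 1 \<le> m \<and> birkhoff_sum f m x < l + t \<and> (shift_map ^^ m) x \<in> U"
        using m s by (intro exI[of _ m]) auto
    next
      assume "\<exists>m. 1 \<le> m \<and> birkhoff_sum f m x < l + t \<and> (shift_map ^^ m) x \<in> U"
      then obtain m where m: "1 \<le> m" "birkhoff_sum f m x < l + t" "(shift_map ^^ m) x \<in> U" by blast
      have "m = 1 \<or> 1 < m" using m(1) by auto
      then have "birkhoff_sum f 1 x \<le> birkhoff_sum f m x" using roof_strict_mono[OF f x, where m = 1 and m' = m] by auto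
      then have lm: "l < birkhoff_sum f m x" using l by (simp add: birkhoff_sum_def)
      define s where "s = birkhoff_sum f m x - l"
      have s: "s \<in> {0<..<t}" "0 \<le> l + s" "birkhoff_sum f m x = l + s" using lm m l by (auto simp: s_def)
      have "special_flow f s (x, l) \<in> U \<times> {0}"
        by (rule iffD2[OF special_flow_section[OF f x s(2)]]) (use s(3) m(3) in blast)
      then show "\<exists>s\<in>{0<..<t}. special_flow f s (x, l) \<in> U \<times> {0}" by (rule bexI[OF _ s(1)])
    qed
  qed
  show ?thesis unfolding survivor_set_def
  proof (rule Collect_cong, rule conj_cong[OF refl])
    fix q assume q: "q \<in> susp_space A f"
    obtain x l where xl: "q = (x, l)" by (cases q)
    have "(\<Union>s\<in>{0<..<t}. {special_flow f s q}) \<inter> U \<times> {0} = {} \<longleftrightarrow>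
        \<not> (\<exists>s\<in>{0<..<t}. special_flow f s q \<in> U \<times> {0})"
      by (rule disjoint_UN_singletons)
    also have "\<dots> \<longleftrightarrow> \<not> (\<exists>m. 1 \<le> m \<and> birkhoff_sum f m x < l + t \<and> (shift_map ^^ m) x \<in> U)"
      unfolding xl using main q xl by (simp only:)
    also have "\<dots> \<longleftrightarrow> (\<forall>m. 1 \<le> m \<longrightarrow> birkhoff_sum f m (fst q) < snd q + t \<longrightarrow> (shift_map ^^ m) (fst q) \<notin> U)"
      unfolding xl fst_conv snd_conv by blast
    finally show "(\<Union>s\<in>{0<..<t}. {special_flow f s q}) \<inter> U \<times> {0} = {} \<longleftrightarrow>
        (\<forall>m. 1 \<le> m \<longrightarrow> birkhoff_sum f m (fst q) < snd q + t \<longrightarrow> (shift_map ^^ m) (fst q) \<notin> U)" .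
  qed
qed

lemma escape_rate_ge:
  assumes "0 < C" "\<forall>\<^sub>F t in at_top. measure (susp_measure A f \<mu>) (survivor_set A f U t) \<le> C * exp (- a * t)"
  shows "ereal a \<le> escape_rate A f \<mu> U"
proof -
  let ?v = "\<lambda>t. measure (susp_measure A f \<mu>) (survivor_set A f U t)"
  have "\<forall>\<^sub>F t in at_top. ereal (1 / t) * ext_ln (?v t) \<le> ereal (ln C / t - a)"
    using assms(2) eventually_gt_at_top[of 0]
  proof eventually_elim
    case (elim t)
    show ?case
    proof (cases "?v t = 0")
      case True
      then show ?thesis using elim(2) by (simp add: ext_ln_def)
    next
      case False
      then have pos: "0 < ?v t" by (simp add: zero_less_measure_iff)
      have "ln (?v t) \<le> ln (C * exp (- a * t))" using elim(1) pos by simp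
      also have "\<dots> = ln C - a * t" using assms(1) by (simp add: ln_mult)
      finally have "ln (?v t) / t \<le> (ln C - a * t) / t" using elim(2) by (intro divide_right_mono) auto
      then show ?thesis using False elim(2) by (simp add: ext_ln_def diff_divide_distrib)
    qed
  qed
  then have "Limsup at_top (\<lambda>t. ereal (1 / t) * ext_ln (?v t)) \<le> Limsup at_top (\<lambda>t. ereal (ln C / t - a))"
    by (rule Limsup_mono)
  also have "\<dots> = ereal (- a)"
  proof (rule lim_imp_Limsup)
    have "((\<lambda>t. ln C / t - a) \<longlongrightarrow> 0 - a) at_top"
      by (intro tendsto_diff tendsto_const tendsto_divide_0[OF tendsto_const] filterlim_at_top_imp_at_infinity filterlim_ident)
    then show "((\<lambda>t. ereal (ln C / t - a)) \<longlongrightarrow> ereal (- a)) at_top" by simp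
  qed simp
  finally show ?thesis unfolding escape_rate_def using ereal_minus_le_minus by fastforce
qed

lemma escape_rate_le:
  assumes "0 < C" "\<forall>\<^sub>F t in at_top. C * exp (- a * t) \<le> measure (susp_measure A f \<mu>) (survivor_set A f U t)"
  shows "escape_rate A f \<mu> U \<le> ereal a"
proof -
  let ?v = "\<lambda>t. measure (susp_measure A f \<mu>) (survivor_set A f U t)"
  have "\<forall>\<^sub>F t in at_top. ereal (ln C / t - a) \<le> ereal (1 / t) * ext_ln (?v t)"
    using assms(2) eventually_gt_at_top[of 0]
  proof eventually_elim
    case (elim t)
    have pos: "0 < ?v t" using elim(1) assms(1) by (meson exp_gt_zero less_le_trans mult_pos_pos)
    have "ln C - a * t = ln (C * exp (- a * t))" using assms(1) by (simp add: ln_mult)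
    also have "\<dots> \<le> ln (?v t)" using elim(1) pos assms(1) by simp
    finally have "(ln C - a * t) / t \<le> ln (?v t) / t" using elim(2) by (intro divide_right_mono) auto
    then show ?case using pos elim(2) by (simp add: ext_ln_def diff_divide_distrib)
  qed
  then have "Limsup at_top (\<lambda>t. ereal (ln C / t - a)) \<le> Limsup at_top (\<lambda>t. ereal (1 / t) * ext_ln (?v t))"
    by (rule Limsup_mono)
  moreover have "Limsup at_top (\<lambda>t. ereal (ln C / t - a)) = ereal (- a)"
  proof (rule lim_imp_Limsup)
    have "((\<lambda>t. ln C / t - a) \<longlongrightarrow> 0 - a) at_top"
      by (intro tendsto_diff tendsto_const tendsto_divide_0[OF tendsto_const] filterlim_at_top_imp_at_infinity filterlim_ident)
    then show "((\<lambda>t. ereal (ln C / t - a)) \<longlongrightarrow> ereal (- a)) at_top" by simp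
  qed simp
  ultimately have "ereal (- a) \<le> Limsup at_top (\<lambda>t. ereal (1 / t) * ext_ln (?v t))" by simp
  then show ?thesis unfolding escape_rate_def using ereal_minus_le_minus by fastforce
qed

lemma ucont_uminus: "ucont A f \<Longrightarrow> ucont A (\<lambda>x. - f x)"
  unfolding ucont_def by (simp add: abs_minus_commute)

context mixing_measure
begin

text \<open>Approximation by a function of finitely many letters changes averages by at most \<open>\<epsilon>
  / 3\<close>.\<close>

lemma large_deviation_ucont:
  assumes f: "ucont A f" and \<epsilon>: "0 < \<epsilon>"
  obtains C \<delta> where "0 < C" "0 < \<delta>"
    "\<And>M. measure \<mu> {x \<in> X. real M * ((\<integral>x. f x \<partial>\<mu>) + \<epsilon>) \<le> birkhoff_sum f M x} \<le> C * exp (- \<delta> * real M)"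
proof -
  have \<epsilon>3: "0 < \<epsilon> / 3" using \<epsilon> by simp
  obtain k \<psi> where \<psi>: "depends_on A k \<psi>" "\<And>x. x \<in> X \<Longrightarrow> \<bar>f x - \<psi> x\<bar> < \<epsilon> / 3"
    by (rule ucont_approx[OF f \<epsilon>3]) (rule that)
  obtain C \<delta> where C: "0 < C" "0 < \<delta>"
    "\<And>M. measure \<mu> {x \<in> X. real M * ((\<integral>x. \<psi> x \<partial>\<mu>) + \<epsilon> / 3) \<le> birkhoff_sum \<psi> M x} \<le> C * exp (- \<delta> * real M)"
    by (rule large_deviation[OF \<psi>(1) \<epsilon>3]) (rule that)
  have "(\<integral>x. \<psi> x \<partial>\<mu>) \<le> (\<integral>x. f x + \<epsilon> / 3 \<partial>\<mu>)"
  proof (rule integral_le_bound)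
    show "integrable \<mu> \<psi>" by (rule depends_on_integrable[OF \<psi>(1)])
    show "integrable \<mu> (\<lambda>x. f x + \<epsilon> / 3)" using ucont_integrable[OF f] by simp
    fix x assume "x \<in> X"
    from \<psi>(2)[OF this] show "\<psi> x \<le> f x + \<epsilon> / 3" unfolding abs_less_iff by linarith
  qed
  then have E: "(\<integral>x. \<psi> x \<partial>\<mu>) \<le> (\<integral>x. f x \<partial>\<mu>) + \<epsilon> / 3"
    using ucont_integrable[OF f] by (simp add: prob_space)
  have "measure \<mu> {x \<in> X. real M * ((\<integral>x. f x \<partial>\<mu>) + \<epsilon>) \<le> birkhoff_sum f M x} \<le> C * exp (- \<delta> * real M)" for M
  proof -
    have "{x \<in> X. real M * ((\<integral>x. f x \<partial>\<mu>) + \<epsilon>) \<le> birkhoff_sum f M x}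
        \<subseteq> {x \<in> X. real M * ((\<integral>x. \<psi> x \<partial>\<mu>) + \<epsilon> / 3) \<le> birkhoff_sum \<psi> M x}"
    proof (intro subsetI CollectI conjI)
      fix x assume x: "x \<in> {x \<in> X. real M * ((\<integral>x. f x \<partial>\<mu>) + \<epsilon>) \<le> birkhoff_sum f M x}"
      then show "x \<in> X" by simp
      have "birkhoff_sum f M x - birkhoff_sum \<psi> M x \<le> (\<Sum>k<M. \<epsilon> / 3)"
        unfolding birkhoff_sum_def sum_subtractf[symmetric]
      proof (rule sum_mono)
        fix k
        have "(shift_map ^^ k) x \<in> X" using \<open>x \<in> X\<close> by auto
        from \<psi>(2)[OF this] show "f ((shift_map ^^ k) x) - \<psi> ((shift_map ^^ k) x) \<le> \<epsilon> / 3"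
          unfolding abs_less_iff by linarith
      qed
      moreover have "real M * ((\<integral>x. \<psi> x \<partial>\<mu>) + \<epsilon> / 3) \<le> real M * ((\<integral>x. f x \<partial>\<mu>) + \<epsilon> - \<epsilon> / 3)"
        using E by (intro mult_left_mono) auto
      moreover have "real M * ((\<integral>x. f x \<partial>\<mu>) + \<epsilon> - \<epsilon> / 3) = real M * ((\<integral>x. f x \<partial>\<mu>) + \<epsilon>) - real M * (\<epsilon> / 3)"
        by (simp only: right_diff_distrib)
      moreover have "(\<Sum>k<M. \<epsilon> / 3) = real M * (\<epsilon> / 3)" by simp
      moreover have "real M * ((\<integral>x. f x \<partial>\<mu>) + \<epsilon>) \<le> birkhoff_sum f M x" using x by simp
      ultimately show "real M * ((\<integral>x. \<psi> x \<partial>\<mu>) + \<epsilon> / 3) \<le> birkhoff_sum \<psi> M x" by linarith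
    qed
    moreover have "{x \<in> X. real M * ((\<integral>x. \<psi> x \<partial>\<mu>) + \<epsilon> / 3) \<le> birkhoff_sum \<psi> M x} \<in> sets \<mu>"
    proof -
      have "birkhoff_sum \<psi> M \<in> borel_measurable \<mu>"
        using integral_birkhoff_sum(1)[OF ucont_depends_on[OF \<psi>(1)], of M] by (rule borel_measurable_integrable)
      then have "{x \<in> space \<mu>. real M * ((\<integral>x. \<psi> x \<partial>\<mu>) + \<epsilon> / 3) \<le> birkhoff_sum \<psi> M x} \<in> sets \<mu>" by measurable
      then show ?thesis by (simp add: space_eq)
    qed
    ultimately have "measure \<mu> {x \<in> X. real M * ((\<integral>x. f x \<partial>\<mu>) + \<epsilon>) \<le> birkhoff_sum f M x}
        \<le> measure \<mu> {x \<in> X. real M * ((\<integral>x. \<psi> x \<partial>\<mu>) + \<epsilon> / 3) \<le> birkhoff_sum \<psi> M x}"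
      by (rule finite_measure_mono)
    then show ?thesis using C(3)[of M] by linarith
  qed
  with C(1,2) show ?thesis by (rule that)
qed

context
  fixes f :: "(nat \<Rightarrow> 's) \<Rightarrow> real"
  assumes f: "ucont A f" and f1: "\<forall>x\<in>X. 1 < f x"
begin

abbreviation "fbar \<equiv> \<integral>x. f x \<partial>\<mu>"
abbreviation "\<nu> \<equiv> susp_measure A f \<mu>"

lemma fbar_ge: "1 \<le> fbar"
proof -
  have "(\<integral>x. 1 \<partial>\<mu>) \<le> fbar"
    by (rule integral_le_bound) (use ucont_integrable[OF f] f1 in \<open>auto intro: less_imp_le\<close>)
  then show ?thesis by (simp add: prob_space)
qed

lemma f_measurable [measurable]: "f \<in> borel_measurable \<mu>"
  by (rule ucont_measurable[OF f])

lemma birkhoff_measurable [measurable]: "birkhoff_sum f m \<in> borel_measurable \<mu>"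
  using integral_birkhoff_sum(1)[OF f] by (rule borel_measurable_integrable)

lemma susp_space_sets: "susp_space A f \<in> sets (\<mu> \<Otimes>\<^sub>M lborel)"
proof -
  have "{p \<in> space (\<mu> \<Otimes>\<^sub>M lborel). 0 \<le> snd p \<and> snd p < f (fst p)} \<in> sets (\<mu> \<Otimes>\<^sub>M lborel)" by measurable
  moreover have "{p \<in> space (\<mu> \<Otimes>\<^sub>M lborel). 0 \<le> snd p \<and> snd p < f (fst p)} = susp_space A f"
    by (auto simp: susp_space_def space_pair_measure space_eq)
  ultimately show ?thesis by simp
qed

lemma survivor_sets:
  assumes U[measurable]: "U \<in> sets \<mu>"
  shows "survivor_set A f (U \<times> {0}) t \<in> sets (\<mu> \<Otimes>\<^sub>M lborel)"
proof -
  have "{p \<in> space (\<mu> \<Otimes>\<^sub>M lborel). \<forall>m. 1 \<le> m \<longrightarrow> birkhoff_sum f m (fst p) < snd p + t \<longrightarrow> (shift_map ^^ m) (fst p) \<notin> U}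
    \<in> sets (\<mu> \<Otimes>\<^sub>M lborel)" by measurable
  then have "susp_space A f \<inter> {p \<in> space (\<mu> \<Otimes>\<^sub>M lborel). \<forall>m. 1 \<le> m \<longrightarrow> birkhoff_sum f m (fst p) < snd p + t \<longrightarrow> (shift_map ^^ m) (fst p) \<notin> U}
    \<in> sets (\<mu> \<Otimes>\<^sub>M lborel)" by (rule sets.Int[OF susp_space_sets])
  moreover have "susp_space A f \<inter> {p \<in> space (\<mu> \<Otimes>\<^sub>M lborel). \<forall>m. 1 \<le> m \<longrightarrow> birkhoff_sum f m (fst p) < snd p + t \<longrightarrow> (shift_map ^^ m) (fst p) \<notin> U}
    = survivor_set A f (U \<times> {0}) t"
    using sets.sets_into_space[OF susp_space_sets] unfolding survivor_set_section[of A f, OF f1] by blast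
  ultimately show ?thesis by simp
qed

lemma emeasure_\<nu>:
  assumes "S \<in> sets (\<mu> \<Otimes>\<^sub>M lborel)" "S \<subseteq> susp_space A f"
  shows "emeasure \<nu> S = ennreal (1 / fbar) * emeasure (\<mu> \<Otimes>\<^sub>M lborel) S"
proof -
  have "susp_space A f \<inter> space (\<mu> \<Otimes>\<^sub>M lborel) \<in> sets (\<mu> \<Otimes>\<^sub>M lborel)"
    using susp_space_sets by auto
  then show ?thesis unfolding susp_measure_def emeasure_scale_measure
    using assms by (subst emeasure_restrict_space) auto
qed

lemma emeasure_rectangle:
  assumes "V \<in> sets \<mu>" "0 \<le> b"
  shows "emeasure (\<mu> \<Otimes>\<^sub>M lborel) (V \<times> {0..b}) = ennreal (measure \<mu> V * b)"
    and "emeasure (\<mu> \<Otimes>\<^sub>M lborel) (V \<times> {0..<b}) = ennreal (measure \<mu> V * b)"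
  using assms by (simp_all add: lborel.emeasure_pair_measure_Times emeasure_eq_measure ennreal_mult')

lemma measure_\<nu>_le:
  assumes S: "S \<in> sets (\<mu> \<Otimes>\<^sub>M lborel)" "S \<subseteq> susp_space A f" and V: "V \<in> sets \<mu>" "0 \<le> b" "S \<subseteq> V \<times> {0..b}"
  shows "measure \<nu> S \<le> measure \<mu> V * b / fbar"
proof -
  have "emeasure (\<mu> \<Otimes>\<^sub>M lborel) S \<le> ennreal (measure \<mu> V * b)"
    unfolding emeasure_rectangle(1)[OF V(1,2), symmetric] using V S by (intro emeasure_mono) auto
  then have "emeasure \<nu> S \<le> ennreal (1 / fbar) * ennreal (measure \<mu> V * b)"
    unfolding emeasure_\<nu>[OF S] by (intro mult_left_mono) auto
  also have "\<dots> = ennreal (measure \<mu> V * b / fbar)"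
    using fbar_ge V by (subst ennreal_mult'[symmetric]) auto
  finally show ?thesis using fbar_ge V unfolding measure_def by (intro enn2real_leI) auto
qed

lemma measure_\<nu>_ge:
  assumes S: "S \<in> sets (\<mu> \<Otimes>\<^sub>M lborel)" "S \<subseteq> susp_space A f" and V: "V \<in> sets \<mu>" "V \<times> {0..<1} \<subseteq> S"
  shows "measure \<mu> V / fbar \<le> measure \<nu> S"
proof -
  obtain F where F: "0 < F" "\<And>x. x \<in> X \<Longrightarrow> \<bar>f x\<bar> \<le> F" by (rule ucont_bounded[OF f]) (rule that)
  have "S \<subseteq> X \<times> {0..F}"
  proof
    fix p assume "p \<in> S"
    then obtain y l where p: "p = (y, l)" "y \<in> X" "0 \<le> l" "l < f y" using S(2) by (auto simp: susp_space_def)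
    then show "p \<in> X \<times> {0..F}" using F(2)[OF p(2)] by simp
  qed
  moreover have XX: "X \<in> sets \<mu>" using sets.top[of \<mu>] by (simp add: space_eq)
  then have "X \<times> {0..F} \<in> sets (\<mu> \<Otimes>\<^sub>M lborel)" by (intro pair_measureI) auto
  ultimately have "emeasure (\<mu> \<Otimes>\<^sub>M lborel) S \<le> emeasure (\<mu> \<Otimes>\<^sub>M lborel) (X \<times> {0..F})"
    by (rule emeasure_mono)
  also have "\<dots> = ennreal (measure \<mu> X * F)" using F(1) by (intro emeasure_rectangle XX) simp
  finally have "emeasure \<nu> S \<le> ennreal (1 / fbar) * ennreal (measure \<mu> X * F)"
    unfolding emeasure_\<nu>[OF S] by (intro mult_left_mono) auto
  also have "\<dots> < \<infinity>" by (simp add: ennreal_mult_less_top)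
  finally have fin: "emeasure \<nu> S < \<infinity>" .
  have "ennreal (measure \<mu> V / fbar) = ennreal (1 / fbar) * ennreal (measure \<mu> V * 1)"
    using fbar_ge by (subst ennreal_mult'[symmetric]) auto
  also have "\<dots> \<le> ennreal (1 / fbar) * emeasure (\<mu> \<Otimes>\<^sub>M lborel) S"
    unfolding emeasure_rectangle(2)[OF V(1) zero_le_one, symmetric] using V S
    by (intro mult_left_mono emeasure_mono) auto
  also have "\<dots> = emeasure \<nu> S" by (rule emeasure_\<nu>[OF S, symmetric])
  also have "\<dots> = ennreal (measure \<nu> S)" using fin by (intro emeasure_eq_ennreal_measure) auto
  finally show ?thesis by (simp add: ennreal_le_iff)
qed

lemma measure_section:
  assumes U: "U \<in> sets \<mu>"
  shows "measure \<nu> (U \<times> {0..1::real}) = measure \<mu> U / fbar"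
proof -
  have UX: "U \<subseteq> X" using sets.sets_into_space[OF U] by (simp add: space_eq)
  have S: "U \<times> {0..1::real} \<in> sets (\<mu> \<Otimes>\<^sub>M lborel)" "U \<times> {0..1::real} \<subseteq> susp_space A f"
  proof -
    show "U \<times> {0..1::real} \<in> sets (\<mu> \<Otimes>\<^sub>M lborel)" using U by (intro pair_measureI) auto
    show "U \<times> {0..1::real} \<subseteq> susp_space A f"
    proof
      fix p assume "p \<in> U \<times> {0..1::real}"
      then obtain y l where p: "p = (y, l)" "y \<in> U" "0 \<le> l" "l \<le> 1" by auto
      then have "y \<in> X" "1 < f y" using UX f1 by auto
      then show "p \<in> susp_space A f" using p by (simp add: susp_space_def)
    qed
  qed
  show ?thesis
    using measure_\<nu>_le[OF S U, of 1] measure_\<nu>_ge[OF S U] by force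
qed

text \<open>A surviving flow orbit either makes fewer than \<open>M = t / (fbar + \<epsilon>)\<close> laps, a
  large deviation, or its first \<open>M\<close> laps avoid \<open>U\<close>.\<close>

lemma flow_escape_ge:
  assumes U: "determined A n U" and \<epsilon>: "0 < \<epsilon>"
    and ld: "0 < C" "\<And>M. measure \<mu> {x \<in> X. real M * (fbar + \<epsilon>) \<le> birkhoff_sum f M x} \<le> C * exp (- \<delta> * real M)"
    and x: "0 \<le> x" "x \<le> \<delta>" and C': "0 < C'" "\<And>K. measure \<mu> (surv A K U) \<le> C' * exp (- x * real K)"
  shows "ereal (x / (fbar + \<epsilon>)) \<le> escape_rate A f \<mu> (U \<times> {0})"
proof -
  obtain F where F: "0 < F" "\<And>x. x \<in> X \<Longrightarrow> \<bar>f x\<bar> \<le> F" by (rule ucont_bounded[OF f]) (rule that)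
  have fe: "0 < fbar + \<epsilon>" using fbar_ge \<epsilon> by simp
  define D where "D = (C + C') * exp x * F / fbar"
  have D: "0 < D" using ld C' F fbar_ge by (simp add: D_def)
  have Us: "U \<in> sets \<mu>" using determined_sets[OF U] .
  have "measure \<nu> (survivor_set A f (U \<times> {0}) t) \<le> D * exp (- (x / (fbar + \<epsilon>)) * t)" if t: "0 < t" for t
  proof -
    define M where "M = nat \<lfloor>t / (fbar + \<epsilon>)\<rfloor>"
    have tf: "0 \<le> t / (fbar + \<epsilon>)" using t fe by simp
    have M: "real M \<le> t / (fbar + \<epsilon>)" "t / (fbar + \<epsilon>) \<le> real M + 1"
      unfolding M_def using tf by (simp_all, (linarith+)?)
    let ?E = "{x \<in> X. real M * (fbar + \<epsilon>) \<le> birkhoff_sum f M x}"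
    let ?Q = "preim A 1 (surv A M U)"
    have "{x \<in> space \<mu>. real M * (fbar + \<epsilon>) \<le> birkhoff_sum f M x} \<in> sets \<mu>" by measurable
    then have E: "?E \<in> sets \<mu>" by (simp add: space_eq)
    have SU: "surv A M U \<in> sets \<mu>" by (rule determined_sets[OF determined_surv[OF U]])
    then have Q: "?Q \<in> sets \<mu>" by auto
    have Mt: "real M * (fbar + \<epsilon>) \<le> t" using M(1) fe by (simp add: le_divide_eq)
    have sub: "survivor_set A f (U \<times> {0}) t \<subseteq> (?E \<union> ?Q) \<times> {0..F}"
    proof
      fix p assume "p \<in> survivor_set A f (U \<times> {0}) t"
      then obtain y l where p: "p = (y, l)" "y \<in> X" "0 \<le> l" "l < f y"
        and s: "\<And>m. 1 \<le> m \<Longrightarrow> birkhoff_sum f m y < l + t \<Longrightarrow> (shift_map ^^ m) y \<notin> U"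
        unfolding survivor_set_section[of A f, OF f1] by (cases p) (auto simp: susp_space_def)
      have "y \<in> ?Q" if "y \<notin> ?E"
      proof -
        have "birkhoff_sum f M y < t" using that p(2) Mt by auto
        then have "(shift_map ^^ Suc j) y \<notin> U" if "j < M" for j
          using s[of "Suc j"] roof_strict_mono[where m = "Suc j" and m' = M, OF f1 p(2)] that p(3)
          by (cases "Suc j = M") (auto simp del: funpow.simps)
        then show ?thesis using p(2) by (auto simp: preim_def surv_def funpow_swap1)
      qed
      moreover have "l \<le> F" using p(4) F(2)[OF p(2)] by simp
      ultimately show "p \<in> (?E \<union> ?Q) \<times> {0..F}" using p by auto
    qed
    have "measure \<nu> (survivor_set A f (U \<times> {0}) t) \<le> measure \<mu> (?E \<union> ?Q) * F / fbar"
      using sub F(1) E Q by (intro measure_\<nu>_le survivor_sets Us) (auto simp: survivor_set_def)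
    also have "\<dots> \<le> ((C + C') * exp (- x * real M)) * F / fbar"
    proof (intro divide_right_mono mult_right_mono)
      have "measure \<mu> (?E \<union> ?Q) \<le> measure \<mu> ?E + measure \<mu> ?Q" by (rule measure_Un_le[OF E Q])
      also have "measure \<mu> ?Q = measure \<mu> (surv A M U)" by (rule invariant[OF SU])
      also have "measure \<mu> ?E \<le> C * exp (- x * real M)"
      proof -
        have "C * exp (- \<delta> * real M) \<le> C * exp (- x * real M)"
          using x ld(1) by (simp add: mult_right_mono)
        then show ?thesis using ld(2)[of M] by linarith
      qed
      finally show "measure \<mu> (?E \<union> ?Q) \<le> (C + C') * exp (- x * real M)"
        using C'(2)[of M] by (simp add: distrib_right)
    qed (use F fbar_ge in auto)
    also have "\<dots> \<le> ((C + C') * (exp x * exp (- (x / (fbar + \<epsilon>)) * t))) * F / fbar"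
    proof (intro divide_right_mono mult_right_mono mult_left_mono)
      have "x * (t / (fbar + \<epsilon>)) \<le> x * (real M + 1)" using M(2) x by (intro mult_left_mono)
      then have "- x * real M \<le> x + - (x / (fbar + \<epsilon>)) * t" by (simp add: algebra_simps)
      then show "exp (- x * real M) \<le> exp x * exp (- (x / (fbar + \<epsilon>)) * t)" by (simp flip: exp_add)
    qed (use F fbar_ge ld C' in auto)
    also have "\<dots> = D * exp (- (x / (fbar + \<epsilon>)) * t)" by (simp add: D_def)
    finally show ?thesis .
  qed
  then show ?thesis
    by (intro escape_rate_ge[OF D] eventually_mono[OF eventually_gt_at_top[of 0]]) auto
qed

text \<open>If \<open>M\<close> laps avoid \<open>U\<close> and take the expected time, the flow orbit
  survives. Large deviations decay faster than the survival probability of the shift, since \<open>x <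
  \<delta>\<close>, so they remove at most half of it.\<close>

lemma flow_escape_le:
  assumes U: "determined A n U" and \<epsilon>: "0 < \<epsilon>" "\<epsilon> < fbar"
    and ld: "0 < C" "\<And>M. measure \<mu> {x \<in> X. birkhoff_sum f M x \<le> real M * (fbar - \<epsilon>)} \<le> C * exp (- \<delta> * real M)"
    and x: "0 \<le> x" "x < \<delta>" and C': "0 < C'" "\<And>K. C' * exp (- x * real K) \<le> measure \<mu> (surv A K U)"
  shows "escape_rate A f \<mu> (U \<times> {0}) \<le> ereal (x / (fbar - \<epsilon>))"
proof -
  have fe: "0 < fbar - \<epsilon>" using \<epsilon> by simp
  have Us: "U \<in> sets \<mu>" using determined_sets[OF U] .
  have "(\<lambda>M. C * exp (- (\<delta> - x)) ^ M) \<longlonglongrightarrow> C * 0"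
    using x by (intro tendsto_mult tendsto_const LIMSEQ_power_zero) auto
  then have "\<forall>\<^sub>F M in sequentially. C * exp (- (\<delta> - x)) ^ M < C' / 2"
    using C'(1) by (intro order_tendstoD(2)[where y = 0]) auto
  then obtain M0 where M0: "\<And>M. M0 \<le> M \<Longrightarrow> C * exp (- (\<delta> - x)) ^ M < C' / 2"
    by (auto simp: eventually_sequentially)
  define D where "D = C' / 2 * exp (- x * (1 / (fbar - \<epsilon>) + 1)) / fbar"
  have D: "0 < D" using C' fbar_ge by (simp add: D_def)
  have "D * exp (- (x / (fbar - \<epsilon>)) * t) \<le> measure \<nu> (survivor_set A f (U \<times> {0}) t)"
    if t: "0 < t" "real M0 * (fbar - \<epsilon>) \<le> t" for t
  proof -
    define M where "M = nat \<lceil>(t + 1) / (fbar - \<epsilon>)\<rceil>"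
    have tf: "0 \<le> (t + 1) / (fbar - \<epsilon>)" using t fe by simp
    have M: "(t + 1) / (fbar - \<epsilon>) \<le> real M" "real M \<le> (t + 1) / (fbar - \<epsilon>) + 1"
      unfolding M_def using tf by (simp_all, (linarith+)?)
    have "real M0 \<le> (t + 1) / (fbar - \<epsilon>)" using t fe by (simp add: le_divide_eq)
    then have MM0: "M0 \<le> M" using M(1) by linarith
    let ?E = "{x \<in> X. birkhoff_sum f (Suc M) x \<le> real (Suc M) * (fbar - \<epsilon>)}"
    let ?Q = "preim A 1 (surv A M U)"
    have "{x \<in> space \<mu>. birkhoff_sum f (Suc M) x \<le> real (Suc M) * (fbar - \<epsilon>)} \<in> sets \<mu>" by measurable
    then have E: "?E \<in> sets \<mu>" by (simp add: space_eq)
    have SU: "surv A M U \<in> sets \<mu>" by (rule determined_sets[OF determined_surv[OF U]])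
    then have Q: "?Q \<in> sets \<mu>" by auto
    have Mt: "t + 1 \<le> real (Suc M) * (fbar - \<epsilon>)"
    proof -
      have "t + 1 \<le> real M * (fbar - \<epsilon>)" using M(1) fe by (simp add: divide_le_eq)
      also have "\<dots> \<le> real (Suc M) * (fbar - \<epsilon>)" using fe by (intro mult_right_mono) auto
      finally show ?thesis .
    qed
    have sub: "(?Q - ?E) \<times> {0..<1} \<subseteq> survivor_set A f (U \<times> {0}) t"
    proof
      fix p assume "p \<in> (?Q - ?E) \<times> {0..<1::real}"
      moreover obtain y l where yl: "p = (y, l)" by (cases p)
      ultimately have p: "p = (y, l)" "y \<in> ?Q" "y \<notin> ?E" "0 \<le> l" "l < 1"
        unfolding yl mem_Sigma_iff Diff_iff atLeastLessThan_iff by blast+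
      have y: "y \<in> X" using p(2) by (simp add: preim_def)
      have big: "t + 1 < birkhoff_sum f (Suc M) y" 
      proof -
        have "\<not> birkhoff_sum f (Suc M) y \<le> real (Suc M) * (fbar - \<epsilon>)" using p(3) y by blast
        then show ?thesis using Mt by linarith
      qed
      have "(shift_map ^^ m) y \<notin> U" if m: "1 \<le> m" "birkhoff_sum f m y < l + t" for m
      proof -
        have "\<not> Suc M \<le> m"
        proof
          assume "Suc M \<le> m"
          then have "birkhoff_sum f (Suc M) y \<le> birkhoff_sum f m y"
            using roof_strict_mono[where m = "Suc M" and m' = m, OF f1 y] by (cases "Suc M = m") auto
          then show False using m(2) big p(5) by linarith
        qed
        moreover obtain j where j: "m = Suc j" using m(1) by (cases m) auto
        ultimately have "j < M" by simp
        then have "(shift_map ^^ j) (shift_map y) \<notin> U" using p(2) by (simp add: preim_def surv_def)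
        then show ?thesis using j by (simp add: funpow_swap1)
      qed
      moreover have "p \<in> susp_space A f" using p y bspec[OF f1 y] by (simp add: susp_space_def)
      ultimately show "p \<in> survivor_set A f (U \<times> {0}) t"
        unfolding survivor_set_section[of A f, OF f1] using p(1) by simp
    qed
    have "(C' / 2) * exp (- x * real M) \<le> measure \<mu> (?Q - ?E)"
    proof -
      have "measure \<mu> ?E \<le> C * exp (- \<delta> * real (Suc M))" by (rule ld(2))
      also have "\<dots> \<le> C * exp (- \<delta> * real M)" using ld(1) x by (simp add: mult_left_mono)
      also have "\<dots> = (C * exp (- (\<delta> - x)) ^ M) * exp (- x * real M)"
        by (simp add: algebra_simps flip: exp_of_nat_mult exp_add)
      also have "\<dots> \<le> (C' / 2) * exp (- x * real M)" using M0[OF MM0] by (intro mult_right_mono) auto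
      finally have 1: "measure \<mu> ?E \<le> (C' / 2) * exp (- x * real M)" .
      have "measure \<mu> ?Q = measure \<mu> (surv A M U)" by (rule invariant[OF SU])
      then have 2: "C' * exp (- x * real M) \<le> measure \<mu> ?Q" using C'(2)[of M] by simp
      have "measure \<mu> ?Q \<le> measure \<mu> ((?Q - ?E) \<union> ?E)" using Q E by (intro finite_measure_mono) auto
      also have "\<dots> \<le> measure \<mu> (?Q - ?E) + measure \<mu> ?E" using Q E by (intro measure_Un_le) auto
      finally show ?thesis using 1 2 by linarith
    qed
    then have "(C' / 2) * exp (- x * real M) / fbar \<le> measure \<mu> (?Q - ?E) / fbar"
      using fbar_ge by (intro divide_right_mono) auto
    also have "\<dots> \<le> measure \<nu> (survivor_set A f (U \<times> {0}) t)"
      using sub E Q by (intro measure_\<nu>_ge survivor_sets Us) (auto simp: survivor_set_def)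
    finally have 3: "(C' / 2) * exp (- x * real M) / fbar \<le> measure \<nu> (survivor_set A f (U \<times> {0}) t)" .
    have "D * exp (- (x / (fbar - \<epsilon>)) * t) = (C' / 2) * (exp (- x * (1 / (fbar - \<epsilon>) + 1)) * exp (- (x / (fbar - \<epsilon>)) * t)) / fbar"
      by (simp add: D_def)
    also have "\<dots> \<le> (C' / 2) * exp (- x * real M) / fbar"
    proof (intro divide_right_mono mult_left_mono)
      have "x * real M \<le> x * ((t + 1) / (fbar - \<epsilon>) + 1)" using M(2) x by (intro mult_left_mono)
      also have "\<dots> = x * (1 / (fbar - \<epsilon>) + 1) + x / (fbar - \<epsilon>) * t" by (simp add: add_divide_distrib algebra_simps)
      finally have "- x * (1 / (fbar - \<epsilon>) + 1) + - (x / (fbar - \<epsilon>)) * t \<le> - x * real M" by simp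
      then show "exp (- x * (1 / (fbar - \<epsilon>) + 1)) * exp (- (x / (fbar - \<epsilon>)) * t) \<le> exp (- x * real M)"
        unfolding exp_add[symmetric] exp_le_cancel_iff .
    qed (use C' fbar_ge in auto)
    finally show ?thesis using 3 by linarith
  qed
  then show ?thesis
    by (intro escape_rate_le[OF D] eventually_mono[OF eventually_conj[OF eventually_gt_at_top[of 0] eventually_ge_at_top[of "real M0 * (fbar - \<epsilon>)"]]]) auto
qed

end

end

section \<open>The local escape rate\<close>

lemma upper_ratio_bound:
  fixes b d h \<tau> :: real
  assumes "1 \<le> b" "d \<le> 1" "0 < h" "0 < \<tau>" "\<tau> \<le> 1 / 2" "5 * \<tau> \<le> h"
  shows "(d + \<tau>) * b \<le> (d + h) * (b - \<tau>)"
proof -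
  have "(d + h) * (b - \<tau>) - (d + \<tau>) * b =
      (h - \<tau>) * (b - 1) + (1 - d) * \<tau> + h * (1 / 2 - \<tau>) + (h / 2 - 2 * \<tau>)"
    by (simp add: field_simps)
  also have "0 \<le> \<dots>"
    by (intro add_nonneg_nonneg mult_nonneg_nonneg) (use assms in auto)
  finally show ?thesis by simp
qed

context mixing_measure
begin

lemma fresh_eq:
  assumes U: "determined A n U"
  shows "fresh U r = measure \<mu> U - measure \<mu> (\<Union>j\<in>{1..r}. U \<inter> preim A j U)"
proof -
  have sets: "U \<in> sets \<mu>" "(\<Union>j\<in>{1..r}. U \<inter> preim A j U) \<in> sets \<mu>"
    using determined_sets[OF U] by auto
  have "U \<inter> preim A 1 (surv A r U) = U - (\<Union>j\<in>{1..r}. U \<inter> preim A j U)"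
  proof (intro set_eqI iffI)
    fix x assume x: "x \<in> U \<inter> preim A 1 (surv A r U)"
    have "x \<notin> preim A j U" if "j \<in> {1..r}" for j
    proof -
      from \<open>j \<in> {1..r}\<close> obtain i where "j = Suc i" "i < r" by (cases j) auto
      moreover have "(shift_map ^^ i) (shift_map x) \<notin> U" using x \<open>i < r\<close> by (simp add: preim_def surv_def)
      ultimately show ?thesis by (simp add: preim_def funpow_swap1)
    qed
    then show "x \<in> U - (\<Union>j\<in>{1..r}. U \<inter> preim A j U)" using x by blast
  next
    fix x assume x: "x \<in> U - (\<Union>j\<in>{1..r}. U \<inter> preim A j U)"
    then have xX: "x \<in> X" using determined_subset[OF U] by blast
    have "(shift_map ^^ i) (shift_map x) \<notin> U" if "i < r" for i
    proof -
      have "x \<notin> preim A (Suc i) U" using x that by fastforce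
      then show ?thesis using xX by (simp add: preim_def funpow_swap1)
    qed
    then show "x \<in> U \<inter> preim A 1 (surv A r U)" using x xX by (auto simp: preim_def surv_def)
  qed
  then have "fresh U r = measure \<mu> (U - (\<Union>j\<in>{1..r}. U \<inter> preim A j U))" by (simp add: fresh_def)
  also have "\<dots> = measure \<mu> U - measure \<mu> (\<Union>j\<in>{1..r}. U \<inter> preim A j U)"
    using sets by (intro finite_measure_Diff) auto
  finally show ?thesis .
qed

text \<open>For large \<open>n\<close> the rate of the shift is below the rate of large deviations of
  \<open>f\<close>, so both flow estimates apply.\<close>

theorem flow_local_escape:
  assumes f: "ucont A f" and f1: "\<forall>x\<in>X. 1 < f x"
    and I: "\<And>n. 1 \<le> n \<Longrightarrow> determined A n (I n)" "\<And>n. 1 \<le> n \<Longrightarrow> I (Suc n) \<subseteq> I n" "\<And>n. 1 \<le> n \<Longrightarrow> I n \<noteq> {}"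
    and \<rho>: "0 < \<rho>" "\<rho> < 1" "\<And>n. 1 \<le> n \<Longrightarrow> measure \<mu> (I n) \<le> c * \<rho> ^ n"
    and lim: "\<And>r. r0 \<le> r \<Longrightarrow> (\<lambda>n. fresh (I n) r / measure \<mu> (I n)) \<longlonglongrightarrow> d"
    and d: "0 \<le> d" "d \<le> 1"
  shows "(\<lambda>n. escape_rate A f \<mu> (I n \<times> {0}) / ereal (measure (susp_measure A f \<mu>) (I n \<times> {0..1}))) \<longlonglongrightarrow> ereal d"
proof -
  let ?q = "\<lambda>n. escape_rate A f \<mu> (I n \<times> {0}) / ereal (measure (susp_measure A f \<mu>) (I n \<times> {0..1}))"
  let ?b = "\<integral>x. f x \<partial>\<mu>"
  have b: "1 \<le> ?b" by (rule fbar_ge[OF f f1])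
  have main: "\<forall>\<^sub>F n in sequentially. ereal (d - h) \<le> ?q n \<and> ?q n \<le> ereal (d + h)" if h: "0 < h" for h
  proof -
    \<comment> \<open>One small parameter for the base rate and for the large deviations; \<open>h / 5\<close> absorbs both errors.\<close>
    define \<tau> where "\<tau> = min (1 / 2) (h / 5)"
    have \<tau>: "0 < \<tau>" "\<tau> \<le> 1 / 2" "5 * \<tau> \<le> h" using h by (auto simp: \<tau>_def)
    obtain C1 \<delta>1 where C1: "0 < C1" "0 < \<delta>1"
      "\<And>M. measure \<mu> {x \<in> X. real M * (?b + \<tau>) \<le> birkhoff_sum f M x} \<le> C1 * exp (- \<delta>1 * real M)"
      by (rule large_deviation_ucont[OF f \<tau>(1)]) (rule that)
    obtain C2 \<delta>2 where C2: "0 < C2" "0 < \<delta>2"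
      "\<And>M. measure \<mu> {x \<in> X. real M * ((\<integral>x. - f x \<partial>\<mu>) + \<tau>) \<le> birkhoff_sum (\<lambda>x. - f x) M x} \<le> C2 * exp (- \<delta>2 * real M)"
      by (rule large_deviation_ucont[OF ucont_uminus[OF f] \<tau>(1)]) (rule that)
    have C2': "measure \<mu> {x \<in> X. birkhoff_sum f M x \<le> real M * (?b - \<tau>)} \<le> C2 * exp (- \<delta>2 * real M)" for M
    proof -
      have "real M * ((\<integral>x. - f x \<partial>\<mu>) + \<tau>) \<le> birkhoff_sum (\<lambda>x. - f x) M x \<longleftrightarrow> birkhoff_sum f M x \<le> real M * (?b - \<tau>)" for x
        by (simp add: birkhoff_sum_def sum_negf algebra_simps)
      then show ?thesis using C2(3)[of M] by simp
    qed
    define \<delta> where "\<delta> = min \<delta>1 \<delta>2"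
    have \<delta>: "0 < \<delta>" using C1 C2 by (simp add: \<delta>_def)
    have "(\<lambda>n. 2 * (c * \<rho> ^ n)) \<longlonglongrightarrow> 2 * (c * 0)"
      using \<rho> by (intro tendsto_mult tendsto_const LIMSEQ_power_zero) auto
    then have small: "\<forall>\<^sub>F n in sequentially. 2 * (c * \<rho> ^ n) < \<delta>"
      using \<delta> by (intro order_tendstoD(2)[where y = 0]) auto
    have base: "\<forall>\<^sub>F n in sequentially.
      (\<exists>C>0. \<forall>K. measure \<mu> (surv A K (I n)) \<le> C * exp (- (d - \<tau>) * measure \<mu> (I n) * real K)) \<and>
      (\<exists>C>0. \<forall>K. C * exp (- (d + \<tau>) * measure \<mu> (I n) * real K) \<le> measure \<mu> (surv A K (I n)))"
      by (rule base_escape[OF I \<rho> lim d \<tau>(1)])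
    show ?thesis
      using base small eventually_ge_at_top[of 1]
    proof eventually_elim
      case (elim n)
      define m where "m = measure \<mu> (I n)"
      have n: "1 \<le> n" by (rule elim(3))
      have m: "0 < m" unfolding m_def by (rule full_support[OF I(1)[OF n] I(3)[OF n]])
      have mb: "0 < m / ?b" using m b by simp
      have \<nu>: "measure (susp_measure A f \<mu>) (I n \<times> {0..1}) = m / ?b"
        unfolding m_def by (rule measure_section[OF f f1 determined_sets[OF I(1)[OF n]]])
      have m\<delta>: "2 * m < \<delta>" using elim(2) \<rho>(3)[OF n] by (simp add: m_def)
      have dm: "(d + \<tau>) * m < \<delta>"
      proof -
        have "(d + \<tau>) * m \<le> 2 * m" using d \<tau> m by (intro mult_right_mono) auto
        then show ?thesis using m\<delta> by linarith
      qed
      obtain K1 where K1: "0 < K1" "\<And>K. measure \<mu> (surv A K (I n)) \<le> K1 * exp (- (d - \<tau>) * m * real K)"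
        using elim(1) unfolding m_def by blast
      obtain K2 where K2: "0 < K2" "\<And>K. K2 * exp (- (d + \<tau>) * m * real K) \<le> measure \<mu> (surv A K (I n))"
        using elim(1) unfolding m_def by blast
      define x where "x = max 0 ((d - \<tau>) * m)"
      have x: "0 \<le> x" "x \<le> \<delta>1"
      proof -
        have "(d - \<tau>) * m \<le> (d + \<tau>) * m" using \<tau> m by (intro mult_right_mono) auto
        then show "x \<le> \<delta>1" using dm \<delta> unfolding x_def \<delta>_def by auto
      qed (simp add: x_def)
      have "\<exists>C'>0. \<forall>K. measure \<mu> (surv A K (I n)) \<le> C' * exp (- x * real K)"
      proof (cases "0 \<le> (d - \<tau>) * m")
        case True
        then have "- x = - (d - \<tau>) * m" unfolding minus_mult_left[symmetric] by (simp add: x_def)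
        then have "measure \<mu> (surv A K (I n)) \<le> K1 * exp (- x * real K)" for K using K1(2)[of K] by (simp only:)
        then show ?thesis using K1(1) by blast
      next
        case False
        then have "x = 0" by (simp add: x_def)
        then show ?thesis by (intro exI[of _ 1]) simp
      qed
      then obtain C' where C': "0 < C'" "\<And>K. measure \<mu> (surv A K (I n)) \<le> C' * exp (- x * real K)" by blast
      have "ereal (x / (?b + \<tau>)) \<le> escape_rate A f \<mu> (I n \<times> {0})"
        by (rule flow_escape_ge[OF f f1 I(1)[OF n] \<tau>(1) C1(1) C1(3) x C'])
      then have lo1: "ereal (x / (?b + \<tau>)) / ereal (m / ?b) \<le> ?q n"
        unfolding \<nu> by (rule ereal_divide_right_mono) (use mb in simp)
      have lo2: "ereal (x / (?b + \<tau>)) / ereal (m / ?b) = ereal (x / (?b + \<tau>) / (m / ?b))"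
        using mb m b by auto
      have lo3: "d - h \<le> x / (?b + \<tau>) / (m / ?b)"
      proof (cases "d - h \<le> 0")
        case True
        have "0 \<le> x / (?b + \<tau>) / (m / ?b)" using x m b \<tau> by simp
        then show ?thesis using True by linarith
      next
        case False
        have "(d - h) * \<tau> \<le> 1 * \<tau>" using d h \<tau> by (intro mult_right_mono) auto
        moreover have "(4 * \<tau>) * 1 \<le> (h - \<tau>) * ?b" using \<tau> b by (intro mult_mono) auto
        ultimately have "(d - h) * (?b + \<tau>) \<le> (d - \<tau>) * ?b" using \<tau> by (simp add: algebra_simps)
        then have "d - h \<le> (d - \<tau>) * ?b / (?b + \<tau>)" using b \<tau> by (simp add: le_divide_eq)
        also have "\<dots> = (d - \<tau>) * m / (?b + \<tau>) / (m / ?b)" using m b by simp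
        also have "\<dots> \<le> x / (?b + \<tau>) / (m / ?b)"
          using m b \<tau> by (intro divide_right_mono) (auto simp: x_def)
        finally show ?thesis .
      qed
      have "ereal (d - h) \<le> ereal (x / (?b + \<tau>) / (m / ?b))" using lo3 by (simp only: ereal_less_eq)
      then have 1: "ereal (d - h) \<le> ?q n" using lo1 unfolding lo2 by (rule order_trans)
      have x2: "0 \<le> (d + \<tau>) * m" "(d + \<tau>) * m < \<delta>2" using d \<tau> m dm by (auto simp: \<delta>_def)
      have K2': "K2 * exp (- ((d + \<tau>) * m) * real K) \<le> measure \<mu> (surv A K (I n))" for K
        using K2(2)[of K] unfolding minus_mult_left[symmetric] .
      have \<tau>b: "\<tau> < ?b" using \<tau> b by linarith
      have "escape_rate A f \<mu> (I n \<times> {0}) \<le> ereal ((d + \<tau>) * m / (?b - \<tau>))"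
        by (rule flow_escape_le[OF f f1 I(1)[OF n] \<tau>(1) \<tau>b C2(1) C2' x2 K2(1) K2'])
      then have up1: "?q n \<le> ereal ((d + \<tau>) * m / (?b - \<tau>)) / ereal (m / ?b)"
        unfolding \<nu> by (rule ereal_divide_right_mono) (use mb in simp)
      have up2: "ereal ((d + \<tau>) * m / (?b - \<tau>)) / ereal (m / ?b) = ereal ((d + \<tau>) * m / (?b - \<tau>) / (m / ?b))"
        using mb m b by auto
      have up3: "(d + \<tau>) * m / (?b - \<tau>) / (m / ?b) \<le> d + h"
      proof -
        have "(d + \<tau>) * ?b \<le> (d + h) * (?b - \<tau>)"
          by (rule upper_ratio_bound) (use b d h \<tau> in auto)
        then have "(d + \<tau>) * ?b / (?b - \<tau>) \<le> d + h" using \<tau>b by (simp add: divide_le_eq)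
        moreover have "(d + \<tau>) * m / (?b - \<tau>) / (m / ?b) = (d + \<tau>) * ?b / (?b - \<tau>)" using m b by simp
        ultimately show ?thesis by simp
      qed
      have "ereal ((d + \<tau>) * m / (?b - \<tau>) / (m / ?b)) \<le> ereal (d + h)" using up3 by (simp only: ereal_less_eq)
      with up1[unfolded up2] have "?q n \<le> ereal (d + h)" by (rule order_trans)
      with 1 show ?case by blast
    qed
  qed
  show ?thesis
  proof (rule order_tendstoI)
    fix a assume "a < ereal d"
    then obtain y where y: "a < ereal y" "ereal y < ereal d" using ereal_dense2 by blast
    have "\<forall>\<^sub>F n in sequentially. ereal (d - (d - y)) \<le> ?q n \<and> ?q n \<le> ereal (d + (d - y))"
      by (rule main) (use y in simp)
    then show "\<forall>\<^sub>F n in sequentially. a < ?q n"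
      by (rule eventually_mono) (use y in \<open>auto intro: less_le_trans\<close>)
  next
    fix a assume "ereal d < a"
    then obtain y where y: "ereal d < ereal y" "ereal y < a" using ereal_dense2 by blast
    have "\<forall>\<^sub>F n in sequentially. ereal (d - (y - d)) \<le> ?q n \<and> ?q n \<le> ereal (d + (y - d))"
      by (rule main) (use y in simp)
    then show "\<forall>\<^sub>F n in sequentially. ?q n < a"
      by (rule eventually_mono) (use y in \<open>auto intro: le_less_trans\<close>)
  qed
qed

text \<open>For large \<open>n\<close> the points of \<open>I n\<close> share with \<open>z\<close> a prefix
  that contains a letter at which \<open>z\<close> and \<open>\<sigma>\<^sup>j z\<close> differ.\<close>

lemma eventually_no_return:
  assumes z: "(shift_map ^^ j) z \<noteq> z"
    and sub: "\<And>n. 1 \<le> n \<Longrightarrow> I n \<subseteq> cylinder A z (l n)" and l: "\<And>L::nat. \<forall>\<^sub>F n in sequentially. L \<le> l n"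
  shows "\<forall>\<^sub>F n in sequentially. I n \<inter> preim A j (I n) = {}"
proof -
  obtain i where i: "z (i + j) \<noteq> z i" using z by (auto simp: shift_map_funpow fun_eq_iff)
  show ?thesis
    using l[of "Suc (i + j)"] eventually_ge_at_top[of 1]
  proof eventually_elim
    case (elim n)
    show ?case
    proof (rule ccontr)
      assume "I n \<inter> preim A j (I n) \<noteq> {}"
      then obtain x where x: "x \<in> I n" "(shift_map ^^ j) x \<in> I n" by (auto simp: preim_def)
      have "agree (l n) x z" "agree (l n) ((shift_map ^^ j) x) z"
        using x sub[OF elim(2)] by (auto simp: mem_cylinder)
      then have "x (i + j) = z (i + j)" "(shift_map ^^ j) x i = z i"
        using elim(1) by (auto simp: agree_def)
      then show False using i by (simp add: shift_map_funpow_apply)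
    qed
  qed
qed

lemma fresh_limit_aperiodic:
  assumes z: "\<And>j. 1 \<le> j \<Longrightarrow> (shift_map ^^ j) z \<noteq> z"
    and I: "\<And>n. 1 \<le> n \<Longrightarrow> determined A n (I n)" "\<And>n. 1 \<le> n \<Longrightarrow> I n \<noteq> {}"
    and sub: "\<And>n. 1 \<le> n \<Longrightarrow> I n \<subseteq> cylinder A z (l n)" and l: "\<And>L::nat. \<forall>\<^sub>F n in sequentially. L \<le> l n"
  shows "(\<lambda>n. fresh (I n) r / measure \<mu> (I n)) \<longlonglongrightarrow> 1"
proof (rule tendsto_eventually)
  have "\<forall>\<^sub>F n in sequentially. \<forall>j\<in>{1..r}. I n \<inter> preim A j (I n) = {}"
    by (intro eventually_ball_finite ballI eventually_no_return[where z = z and l = l] z sub l) auto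
  then show "\<forall>\<^sub>F n in sequentially. fresh (I n) r / measure \<mu> (I n) = 1"
    using eventually_ge_at_top[of 1]
  proof eventually_elim
    case (elim n)
    have "0 < measure \<mu> (I n)" using full_support[OF I(1) I(2)] elim(2) by simp
    moreover have "(\<Union>j\<in>{1..r}. I n \<inter> preim A j (I n)) = {}" using elim(1) by blast
    ultimately show ?case using fresh_eq[OF I(1)[OF elim(2)], of r] by simp
  qed
qed

end

text \<open>The last clause of the nested condition turns a return at a multiple of \<open>p\<close> into a
  return at time \<open>p\<close>, by descending along the multiples. So the returning points are
  \<open>[z]\<^sub>p \<inter> \<sigma>\<^sup>-\<^sup>p (I n)\<close>, whose measure is given by the
  Jacobian.\<close>

lemma (in gibbs_measure) fresh_limit_periodic:
  assumes zX: "z \<in> X" and p: "prime_period z p"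
    and I: "\<And>n. 1 \<le> n \<Longrightarrow> determined A n (I n)" "\<And>n. 1 \<le> n \<Longrightarrow> I n \<noteq> {}"
    and sub: "\<And>n. 1 \<le> n \<Longrightarrow> I n \<subseteq> cylinder A z (l n)" and l: "\<And>L::nat. \<forall>\<^sub>F n in sequentially. L \<le> l n"
    and bwd: "\<forall>\<^sub>F n in sequentially. (shift_map ^^ p) -` I n \<inter> cylinder A z p \<subseteq> I n"
    and r: "p \<le> r"
  shows "(\<lambda>n. mixing_measure.fresh A \<mu> (I n) r / measure \<mu> (I n)) \<longlonglongrightarrow> 1 - Gprod p z"
proof -
  interpret mixing_measure A \<mu> by (rule gibbs_mixing)
  have pz: "0 < p" "(shift_map ^^ p) z = z" "\<And>q. 0 < q \<Longrightarrow> q < p \<Longrightarrow> (shift_map ^^ q) z \<noteq> z"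
    using p by (auto simp: prime_period_def)
  have mult: "(shift_map ^^ (k * p)) z = z" for k
    by (induction k) (simp_all add: funpow_add pz(2))
  have nz: "(shift_map ^^ j) z \<noteq> z" if "\<not> p dvd j" for j
  proof -
    have "j = j mod p + (j div p) * p" by simp
    then have "(shift_map ^^ j) z = (shift_map ^^ (j mod p)) ((shift_map ^^ ((j div p) * p)) z)"
      by (metis comp_apply funpow_add)
    moreover have "(shift_map ^^ (j mod p)) z \<noteq> z"
      using that pz(1) by (intro pz(3)) (auto simp: dvd_eq_mod_eq_0)
    ultimately show ?thesis by (simp only: mult not_False_eq_True)
  qed
  have E1: "\<forall>\<^sub>F n in sequentially. \<forall>j\<in>{j\<in>{1..r}. \<not> p dvd j}. I n \<inter> preim A j (I n) = {}"
    by (intro eventually_ball_finite ballI eventually_no_return[where z = z and l = l] nz sub l) auto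
  have key: "\<forall>\<^sub>F n in sequentially. \<bar>fresh (I n) r / measure \<mu> (I n) - (1 - Gprod p z)\<bar>
      \<le> Gprod p z * (exp (B * \<beta> ^ l n) - exp (- B * \<beta> ^ l n))"
    using E1 bwd l[of "Suc (r + p)"] eventually_ge_at_top[of 1]
  proof eventually_elim
    case (elim n)
    let ?U = "I n"
    have n: "1 \<le> n" by (rule elim(4))
    note U = I(1)[OF n]
    have m: "0 < measure \<mu> ?U" by (rule full_support[OF U I(2)[OF n]])
    have UX: "?U \<subseteq> X" by (rule determined_subset[OF U])
    have descend: "(shift_map ^^ p) x \<in> ?U" if "x \<in> ?U" "(shift_map ^^ (Suc k * p)) x \<in> ?U" "Suc k * p \<le> r" for x k
      using that(2,3)
    proof (induction k)
      case (Suc k)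
      let ?y = "(shift_map ^^ (Suc k * p)) x"
      have "agree (l n) x z" using that(1) sub[OF n] by (auto simp: mem_cylinder)
      moreover have "Suc k * p + p \<le> l n" using Suc.prems(2) elim(3) by simp
      ultimately have "agree (Suc k * p + p) x z" by (rule agree_mono)
      then have "agree p ?y ((shift_map ^^ (Suc k * p)) z)" by (rule agree_shift)
      then have "agree p ?y z" by (simp only: mult)
      then have "?y \<in> cylinder A z p" using that(1) UX by (auto simp: mem_cylinder)
      moreover have "(shift_map ^^ p) ?y \<in> ?U"
      proof -
        have "p + Suc k * p = Suc (Suc k) * p" by simp
        then have "(shift_map ^^ p) ?y = (shift_map ^^ (Suc (Suc k) * p)) x"
          by (metis comp_apply funpow_add)
        then show ?thesis using Suc.prems(1) by simp
      qed
      ultimately have "?y \<in> ?U" using elim(2) by blast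
      then show ?case using Suc.IH Suc.prems(2) by simp
    qed simp
    have ret: "(\<Union>j\<in>{1..r}. ?U \<inter> preim A j ?U) = ?U \<inter> preim A p ?U"
    proof (intro equalityI subsetI)
      fix x assume "x \<in> (\<Union>j\<in>{1..r}. ?U \<inter> preim A j ?U)"
      then obtain j where j: "1 \<le> j" "j \<le> r" "x \<in> ?U" "x \<in> preim A j ?U" by auto
      have "p dvd j" using elim(1) j by fastforce
      then obtain k' where "j = k' * p" by (metis dvdE mult.commute)
      moreover then obtain k where "k' = Suc k" using j(1) by (cases k') auto
      ultimately have k: "j = Suc k * p" by simp
      have "(shift_map ^^ p) x \<in> ?U"
        by (rule descend[of x k]) (use j k in \<open>auto simp: preim_def simp del: mult_Suc\<close>)
      then show "x \<in> ?U \<inter> preim A p ?U" using j(3) UX by (auto simp: preim_def)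
    next
      fix x assume "x \<in> ?U \<inter> preim A p ?U"
      then show "x \<in> (\<Union>j\<in>{1..r}. ?U \<inter> preim A j ?U)" using pz(1) r by (intro UN_I[of p]) auto
    qed
    have "?U \<inter> preim A p ?U = cylinder A z p \<inter> preim A p ?U"
    proof -
      have "x \<in> cylinder A z p" if "x \<in> ?U" for x
        using that sub[OF n] elim(3) UX agree_mono[of "l n" x z p] by (auto simp: mem_cylinder)
      then show ?thesis using elim(2) by (auto simp: preim_def)
    qed
    then have fr: "fresh ?U r = measure \<mu> ?U - measure \<mu> (cylinder A z p \<inter> preim A p ?U)"
      using fresh_eq[OF U, of r] ret by simp
    have V: "?U \<subseteq> cylinder A ((shift_map ^^ p) z) (l n)" using sub[OF n] by (simp add: pz(2))
    have "1 \<le> l n" using elim(3) by simp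
    note J = jacobian_bounds[OF zX U V this]
    let ?r = "measure \<mu> (cylinder A z p \<inter> preim A p ?U) / measure \<mu> ?U"
    have 1: "?r \<le> Gprod p z * exp (B * \<beta> ^ l n)" "Gprod p z * exp (- B * \<beta> ^ l n) \<le> ?r"
      using J m by (simp_all add: divide_le_eq le_divide_eq mult_ac)
    have g: "0 < Gprod p z" by (rule Gprod_pos[OF zX])
    have "0 \<le> B * \<beta> ^ l n" using B_nonneg beta by simp
    then have "exp (- B * \<beta> ^ l n) \<le> 1" "1 \<le> exp (B * \<beta> ^ l n)" by simp_all
    then have 2: "Gprod p z * exp (- B * \<beta> ^ l n) \<le> Gprod p z * 1" "Gprod p z * 1 \<le> Gprod p z * exp (B * \<beta> ^ l n)"
      using g by (intro mult_left_mono; simp)+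
    have "fresh ?U r / measure \<mu> ?U = 1 - ?r" using m by (simp add: fr diff_divide_distrib)
    then show ?case unfolding right_diff_distrib abs_le_iff using 1 2 by linarith
  qed
  have "filterlim l at_top sequentially" unfolding filterlim_at_top using l by blast
  then have "(\<lambda>n. \<beta> ^ l n) \<longlonglongrightarrow> 0"
    by (rule filterlim_compose[rotated]) (use beta in \<open>intro LIMSEQ_power_zero; simp\<close>)
  then have "(\<lambda>n. Gprod p z * (exp (B * \<beta> ^ l n) - exp (- B * \<beta> ^ l n))) \<longlonglongrightarrow> Gprod p z * (exp (B * 0) - exp (- B * 0))"
    by (intro tendsto_intros)
  then have "(\<lambda>n. Gprod p z * (exp (B * \<beta> ^ l n) - exp (- B * \<beta> ^ l n))) \<longlonglongrightarrow> 0" by simp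
  then have "(\<lambda>n. fresh (I n) r / measure \<mu> (I n) - (1 - Gprod p z)) \<longlonglongrightarrow> 0"
    by (rule Lim_null_comparison[rotated]) (use key in simp)
  then show ?thesis by (simp add: LIM_zero_iff)
qed

theorem theorem1p2:
  fixes A :: "nat ^ 's ^ 's"
    and \<theta> :: real
    and \<phi> f :: "(nat \<Rightarrow> 's) \<Rightarrow> real"
    and \<mu> :: "(nat \<Rightarrow> 's) measure"
    and I :: "nat \<Rightarrow> (nat \<Rightarrow> 's) set"
    and z :: "nat \<Rightarrow> 's"
  assumes "CARD('s) \<ge> 2"
    and "aperiodic_01_matrix A"
    and "0 < \<theta>" and "\<theta> < 1"
    and "Hoelder_on (subshift_metric \<theta> A) \<phi>"
    and "equilibrium_state \<theta> A \<phi> \<mu>"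
    and "Lipschitz_continuous_map (subshift_metric \<theta> A) euclidean_metric f"
    and "\<And>x. x \<in> subshift A \<Longrightarrow> f x > 1"
    and "nested_condition \<theta> A \<mu> I z"
  shows "W_const A f \<mu> \<ge> 2 \<and>
    (\<exists>L::real.
      (\<lambda>n. escape_rate A f \<mu> (I n \<times> {0}) /
            ereal (measure (susp_measure A f \<mu>) (I n \<times> {0..1}))) \<longlonglongrightarrow> ereal L \<and>
      ((\<nexists>p. prime_period z p) \<longrightarrow> L \<ge> 1 / W_const A f \<mu>) \<and>
      (\<forall>p. prime_period z p \<longrightarrow>
         L \<ge> (1 - exp ((\<Sum>k<p. \<phi> ((shift_map ^^ k) z)) - real p * pressure \<phi> \<mu>)) / W_const A f \<mu>))"
proof -
  note \<theta> = assms(3,4)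
  obtain G \<beta> c where gibbs: "gibbs_measure A G \<beta> c \<mu>"
    and per: "\<And>z p. z \<in> subshift A \<Longrightarrow> (shift_map ^^ p) z = z \<Longrightarrow>
      (\<Prod>k<p. G ((shift_map ^^ k) z)) = exp ((\<Sum>k<p. \<phi> ((shift_map ^^ k) z)) - real p * pressure \<phi> \<mu>)"
    by (rule equilibrium_gibbs[OF assms(2-6)]) (rule that)
  interpret gibbs_measure A G \<beta> c \<mu> by (rule gibbs)
  interpret mixing_measure A \<mu> by (rule gibbs_mixing)
  have f1: "\<forall>x\<in>X. 1 < f x" using assms(8) by blast
  obtain Lf where Lf: "\<And>x y. x \<in> X \<Longrightarrow> y \<in> X \<Longrightarrow> \<bar>f x - f y\<bar> \<le> Lf * d_theta \<theta> x y"
    using assms(7) unfolding Lipschitz_continuous_map_def mspace_subshift_metric[OF \<theta>] mdist_subshift_metric[OF \<theta>]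
    by (auto simp: dist_real_def)
  have f: "ucont A f"
  proof (rule ucont_exp_bound[OF \<theta>])
    fix k x y assume xy: "x \<in> X" "y \<in> X" "agree k x y"
    have d: "0 \<le> d_theta \<theta> x y" using \<theta> by (simp add: d_theta_def)
    have "f x - f y \<le> Lf * d_theta \<theta> x y" using Lf[OF xy(1,2)] by simp
    also have "\<dots> \<le> \<bar>Lf\<bar> * \<theta> ^ k" using d d_theta_le[OF \<theta> xy(3)] by (intro mult_mono) auto
    finally show "f x - f y \<le> \<bar>Lf\<bar> * \<theta> ^ k" .
  qed
  let ?b = "\<integral>x. f x \<partial>\<mu>"
  have b: "1 \<le> ?b" by (rule fbar_ge[OF f f1])
  obtain F where F: "\<And>x. x \<in> X \<Longrightarrow> \<bar>f x\<bar> \<le> F" by (rule ucont_bounded[OF f]) (rule that)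
  let ?S = "SUP x\<in>X. \<bar>f x\<bar>"
  have fS: "f x \<le> ?S" if "x \<in> X" for x
  proof -
    have "\<bar>f x\<bar> \<le> ?S" by (rule cSUP_upper[OF that]) (use F in \<open>auto intro!: bdd_aboveI2\<close>)
    then show ?thesis by linarith
  qed
  have "?b \<le> (\<integral>x. ?S \<partial>\<mu>)" by (rule integral_le_bound[OF ucont_integrable[OF f]]) (use fS in auto)
  then have bS: "?b \<le> ?S" by (simp add: prob_space)
  have W: "2 \<le> W_const A f \<mu>" unfolding W_const_def using bS b by (simp add: le_divide_eq)

  note N1 = assms(9)[unfolded nested_condition_def]
  note N2 = conjunct2[OF N1]
  note N3 = conjunct2[OF N2]
  note N4 = conjunct2[OF N3]
  note N5 = conjunct2[OF N4]
  note N6 = conjunct2[OF N5]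
  note N7 = conjunct2[OF N6]
  note unions = conjunct1[OF N2, rule_format]
  note decr = conjunct1[OF N3, rule_format]
  note zX = conjunct1[OF N4]
  note inter = conjunct1[OF N5]
  note bwd = conjunct2[OF N7, rule_format]
  obtain c0 \<rho> where \<rho>01: "0 < \<rho>" "\<rho> < 1" and \<rho>_all: "\<forall>n\<ge>1. measure \<mu> (I n) \<le> c0 * \<rho> ^ n"
    using conjunct1[OF N6] by (elim exE conjE) (rule that)
  note \<rho> = \<rho>01 \<rho>_all[rule_format]
  obtain l \<kappa> where \<kappa>: "0 < \<kappa>"
    and l_all: "\<forall>n\<ge>1. l n \<ge> 1 \<and> \<kappa> < real (l n) / real n \<and> real (l n) / real n \<le> 1 \<and> I n \<subseteq> cylinder A z (l n)"
    using conjunct1[OF N7] by (elim exE conjE) (rule that)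
  have \<kappa>l: "\<kappa> < real (l n) / real n" and sub: "I n \<subseteq> cylinder A z (l n)" if "1 \<le> n" for n
    using l_all[rule_format, OF that] by simp_all
  have det: "determined A n (I n)" if "1 \<le> n" for n
  proof -
    obtain F where "I n = (\<Union>x\<in>F. cylinder A x n)" using unions[OF \<open>1 \<le> n\<close>] by blast
    then show ?thesis by (simp add: determined_UN determined_cylinder)
  qed
  have ne: "I n \<noteq> {}" if n: "1 \<le> n" for n
  proof -
    have "z \<in> (\<Inter>n\<in>{1..}. I n)" by (simp only: inter singletonI)
    then have "z \<in> I n" by (rule INT_D) (use n in simp)
    then show ?thesis by blast
  qed
  have l: "\<forall>\<^sub>F n in sequentially. L \<le> l n" for L :: nat
  proof -
    have "\<forall>\<^sub>F n in sequentially. real L / \<kappa> \<le> real n"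
      using filterlim_real_sequentially unfolding filterlim_at_top by blast
    then show ?thesis using eventually_ge_at_top[of 1]
    proof eventually_elim
      case (elim n)
      have "real L \<le> \<kappa> * real n" using elim(1) \<kappa> by (simp add: field_simps)
      also have "\<dots> < real (l n)" using \<kappa>l[OF elim(2)] elim(2) by (simp add: less_divide_eq)
      finally show ?case by simp
    qed
  qed
  let ?q = "\<lambda>n. escape_rate A f \<mu> (I n \<times> {0}) / ereal (measure (susp_measure A f \<mu>) (I n \<times> {0..1}))"
  have shrink: "d / W_const A f \<mu> \<le> d" if "0 \<le> d" for d
  proof -
    have "d * 1 \<le> d * W_const A f \<mu>" using W that by (intro mult_left_mono) auto
    then show ?thesis using W by (simp add: divide_le_eq)
  qed
  have "\<exists>L::real. ?q \<longlonglongrightarrow> ereal L \<and>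
      ((\<nexists>p. prime_period z p) \<longrightarrow> L \<ge> 1 / W_const A f \<mu>) \<and>
      (\<forall>p. prime_period z p \<longrightarrow>
         L \<ge> (1 - exp ((\<Sum>k<p. \<phi> ((shift_map ^^ k) z)) - real p * pressure \<phi> \<mu>)) / W_const A f \<mu>)"
  proof (cases "\<exists>p. prime_period z p")
    case True
    then obtain p where p: "prime_period z p" by blast
    have uniq: "p' = p" if "prime_period z p'" for p'
    proof -
      have "\<not> p' < p" "\<not> p < p'" using p that unfolding prime_period_def by blast+
      then show ?thesis by simp
    qed
    let ?g = "Gprod p z"
    have g: "?g = exp ((\<Sum>k<p. \<phi> ((shift_map ^^ k) z)) - real p * pressure \<phi> \<mu>)"
      unfolding Gprod_def using p by (intro per zX) (simp add: prime_period_def)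
    have lim: "(\<lambda>n. fresh (I n) r / measure \<mu> (I n)) \<longlonglongrightarrow> 1 - ?g" if "p \<le> r" for r
      by (rule fresh_limit_periodic[OF zX p det ne sub l bwd[OF p] that])
    have "0 \<le> 1 - ?g"
      by (rule LIMSEQ_le_const[OF lim[OF order_refl]]) (simp add: fresh_def)
    moreover have "1 - ?g \<le> 1" using Gprod_pos[OF zX, of p] by simp
    ultimately have d01: "0 \<le> 1 - ?g" "1 - ?g \<le> 1" .
    have "?q \<longlonglongrightarrow> ereal (1 - ?g)" by (rule flow_local_escape[OF f f1 det decr ne \<rho> lim d01])
    moreover have "(1 - ?g) / W_const A f \<mu> \<le> 1 - ?g" by (rule shrink[OF d01(1)])
    ultimately show ?thesis using True uniq unfolding g by (intro exI conjI allI impI) (assumption | blast | (drule uniq, simp))+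
  next
    case False
    have z: "(shift_map ^^ j) z \<noteq> z" if "1 \<le> j" for j
    proof
      assume *: "(shift_map ^^ j) z = z"
      define p where "p = (LEAST p. 0 < p \<and> (shift_map ^^ p) z = z)"
      have "0 < p \<and> (shift_map ^^ p) z = z"
        unfolding p_def by (rule LeastI[of _ j]) (use that * in simp)
      moreover have "(shift_map ^^ q) z \<noteq> z" if "0 < q \<and> q < p" for q
        using not_less_Least[of q "\<lambda>p. 0 < p \<and> (shift_map ^^ p) z = z"] that unfolding p_def by blast
      ultimately have "prime_period z p" unfolding prime_period_def by blast
      then show False using False by blast
    qed
    have lim: "(\<lambda>n. fresh (I n) r / measure \<mu> (I n)) \<longlonglongrightarrow> 1" if "0 \<le> r" for r
      by (rule fresh_limit_aperiodic[OF z det ne sub l])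
    have "?q \<longlonglongrightarrow> ereal 1" by (rule flow_local_escape[OF f f1 det decr ne \<rho> lim]) auto
    then show ?thesis using False shrink[of 1] by (intro exI[of _ 1]) auto
  qed
  then show ?thesis using W by blast
qed

end
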